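(* Let $n\ge2$, $1\le k\le n$, and let $\Omega\subseteq\mathbb{R}^n$ be a bounded, strictly $(k-1)$-convex domain with $\partial\Omega\in C^{3,1}$. Let $f:(0,\infty)\to\mathbb{R}$ satisfy: $(\mathbf{f_1})$ $f\in C^1(0,\infty)$, $f>0$ and $f$ is nondecreasing on $(0,\infty)$; $(\mathbf{f_2})$ with $F(\tau)=\int_0^\tau f(s)\,ds$ and $H(\tau)=((k+1)F(\tau))^{1/(k+1)}$, the integral $\Phi(s)=\int_s^\infty\frac{d\tau}{H(\tau)}$ is finite for every $s>0$; $(\mathbf{f_3})$ there is $C_f>0$ with $\lim_{s\to\infty}H'(s)\int_s^\infty\frac{d\tau}{H(\tau)}=C_f$. Let $b$ satisfy: $(\mathbf{b_1})$ $b\in C^{1,1}(\overline\Omega)$ is positive in $\Omega$; $(\mathbf{b_2})$ there exist $\delta_0>0$, a positive nondecreasing function $m\in C^1(0,\delta_0)$ and positive constants $\underline b,\overline b$ with $$\underline b=\liminf_{x\in\Omega,\ d(x)\to0}\frac{b(x)}{m^{k+1}(d(x))}\le\limsup_{x\in\Omega,\ d(x)\to0}\frac{b(x)}{m^{k+1}(d(x))}=\overline b,$$ where $M(t)=\int_0^t m(s)\,ds<\infty$ for $0<t<\delta_0$, and there is $C_m\in[0,\infty)$ with $\lim_{t\to0^+}\big(M(t)/m(t)\big)'=C_m$. Assume $C_f>1-C_m$. Then every viscosity solution $u$ of $S_k(D^2u)=b(x)f(u)$ in $\Omega$, $u=\infty$ on $\partial\Omega$, satisfies $$1\le\liminf_{x\in\Omega,\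 d(x)\to0}\frac{u(x)}{\varphi(\overline\xi M(d(x)))}\quad\text{and}\quad\limsup_{x\in\Omega,\ d(x)\to0}\frac{u(x)}{\varphi(\underline\xi M(d(x)))}\le1,$$ where $$\underline\xi=\left(\frac{\underline b}{L_0(1-C_f^{-1}(1-C_m))}\right)^{1/(k+1)},\qquad \overline\xi=\left(\frac{\overline b}{l_0(1-C_f^{-1}(1-C_m))}\right)^{1/(k+1)}.$$
   Context: $d(x)=\operatorname{dist}(x,\partial\Omega)$. For a symmetric matrix $A$ with eigenvalues $\lambda$, $S_k(A)=\sigma_k(\lambda)$, the $k$-th elementary symmetric function ($\sigma_0=1$). $\Gamma_k=\{\lambda\in\mathbb{R}^n:\sigma_j(\lambda)>0,\ j=1,\dots,k\}$; a $C^2$ function is $k$-admissible if the eigenvalues of its Hessian lie in $\Gamma_k$ everywhere. For $\bar x\in\partial\Omega$, $\rho(\bar x)=(\rho_1(\bar x),\dots,\rho_{n-1}(\bar x))$ are the principal curvatures of $\partial\Omega$ relative to the interior normal; $\Omega$ is strictly $(k-1)$-convex if $\sigma_j(\rho(\bar x))>0$ for $j=1,\dots,k-1$ and all $\bar x\in\partial\Omega$. $L_0=\max_{\bar x\in\partial\Omega}\sigma_{k-1}(\rho(\bar x))$ and $l_0=\min_{\bar x\in\partial\Omega}\sigma_{k-1}(\rho(\bar x))$. The function $\varphi$ is the inverse of $\Phi$, i.e. $\int_{\varphi(t)}^\infty\frac{d\tau}{H(\tau)}=t$ for all $t>0$. A function $u\in C(\Omega)$ is a viscosity subsolution (resp.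 supersolution) of $S_k(D^2u)=b(x)f(u)$ if whenever $x_0\in\Omega$, $A$ is an open neighborhood of $x_0$, $\psi\in C^2(A)$ is $k$-admissible and $u-\psi$ has a local maximum (resp. minimum) at $x_0$, then $S_k(D^2\psi(x_0))\ge b(x_0)f(\psi(x_0))$ (resp. $\le$); a viscosity solution is both. The condition $u=\infty$ on $\partial\Omega$ means $u(x)\to+\infty$ as $d(x)\to0^+$. *)

theory Defs
  imports "HOL-Analysis.Analysis"
begin

definition sigma :: "nat \<Rightarrow> real^'n \<Rightarrow> real" where
  "sigma j lam = (\<Sum>I\<in>{I::'n set. card I = j}. \<Prod>i\<in>I. lam $ i)"

definition diagm :: "real^'n \<Rightarrow> real^'n^'n" where
  "diagm lam = (\<chi> i j. if i = j then lam $ i else 0)"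

definition eigvals :: "real^'n^'n \<Rightarrow> real^'n" where
  "eigvals A = (SOME lam. \<exists>Q. orthogonal_matrix Q \<and> A = Q ** diagm lam ** transpose Q)"

definition Sk :: "nat \<Rightarrow> real^'n^'n \<Rightarrow> real" where
  "Sk j A = sigma j (eigvals A)"

definition Gamma :: "nat \<Rightarrow> (real^'n) set" where
  "Gamma k = {lam. \<forall>j\<in>{1..k}. sigma j lam > 0}"

definition partial :: "'n \<Rightarrow> (real^'n \<Rightarrow> real) \<Rightarrow> real^'n \<Rightarrow> real" where
  "partial i g x = frechet_derivative g (at x) (axis i 1)"

fun pds :: "'n list \<Rightarrow> (real^'n \<Rightarrow> real) \<Rightarrow> real^'n \<Rightarrow> real" where
  "pds [] g = g"
| "pds (i # is) g = partial i (pds is g)"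

definition Ck_on :: "nat \<Rightarrow> (real^'n) set \<Rightarrow> (real^'n \<Rightarrow> real) \<Rightarrow> bool" where
  "Ck_on k S g \<longleftrightarrow>
     (\<forall>is. length is \<le> k \<longrightarrow> continuous_on S (pds is g)) \<and>
     (\<forall>is. length is < k \<longrightarrow> (\<forall>x\<in>S. pds is g differentiable at x))"

definition Ckl_on :: "nat \<Rightarrow> (real^'n) set \<Rightarrow> (real^'n \<Rightarrow> real) \<Rightarrow> bool" where
  "Ckl_on k S g \<longleftrightarrow> Ck_on k S g \<and>
     (\<forall>is. length is = k \<longrightarrow> (\<exists>L. L-lipschitz_on S (pds is g)))"

definition C11_closure :: "(real^'n) set \<Rightarrow> (real^'n \<Rightarrow> real) \<Rightarrow> bool" where
  "C11_closure \<Omega> g \<longleftrightarrow> continuous_on (closure \<Omega>) g \<and> Ckl_on 1 \<Omega> g"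

definition hess :: "(real^'n \<Rightarrow> real) \<Rightarrow> real^'n \<Rightarrow> real^'n^'n" where
  "hess g x = (\<chi> i j. pds [i, j] g x)"

text \<open>Local graph representation of the boundary near xb: in the rotated coordinates
  x = xb + Q y, Omega is locally {y_{i0} > phi(y')} where phi does not depend on y_{i0},
  phi(0)=0, D phi(0)=0.  The principal curvatures (w.r.t. the interior normal) are the
  eigenvalues of D^2 phi(0) on the hyperplane y_{i0}=0; the full n x n Hessian has in
  addition the eigenvalue 0, which does not change sigma_j.\<close>
definition boundary_chart ::
  "(real^'n) set \<Rightarrow> real^'n \<Rightarrow> real^'n^'n \<Rightarrow> 'n \<Rightarrow> (real^'n \<Rightarrow> real) \<Rightarrow> real \<Rightarrow> bool" where
  "boundary_chart \<Omega> xb Q i0 \<phi> r \<longleftrightarrow>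
     orthogonal_matrix Q \<and> 0 < r \<and> \<phi> 0 = 0 \<and> (\<forall>i. partial i \<phi> 0 = 0) \<and>
     (\<forall>y. \<phi> y = \<phi> (y - (y $ i0) *\<^sub>R axis i0 1)) \<and>
     Ck_on 2 (ball 0 r) \<phi> \<and>
     (\<forall>y\<in>ball 0 r. (xb + Q *v y \<in> \<Omega>) \<longleftrightarrow> \<phi> y < y $ i0)"

definition C31_boundary :: "(real^'n) set \<Rightarrow> bool" where
  "C31_boundary \<Omega> \<longleftrightarrow> (\<forall>xb\<in>frontier \<Omega>. \<exists>Q i0 \<phi> r.
      boundary_chart \<Omega> xb Q i0 \<phi> r \<and> Ckl_on 3 (ball 0 r) \<phi>)"

definition curv_sigma :: "(real^'n) set \<Rightarrow> nat \<Rightarrow> real^'n \<Rightarrow> real" where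
  "curv_sigma \<Omega> j xb =
     (let \<phi> = (SOME \<phi>. \<exists>Q i0 r. boundary_chart \<Omega> xb Q i0 \<phi> r) in Sk j (hess \<phi> 0))"

definition strictly_convex_k :: "nat \<Rightarrow> (real^'n) set \<Rightarrow> bool" where
  "strictly_convex_k j \<Omega> \<longleftrightarrow> (\<forall>xb\<in>frontier \<Omega>. \<forall>i\<in>{1..j}. curv_sigma \<Omega> i xb > 0)"

definition L0 :: "nat \<Rightarrow> (real^'n) set \<Rightarrow> real" where
  "L0 k \<Omega> = (SUP xb\<in>frontier \<Omega>. curv_sigma \<Omega> (k - 1) xb)"

definition l0 :: "nat \<Rightarrow> (real^'n) set \<Rightarrow> real" where
  "l0 k \<Omega> = (INF xb\<in>frontier \<Omega>. curv_sigma \<Omega> (k - 1) xb)"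

definition dist_bd :: "(real^'n) set \<Rightarrow> real^'n \<Rightarrow> real" where
  "dist_bd \<Omega> x = infdist x (frontier \<Omega>)"

definition bd_filter :: "(real^'n) set \<Rightarrow> (real^'n) filter" where
  "bd_filter \<Omega> = inf (principal \<Omega>) (filtercomap (dist_bd \<Omega>) (at_right 0))"

definition Fint :: "(real \<Rightarrow> real) \<Rightarrow> real \<Rightarrow> real" where
  "Fint f \<tau> = integral {0..\<tau>} f"

definition Hf :: "nat \<Rightarrow> (real \<Rightarrow> real) \<Rightarrow> real \<Rightarrow> real" where
  "Hf k f \<tau> = (real (k + 1) * Fint f \<tau>) powr (1 / real (k + 1))"

definition Phi :: "nat \<Rightarrow> (real \<Rightarrow> real) \<Rightarrow> real \<Rightarrow> real" where
  "Phi k f s = integral {s..} (\<lambda>\<tau>. 1 / Hf k f \<tau>)"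

definition varphi :: "nat \<Rightarrow> (real \<Rightarrow> real) \<Rightarrow> real \<Rightarrow> real" where
  "varphi k f t = (THE s. 0 < s \<and> Phi k f s = t)"

definition k_admissible_on :: "nat \<Rightarrow> (real^'n) set \<Rightarrow> (real^'n \<Rightarrow> real) \<Rightarrow> bool" where
  "k_admissible_on k A \<psi> \<longleftrightarrow> Ck_on 2 A \<psi> \<and> (\<forall>x\<in>A. eigvals (hess \<psi> x) \<in> Gamma k)"

definition visc_sub ::
  "nat \<Rightarrow> (real^'n \<Rightarrow> real) \<Rightarrow> (real \<Rightarrow> real) \<Rightarrow> (real^'n) set \<Rightarrow> (real^'n \<Rightarrow> real) \<Rightarrow> bool" where
  "visc_sub k b f \<Omega> u \<longleftrightarrow> continuous_on \<Omega> u \<and>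
     (\<forall>x0\<in>\<Omega>. \<forall>A \<psi>. open A \<and> x0 \<in> A \<and> A \<subseteq> \<Omega> \<and> k_admissible_on k A \<psi> \<and> \<psi> x0 = u x0 \<and>
        (\<exists>e>0. \<forall>y\<in>A \<inter> ball x0 e. u y - \<psi> y \<le> u x0 - \<psi> x0)
        \<longrightarrow> Sk k (hess \<psi> x0) \<ge> b x0 * f (\<psi> x0))"

definition visc_super ::
  "nat \<Rightarrow> (real^'n \<Rightarrow> real) \<Rightarrow> (real \<Rightarrow> real) \<Rightarrow> (real^'n) set \<Rightarrow> (real^'n \<Rightarrow> real) \<Rightarrow> bool" where
  "visc_super k b f \<Omega> u \<longleftrightarrow> continuous_on \<Omega> u \<and>
     (\<forall>x0\<in>\<Omega>. \<forall>A \<psi>. open A \<and> x0 \<in> A \<and> A \<subseteq> \<Omega> \<and> k_admissible_on k A \<psi> \<and> \<psi> x0 = u x0 \<and>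
        (\<exists>e>0. \<forall>y\<in>A \<inter> ball x0 e. u y - \<psi> y \<ge> u x0 - \<psi> x0)
        \<longrightarrow> Sk k (hess \<psi> x0) \<le> b x0 * f (\<psi> x0))"

definition visc_sol ::
  "nat \<Rightarrow> (real^'n \<Rightarrow> real) \<Rightarrow> (real \<Rightarrow> real) \<Rightarrow> (real^'n) set \<Rightarrow> (real^'n \<Rightarrow> real) \<Rightarrow> bool" where
  "visc_sol k b f \<Omega> u \<longleftrightarrow> visc_sub k b f \<Omega> u \<and> visc_super k b f \<Omega> u"

end

theory Submission
  imports Defs "HOL-Computational_Algebra.Polynomial"
begin

text \<open>
  The barriers are \<open>g (d \<mp> \<sigma>)\<close> with \<open>g t = \<phi> (\<xi> M t)\<close>.  Since \<open>\<phi>' = - H (\<phi>)\<close>, the formal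
  Hessian of \<open>g (d)\<close> is \<open>\<lambda> (E \<nu> \<nu>\<^sup>T + e C)\<close>, where \<open>\<nu>\<close> is the inner normal, \<open>C\<close> the second
  fundamental form at the nearest boundary point, \<open>E\<close> tends to \<open>\<theta> = 1 - (1 - C\<^sub>m) / C\<^sub>f\<close>, \<open>e\<close> tends
  to 0 and \<open>\<lambda>\<^sup>k e\<^bsup>k-1\<^esup> = \<xi>\<^bsup>k+1\<^esup> m\<^bsup>k+1\<^esup> f (g)\<close>.  Hence \<open>S\<^sub>k\<close> of this matrix is asymptotically
  \<open>\<xi>\<^bsup>k+1\<^esup> \<theta> \<sigma>\<^sub>k\<^sub>-\<^sub>1(\<rho>) m\<^bsup>k+1\<^esup> f (g)\<close>, so the barrier is a strict super- or subsolution as soon as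
  \<open>\<xi>\<close> is smaller or larger than the critical value.

  No smoothness of the distance function \<open>d\<close> is needed: at a point where \<open>u - g (d \<mp> \<sigma>)\<close> is extremal
  it suffices to squeeze \<open>d\<close> between two quadratic polynomials whose tangential Hessians are
  \<open>- C \<mp> \<eta>\<close>, and these yield quadratic test functions.  The lower squeeze uses that
  \<open>|\<nu>(x) \<bullet> (z - x)| \<le> K |z - x|\<^sup>2\<close> on the boundary, which makes nearest points unique.
  Letting \<open>\<sigma>\<close> tend to 0 compares \<open>u\<close> with \<open>g (d)\<close> up to an additive constant, and \<open>\<xi>\<close> may be
  replaced by its critical value because \<open>t\<^bsup>C\<^sub>f+1\<^esup> \<phi> t\<close> is nondecreasing near 0.
\<close>

section \<open>Elementary symmetric functions of the eigenvalues\<close>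

text \<open>Three notions rest on a choice: \<open>eigvals\<close> picks a diagonalization,
  \<open>curv_sigma\<close> picks a chart separately at each boundary point, and
  \<open>varphi\<close> is a definite description. The first choice is removed by passing to the
  coefficients of \<open>det (mat 1 + t A)\<close>, which are continuous in \<open>A\<close>. The
  second is removed by showing that all charts give the same second fundamental form; this yields
  its continuity, and with it uniform constants on the compact boundary. No comparison principle
  between viscosity solutions is invoked: the barrier is explicit, so it suffices to look at an
  extremum of its difference with \<open>u\<close>. The shift by \<open>\<sigma>\<close> makes that
  extremum interior, and the monotonicity of \<open>m\<close> and \<open>f\<close> gives both the
  shift and the sign of the difference the favourable direction. Test functions must be
  k-admissible, so the approximate Hessian has to lie in an open cone and not merely have the right
  \<open>k\<close>-th symmetric function. This is where strict convexity and
  \<open>Cf > 1 - Cm\<close>, that is \<open>\<theta> > 0\<close>, enter.\<close>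

lemma inner_symmetric_matrix:
  fixes A :: "real^'n^'n"
  assumes "transpose A = A"
  shows "(A *v x) \<bullet> y = x \<bullet> (A *v y)"
  by (metis assms dot_lmul_matrix transpose_matrix_vector)

text \<open>A maximizer \<open>x\<close> of the quadratic form on the unit sphere of
  \<open>S\<close> is an eigenvector: the residual \<open>v\<close> lies in \<open>S\<close> and is
  orthogonal to \<open>x\<close>, and moving from \<open>x\<close> in its direction would raise the
  form to first order unless \<open>v\<close> vanishes.\<close>

lemma symmetric_matrix_eigenvector:
  fixes A :: "real^'n^'n"
  assumes sym: "transpose A = A" and S: "subspace S" "S \<noteq> {0}"
    and inv: "\<And>x. x \<in> S \<Longrightarrow> A *v x \<in> S"
  obtains x l where "x \<in> S" "norm x = 1" "A *v x = l *\<^sub>R x"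
proof -
  let ?K = "S \<inter> sphere 0 1"
  have "compact ?K" by (simp add: S(1) closed_subspace closed_Int_compact)
  moreover obtain z where z: "z \<in> S" "z \<noteq> 0" using S subspace_0 by blast
  have "z /\<^sub>R norm z \<in> ?K" using z S(1) by (simp add: subspace_scale)
  then have "?K \<noteq> {}" by blast
  moreover have "continuous_on ?K (\<lambda>x. x \<bullet> (A *v x))"
    by (intro continuous_intros matrix_vector_mult_linear_continuous_on)
  ultimately obtain x where x: "x \<in> ?K" and mx: "\<And>y. y \<in> ?K \<Longrightarrow> y \<bullet> (A *v y) \<le> x \<bullet> (A *v x)"
    using continuous_attains_sup[of ?K "\<lambda>x. x \<bullet> (A *v x)"] by blast
  define l where "l = x \<bullet> (A *v x)"
  have xx: "x \<bullet> x = 1" using x by (simp add: norm_eq_1)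
  have le: "y \<bullet> (A *v y) \<le> l * (y \<bullet> y)" if y: "y \<in> S" for y
  proof (cases "y = 0")
    case False
    have "y /\<^sub>R norm y \<in> ?K" using y S(1) False by (simp add: subspace_scale)
    from mx[OF this] have "(y \<bullet> (A *v y)) / (norm y)\<^sup>2 \<le> l"
      by (simp add: l_def matrix_vector_mult_scaleR field_simps power2_eq_square)
    then show ?thesis using False by (simp add: field_simps power2_norm_eq_inner)
  qed simp
  define v where "v = A *v x - l *\<^sub>R x"
  have vS: "v \<in> S" unfolding v_def using x inv S(1) by (simp add: subspace_diff subspace_scale)
  have vx: "v \<bullet> x = 0" by (simp add: v_def inner_diff xx l_def inner_commute inner_diff_left)
  have q: "2 * t * (v \<bullet> v) \<le> t\<^sup>2 * (l * (v \<bullet> v) - v \<bullet> (A *v v))" for t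
  proof -
    have Av: "x \<bullet> (A *v v) = v \<bullet> v"
      using inner_symmetric_matrix[OF sym, of x v] vx
      by (simp add: v_def[symmetric] inner_diff inner_commute)
        (simp add: v_def inner_diff inner_commute algebra_simps)
    have vA: "v \<bullet> (A *v x) = v \<bullet> v" using inner_symmetric_matrix[OF sym, of v x] Av by (simp add: inner_commute)
    have "x + t *\<^sub>R v \<in> S" using x vS S(1) by (simp add: subspace_add subspace_scale)
    from le[OF this] show ?thesis using vx xx Av vA
      by (simp add: matrix_vector_right_distrib matrix_vector_mult_scaleR inner_add inner_commute[of x v]
        l_def[symmetric] power2_eq_square algebra_simps)
  qed
  have "v \<bullet> v \<le> 0"
  proof (rule ccontr)
    assume "\<not> v \<bullet> v \<le> 0"
    then have p: "v \<bullet> v > 0" by linarith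
    \<comment> \<open>A positive bound for the quadratic coefficient in \<open>q\<close>; at
      \<open>t = (v \<bullet> v) / c\<close> the left side of \<open>q\<close> is twice the bound on
      its right.\<close>
    define c where "c = \<bar>l * (v \<bullet> v) - v \<bullet> (A *v v)\<bar> + 1"
    have c: "c > 0" "l * (v \<bullet> v) - v \<bullet> (A *v v) \<le> c" by (auto simp: c_def)
    have "2 * ((v\<bullet>v)/c) * (v \<bullet> v) \<le> ((v\<bullet>v)/c)\<^sup>2 * c"
      by (rule order_trans[OF q[of "(v\<bullet>v)/c"]]) (intro mult_left_mono c zero_le_power2)
    moreover have "((v\<bullet>v)/c)\<^sup>2 * c = (v\<bullet>v)/c * (v \<bullet> v)" using c by (simp add: power2_eq_square)
    moreover have "(v\<bullet>v)/c * (v \<bullet> v) > 0" using p c by simp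
    ultimately show False by linarith
  qed
  then have "v = 0" by (metis inner_gt_zero_iff not_le)
  then show ?thesis using that[of x l] x by (simp add: v_def)
qed

text \<open>A largest orthonormal set of eigenvectors exists because its cardinality is bounded by
  the dimension. Its orthogonal complement is invariant under the symmetric \<open>A\<close>, so a
  nonzero complement would contain one more unit eigenvector. The set is therefore a basis, and its
  members are the columns of \<open>Q\<close>.\<close>

theorem symmetric_matrix_diagonalizable:
  fixes A :: "real^'n^'n"
  assumes sym: "transpose A = A"
  shows "\<exists>lam Q. orthogonal_matrix Q \<and> A = Q ** diagm lam ** transpose Q"
proof -
  define good where "good B \<longleftrightarrow> pairwise orthogonal B \<and> (\<forall>x\<in>B. norm x = 1) \<and> (\<forall>x\<in>B. \<exists>l. A *v x = l *\<^sub>R x)"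
    for B :: "(real^'n) set"
  have ind: "independent B" if "good B" for B
    using that by (intro pairwise_orthogonal_independent) (auto simp: good_def)
  have fin: "finite B" "card B \<le> CARD('n)" if "good B" for B
    using independent_bound[OF ind[OF that]] by auto
  have "good {}" by (simp add: good_def pairwise_def)
  then obtain B where B: "good B" and mx: "\<And>C. good C \<Longrightarrow> card C \<le> card B"
    using ex_has_greatest_nat[of good "{}" card "CARD('n) + 1"] fin(2) by (metis le_imp_less_Suc add.commute plus_1_eq_Suc)
  define S where "S = {x. \<forall>b\<in>B. b \<bullet> x = 0}"
  have sub: "subspace S" by (auto simp: S_def subspace_def inner_add)
  have "S = {0}"
  proof (rule ccontr)
    assume "S \<noteq> {0}"
    moreover have "A *v x \<in> S" if "x \<in> S" for x
    proof -
      have "b \<bullet> (A *v x) = 0" if b: "b \<in> B" for b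
      proof -
        obtain l where "A *v b = l *\<^sub>R b" using B b by (auto simp: good_def)
        then show ?thesis using \<open>x \<in> S\<close> b inner_symmetric_matrix[OF sym, of b x] by (simp add: S_def)
      qed
      then show ?thesis by (simp add: S_def)
    qed
    ultimately obtain x l where x: "x \<in> S" "norm x = 1" "A *v x = l *\<^sub>R x"
      using symmetric_matrix_eigenvector[OF sym sub] by metis
    have xB: "x \<notin> B" using x by (auto simp: S_def norm_eq_1)
    have "good (insert x B)" using B x by (auto simp: good_def pairwise_insert orthogonal_def S_def inner_commute)
    from mx[OF this] show False using xB fin[OF B] by simp
  qed
  have onb: "b \<bullet> c = (if b = c then 1 else 0)" if "b \<in> B" "c \<in> B" for b c
    using B that by (auto simp: good_def pairwise_def orthogonal_def norm_eq_1)
  have expand: "x = (\<Sum>b\<in>B. (b \<bullet> x) *\<^sub>R b)" for x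
  proof -
    have "x - (\<Sum>b\<in>B. (b \<bullet> x) *\<^sub>R b) \<in> S"
      by (auto simp: S_def inner_diff inner_sum_right onb fin[OF B] if_distrib sum.delta cong: if_cong)
    then show ?thesis using \<open>S = {0}\<close> by simp
  qed
  have "x \<in> span B" for x
    by (subst expand) (intro span_sum span_scale span_base)
  then have "span B = UNIV" by blast
  then have card: "card B = CARD('n)"
    using dim_eq_card[of B UNIV] ind[OF B] by (simp add: dim_UNIV)
  then obtain \<beta> where \<beta>: "bij_betw \<beta> (UNIV::'n set) B"
    using fin[OF B] finite_same_card_bij[of "UNIV::'n set" B] by auto
  have \<beta>B: "\<beta> j \<in> B" for j using \<beta> by (auto simp: bij_betw_def)
  have \<beta>i: "\<beta> i = \<beta> j \<longleftrightarrow> i = j" for i j using \<beta> by (auto simp: bij_betw_def inj_on_def)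
  have "\<forall>j. \<exists>l. A *v \<beta> j = l *\<^sub>R \<beta> j" using B \<beta>B by (auto simp: good_def)
  then obtain lam where lam: "\<And>j. A *v \<beta> j = lam j *\<^sub>R \<beta> j"
    using choice[of "\<lambda>j l. A *v \<beta> j = l *\<^sub>R \<beta> j"] by blast
  define Q where "Q = (\<chi> i j. \<beta> j $ i)"
  have "(transpose Q ** Q) $ i $ j = mat 1 $ i $ j" for i j
  proof -
    have "(transpose Q ** Q) $ i $ j = \<beta> i \<bullet> \<beta> j"
      by (simp add: matrix_matrix_mult_def transpose_def Q_def inner_vec_def)
    also have "\<dots> = mat 1 $ i $ j" unfolding onb[OF \<beta>B \<beta>B] \<beta>i by (simp add: mat_def)
    finally show ?thesis .
  qed
  then have "transpose Q ** Q = mat 1" by (simp add: vec_eq_iff)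
  then have oQ: "orthogonal_matrix Q" by (simp add: orthogonal_matrix)
  then have QQ: "Q ** transpose Q = mat 1" by (simp add: orthogonal_matrix_def)
  have "A ** Q = Q ** diagm (\<chi> j. lam j)"
  proof -
    have "(A ** Q) $ i $ j = (Q ** diagm (\<chi> j. lam j)) $ i $ j" for i j
    proof -
      have "(A ** Q) $ i $ j = (A *v \<beta> j) $ i"
        by (simp add: matrix_matrix_mult_def matrix_vector_mult_def Q_def)
      also have "\<dots> = lam j * \<beta> j $ i" by (simp add: lam)
      also have "\<dots> = (Q ** diagm (\<chi> j. lam j)) $ i $ j"
        by (simp add: matrix_matrix_mult_def Q_def diagm_def if_distrib cong: if_cong)
      finally show ?thesis .
    qed
    then show ?thesis by (simp add: vec_eq_iff)
  qed
  then have "A = Q ** diagm (\<chi> j. lam j) ** transpose Q"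
    by (metis QQ matrix_mul_assoc matrix_mul_rid)
  with oQ show ?thesis by blast
qed

section \<open>Elementary symmetric functions as coefficients of
  \<open>det (mat 1 + t A)\<close>\<close>

definition charmat :: "real^'n^'n \<Rightarrow> real poly^'n^'n" where
  "charmat A = (\<chi> i j. [:if i = j then 1 else 0, A $ i $ j:])"

text \<open>For symmetric \<open>A\<close> this is \<open>Sk j A\<close>, but as a polynomial in the
  entries of \<open>A\<close>; continuity and conjugation invariance can then be proved without
  following the eigenvalues.\<close>

definition csig :: "nat \<Rightarrow> real^'n^'n \<Rightarrow> real" where
  "csig j A = coeff (det (charmat A)) j"

lemma poly_det_charmat: "poly (det (charmat A)) t = det (mat 1 + t *\<^sub>R A)"
proof -
  have "poly (of_int (sign p)) t = of_int (sign p)" for p :: "'n \<Rightarrow> 'n"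
    by (simp add: sign_def)
  then show ?thesis
    by (simp add: det_def poly_sum poly_prod charmat_def mat_def)
qed

lemma csig_eqI:
  assumes "\<And>t. det (mat 1 + t *\<^sub>R A) = poly p t"
  shows "csig j A = coeff p j"
proof -
  have "det (charmat A) = p"
    using assms by (simp add: poly_eq_poly_eq_iff[symmetric] fun_eq_iff poly_det_charmat)
  then show ?thesis by (simp add: csig_def)
qed

text \<open>One further linear factor expresses a coefficient through two coefficients of the
  shorter product, so the induction runs over all \<open>j\<close> at once.\<close>

lemma continuous_on_coeff_prod:
  fixes c d :: "'i \<Rightarrow> 'a::topological_space \<Rightarrow> real"
  assumes "finite I" "\<And>i. i \<in> I \<Longrightarrow> continuous_on X (c i)" "\<And>i. i \<in> I \<Longrightarrow> continuous_on X (d i)"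
  shows "continuous_on X (\<lambda>x. coeff (\<Prod>i\<in>I. [:c i x, d i x:]) j)"
  using assms
proof (induction I arbitrary: j rule: finite_induct)
  case empty
  then show ?case by (simp add: continuous_on_const)
next
  case (insert a I)
  have "continuous_on X (\<lambda>x. c a x * coeff (\<Prod>i\<in>I. [:c i x, d i x:]) j +
      coeff (pCons 0 (smult (d a x) (\<Prod>i\<in>I. [:c i x, d i x:]))) j)"
    using insert by (cases j) (auto intro!: continuous_intros)
  then show ?case using insert by (simp add: mult.commute)
qed

lemma continuous_on_csig: "continuous_on X (csig j)"
proof -
  have s: "coeff (of_int (sign p) * q) j = of_int (sign p) * coeff q j" for p :: "'n \<Rightarrow> 'n" and q :: "real poly"
    by (simp add: sign_def)
  show ?thesis
    unfolding csig_def[abs_def] det_def coeff_sum s charmat_def vec_lambda_beta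
    by (intro continuous_intros continuous_on_coeff_prod) auto
qed

lemma matrix_mult_add_rdistrib: "(A + B) ** C = A ** C + B ** (C::'a::semiring_1^'m^'k)"
  by (simp add: matrix_matrix_mult_def vec_eq_iff sum.distrib algebra_simps)

lemma det_orthogonal_conj:
  fixes A :: "real^'n^'n"
  assumes "orthogonal_matrix Q"
  shows "det (mat 1 + t *\<^sub>R (Q ** A ** transpose Q)) = det (mat 1 + t *\<^sub>R A)"
proof -
  have QQ: "Q ** transpose Q = mat 1" using assms by (simp add: orthogonal_matrix_def)
  have "mat 1 + t *\<^sub>R (Q ** A ** transpose Q) = Q ** (mat 1 + t *\<^sub>R A) ** transpose Q"
    by (simp add: matrix_add_ldistrib matrix_mult_add_rdistrib QQ matrix_scalar_ac scalar_matrix_assoc)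
  moreover have "det Q * det (transpose Q) = 1"
    by (metis QQ det_I det_mul)
  ultimately show ?thesis by (simp add: det_mul)
qed

lemma csig_orthogonal_conj:
  assumes "orthogonal_matrix Q"
  shows "csig j (Q ** A ** transpose Q) = csig j A"
  using det_orthogonal_conj[OF assms, of _ A] csig_eqI[of "Q ** A ** transpose Q" "det (charmat A)" j]
  by (simp add: poly_det_charmat csig_def)

text \<open>The determinant is the product of the factors \<open>1 + t * lam $ i\<close>. Choosing
  the linear term exactly for \<open>i \<in> I\<close> indexes the expansion by subsets, and
  \<open>I\<close> contributes in degree \<open>card I\<close>.\<close>

lemma csig_diagm: "csig j (diagm lam) = sigma j lam"
proof -
  define p where "p = (\<Prod>i\<in>UNIV. [:1, lam $ i:])"
  have "det (mat 1 + t *\<^sub>R diagm lam) = poly p t" for t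
    by (subst det_diagonal) (auto simp: mat_def diagm_def p_def poly_prod)
  then have "csig j (diagm lam) = coeff p j" by (rule csig_eqI)
  also have "p = (\<Sum>I\<in>Pow UNIV. (\<Prod>i\<in>I. monom (lam $ i) 1) * (\<Prod>i\<in>UNIV-I. 1))"
    unfolding p_def by (subst prod_add[symmetric]) (auto simp: monom_altdef one_pCons)
  also have "\<dots> = (\<Sum>I\<in>Pow UNIV. monom (\<Prod>i\<in>I. lam $ i) (card I))"
  proof -
    have "(\<Prod>i\<in>I. monom (lam $ i) 1) = monom (\<Prod>i\<in>I. lam $ i) (card I)" if "finite I" for I
      using that by (induction I rule: finite_induct) (auto simp: mult_monom)
    then show ?thesis by simp
  qed
  also have "coeff \<dots> j = (\<Sum>I\<in>Pow UNIV. if card I = j then (\<Prod>i\<in>I. lam $ i) else 0)"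
    by (simp add: coeff_sum)
  also have "\<dots> = sigma j lam"
    unfolding sigma_def by (subst sum.inter_filter[symmetric]) auto
  finally show ?thesis .
qed

text \<open>The spectral theorem makes the choice in \<open>eigvals\<close> a genuine
  diagonalization, and conjugation invariance makes the value independent of which one is
  chosen.\<close>

lemma csig_eigvals:
  assumes "transpose A = A"
  shows "sigma j (eigvals A) = csig j A"
proof -
  have "\<exists>Q. orthogonal_matrix Q \<and> A = Q ** diagm (eigvals A) ** transpose Q"
    unfolding eigvals_def using symmetric_matrix_diagonalizable[OF assms] by (rule someI_ex)
  then show ?thesis by (metis csig_orthogonal_conj csig_diagm)
qed

lemma Sk_eq_csig: "transpose A = A \<Longrightarrow> Sk j A = csig j A"
  by (simp add: Sk_def csig_eigvals)

section \<open>Symmetric functions under a rank-one perturbation\<close>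

definition outer :: "real^'n \<Rightarrow> real^'n^'n" where
  "outer v = (\<chi> i j. v $ i * v $ j)"

lemma outer_mult_vec: "outer v *v x = (v \<bullet> x) *\<^sub>R v"
  by (simp add: outer_def matrix_vector_mult_def vec_eq_iff inner_vec_def sum_distrib_left sum_distrib_right mult_ac)

lemma transpose_outer [simp]: "transpose (outer v) = outer v"
  by (simp add: outer_def transpose_def vec_eq_iff mult.commute)

text \<open>A rotation that carries a coordinate axis to \<open>v\<close> makes the matrix
  diagonal.\<close>

lemma det_rank_one:
  fixes v :: "real^'n"
  assumes "norm v = 1"
  shows "det (mat 1 + s *\<^sub>R outer v) = 1 + s"
proof -
  obtain k :: 'n where True by simp
  obtain Q where Q: "orthogonal_matrix Q" "Q *v axis k 1 = v"
    using orthogonal_matrix_exists_basis[OF assms] by metis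
  have e: "outer (axis k 1) = diagm (axis k (1::real))"
    by (auto simp: outer_def diagm_def axis_def vec_eq_iff)
  have "outer v = Q ** outer (axis k 1) ** transpose Q"
  proof -
    have "Q ** outer (axis k 1) ** transpose Q *v x = outer v *v x" for x
      using Q(2) by (simp add: outer_mult_vec matrix_vector_mul_assoc[symmetric] matrix_vector_mult_scaleR)
        (metis Q(2) dot_lmul_matrix inner_commute transpose_matrix_vector)
    then show ?thesis by (simp add: matrix_eq)
  qed
  then have "det (mat 1 + s *\<^sub>R outer v) = det (mat 1 + s *\<^sub>R outer (axis k (1::real)))"
    using det_orthogonal_conj[OF Q(1)] by metis
  also have "\<dots> = (\<Prod>i\<in>UNIV. 1 + s * axis k 1 $ i)"
    unfolding e by (subst det_diagonal) (auto simp: mat_def diagm_def)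
  also have "\<dots> = (\<Prod>i\<in>UNIV. if i = k then 1 + s else 1)"
    by (rule prod.cong) (auto simp: axis_def)
  also have "\<dots> = 1 + s" by (simp add: prod.delta)
  finally show ?thesis .
qed

text \<open>Because \<open>C\<close> kills \<open>v\<close>, the matrix
  \<open>mat 1 + t (a v v^T + c C)\<close> factors into \<open>mat 1 + t c C\<close> and
  \<open>mat 1 + t a v v^T\<close>, so the generating polynomial is \<open>1 + a t\<close> times
  that of \<open>C\<close> at \<open>c t\<close>. This is how the \<open>k\<close>-th symmetric
  function of a radial Hessian produces the curvature function of order
  \<open>k - 1\<close>.\<close>

lemma csig_Suc_rank_one:
  fixes v :: "real^'n"
  assumes "norm v = 1" "C *v v = 0"
  shows "csig (Suc j) (a *\<^sub>R outer v + c *\<^sub>R C) = c ^ j * (c * csig (Suc j) C + a * csig j C)"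
proof -
  define p where "p = det (charmat C)"
  define q where "q = pcompose p [:0, c:]"
  have C0: "C ** outer v = 0"
  proof -
    have "(C ** outer v) *v x = 0 *v x" for x
      by (simp add: matrix_vector_mul_assoc[symmetric] outer_mult_vec matrix_vector_mult_scaleR assms)
    then show ?thesis by (simp add: matrix_eq)
  qed
  have "det (mat 1 + t *\<^sub>R (a *\<^sub>R outer v + c *\<^sub>R C)) = poly ([:1, a:] * q) t" for t
  proof -
    have "mat 1 + t *\<^sub>R (a *\<^sub>R outer v + c *\<^sub>R C) = (mat 1 + (t * c) *\<^sub>R C) ** (mat 1 + (t * a) *\<^sub>R outer v)"
      by (simp add: matrix_add_ldistrib matrix_mult_add_rdistrib C0 matrix_scalar_ac scalar_matrix_assoc[symmetric] scaleR_add_right)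
    then show ?thesis
      by (simp add: det_mul det_rank_one[OF assms(1)] q_def poly_pcompose p_def poly_det_charmat algebra_simps)
  qed
  then have "csig (Suc j) (a *\<^sub>R outer v + c *\<^sub>R C) = coeff ([:1, a:] * q) (Suc j)" by (rule csig_eqI)
  moreover have "coeff q i = c ^ i * csig i C" for i
    by (simp add: q_def coeff_pcompose_linear p_def csig_def)
  ultimately show ?thesis by (simp add: algebra_simps)
qed

lemma csig_0 [simp]: "csig 0 A = 1"
proof -
  have "csig 0 A = poly (det (charmat A)) 0" by (simp add: csig_def poly_0_coeff_0)
  then show ?thesis by (simp add: poly_det_charmat)
qed

section \<open>Second order Taylor expansions\<close>

lemma matrix_vector_norm_bound: "norm (A *v x) \<le> norm (A::real^'n^'m) * norm x"
proof -
  have "norm (A *v x) = L2_set (\<lambda>i. \<bar>A $ i \<bullet> x\<bar>) UNIV"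
    by (simp add: norm_vec_def matrix_vector_mult_def inner_vec_def)
  also have "\<dots> \<le> L2_set (\<lambda>i. norm (A $ i) * norm x) UNIV"
    by (intro L2_set_mono Cauchy_Schwarz_ineq2) auto
  also have "\<dots> = norm A * norm x"
    by (simp add: norm_vec_def[of A] L2_set_left_distrib)
  finally show ?thesis .
qed

lemma linear_sum_axis:
  fixes L :: "real^'n \<Rightarrow> real"
  assumes "linear L"
  shows "L h = (\<chi> i. L (axis i 1)) \<bullet> h"
proof -
  have "L h = L (\<Sum>i\<in>UNIV. h $ i *s axis i 1)" by (simp only: basis_expansion)
  also have "\<dots> = (\<Sum>i\<in>UNIV. h $ i * L (axis i 1))"
    by (simp add: linear_sum[OF assms] linear_cmul[OF assms] scalar_mult_eq_scaleR)
  finally show ?thesis by (simp add: inner_vec_def mult.commute)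
qed

lemma has_derivative_gradient:
  fixes g :: "real^'n \<Rightarrow> real"
  assumes "g differentiable at x"
  shows "(g has_derivative (\<lambda>h. (\<chi> i. partial i g x) \<bullet> h)) (at x)"
proof -
  have d: "(g has_derivative frechet_derivative g (at x)) (at x)"
    using assms by (simp add: frechet_derivative_works)
  have "frechet_derivative g (at x) = (\<lambda>h. (\<chi> i. partial i g x) \<bullet> h)"
    unfolding partial_def by (rule ext) (rule linear_sum_axis[OF has_derivative_linear[OF d]])
  with d show ?thesis by simp
qed

lemma has_derivative_vec_lambda:
  fixes f :: "'i::finite \<Rightarrow> 'a::real_normed_vector \<Rightarrow> real"
  assumes "\<And>i. (f i has_derivative f' i) (at x)"
  shows "((\<lambda>x. \<chi> i. f i x) has_derivative (\<lambda>h. \<chi> i. f' i h)) (at x)"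
  using assms by (subst has_derivative_componentwise_within) (auto simp: Basis_vec_def inner_axis)

lemma partial_has_derivative:
  assumes "(g has_derivative g') (at x)"
  shows "partial i g x = g' (axis i 1)"
  unfolding partial_def using frechet_derivative_at[OF assms] by simp

lemma has_real_derivative_along:
  fixes g :: "'a::real_normed_vector \<Rightarrow> real"
  assumes "(g has_derivative g') (at (z + s *\<^sub>R v))"
  shows "((\<lambda>s. g (z + s *\<^sub>R v)) has_real_derivative g' v) (at s)"
proof -
  have "((\<lambda>s. z + s *\<^sub>R v) has_derivative (\<lambda>h. h *\<^sub>R v)) (at s)"
    by (auto intro!: derivative_eq_intros)
  from has_derivative_compose[OF this assms]
  have "((\<lambda>s. g (z + s *\<^sub>R v)) has_derivative (\<lambda>h. g' (h *\<^sub>R v))) (at s)" .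
  moreover have "(\<lambda>h. g' (h *\<^sub>R v)) = (*) (g' v)"
    using linear_cmul[OF has_derivative_linear[OF assms]] by (auto simp: mult.commute)
  ultimately show ?thesis by (simp add: has_field_derivative_def)
qed

text \<open>The mean value theorem is applied first in direction \<open>i\<close> and then in
  direction \<open>j\<close>. The second difference is symmetric in the two directions, whereas the
  order of the partial derivatives reflects which one was treated first.\<close>

lemma second_difference:
  fixes g :: "real^'n \<Rightarrow> real"
  assumes s: "0 < s" "cball x (2 * s) \<subseteq> S"
    and d1: "\<And>y. y \<in> S \<Longrightarrow> g differentiable at y"
    and d2: "\<And>y. y \<in> S \<Longrightarrow> partial i g differentiable at y"
  shows "\<exists>y\<in>cball x (2 * s). g (x + s *\<^sub>R axis i 1 + s *\<^sub>R axis j 1) - g (x + s *\<^sub>R axis i 1)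
     - g (x + s *\<^sub>R axis j 1) + g x = s\<^sup>2 * partial j (partial i g) y"
proof -
  define e where "e i = (axis i 1 :: real^'n)" for i
  have ne: "norm (e i) = 1" for i by (simp add: e_def)
  have inb: "x + a *\<^sub>R e i + b *\<^sub>R e j \<in> cball x (2 * s)" if "\<bar>a\<bar> \<le> s" "\<bar>b\<bar> \<le> s" for a b
  proof -
    have "norm (a *\<^sub>R e i + b *\<^sub>R e j) \<le> \<bar>a\<bar> + \<bar>b\<bar>"
      using norm_triangle_ineq[of "a *\<^sub>R e i" "b *\<^sub>R e j"] ne by simp
    moreover have "dist x (x + a *\<^sub>R e i + b *\<^sub>R e j) = norm (a *\<^sub>R e i + b *\<^sub>R e j)"
      by (metis add.assoc add_diff_cancel_left' dist_commute dist_norm)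
    ultimately show ?thesis using that by simp
  qed
  have inS: "x + a *\<^sub>R e i + b *\<^sub>R e j \<in> S" if "\<bar>a\<bar> \<le> s" "\<bar>b\<bar> \<le> s" for a b
    using inb that s by blast
  have D: "(g has_derivative (\<lambda>h. frechet_derivative g (at y) h)) (at y)" if "y \<in> S" for y
    using d1[OF that] by (simp add: frechet_derivative_works)
  have D2: "(partial i g has_derivative (\<lambda>h. frechet_derivative (partial i g) (at y) h)) (at y)" if "y \<in> S" for y
    using d2[OF that] by (simp add: frechet_derivative_works)
  define p where "p a = g (x + s *\<^sub>R e j + a *\<^sub>R e i) - g (x + a *\<^sub>R e i)" for a
  have "\<exists>z>0. z < s \<and> p s - p 0 = (s - 0) * (partial i g (x + s *\<^sub>R e j + z *\<^sub>R e i) - partial i g (x + z *\<^sub>R e i))"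
  proof (rule MVT2)
    fix a assume a: "0 \<le> a" "a \<le> s"
    show "DERIV p a :> partial i g (x + s *\<^sub>R e j + a *\<^sub>R e i) - partial i g (x + a *\<^sub>R e i)"
      unfolding p_def partial_def e_def[symmetric]
      by (intro DERIV_diff has_real_derivative_along D)
        (use inS[of a s] inS[of a 0] a s in \<open>auto simp: algebra_simps\<close>)
  qed (use s in auto)
  then obtain z where z: "0 < z" "z < s"
    "p s - p 0 = s * (partial i g (x + s *\<^sub>R e j + z *\<^sub>R e i) - partial i g (x + z *\<^sub>R e i))" by auto
  define q where "q b = partial i g (x + z *\<^sub>R e i + b *\<^sub>R e j)" for b
  have "\<exists>w>0. w < s \<and> q s - q 0 = (s - 0) * partial j (partial i g) (x + z *\<^sub>R e i + w *\<^sub>R e j)"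
  proof (rule MVT2)
    fix b assume b: "0 \<le> b" "b \<le> s"
    show "DERIV q b :> partial j (partial i g) (x + z *\<^sub>R e i + b *\<^sub>R e j)"
      unfolding q_def partial_def[of j] e_def[symmetric]
      by (intro has_real_derivative_along D2) (use inS[of z b] z b in auto)
  qed (use s in auto)
  then obtain w where w: "0 < w" "w < s" "q s - q 0 = s * partial j (partial i g) (x + z *\<^sub>R e i + w *\<^sub>R e j)" by auto
  have "g (x + s *\<^sub>R axis i 1 + s *\<^sub>R axis j 1) - g (x + s *\<^sub>R axis i 1)
     - g (x + s *\<^sub>R axis j 1) + g x = p s - p 0"
    by (simp add: p_def e_def algebra_simps)
  also have "\<dots> = s * (q s - q 0)" unfolding z(3) by (simp add: q_def algebra_simps)
  also have "\<dots> = s\<^sup>2 * partial j (partial i g) (x + z *\<^sub>R e i + w *\<^sub>R e j)"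
    unfolding w(3) by (simp add: power2_eq_square)
  finally show ?thesis using inb[of z w] z w by auto
qed

text \<open>Both iterated partials, at points close to \<open>x\<close>, equal the same second
  difference divided by \<open>s\<^sup>2\<close>; continuity forces them to agree at
  \<open>x\<close>. The symmetry of \<open>hess\<close> depends on this, since \<open>Ck_on\<close>
  speaks only of iterated partials.\<close>

lemma mixed_partials_commute:
  fixes g :: "real^'n \<Rightarrow> real"
  assumes S: "open S" "x \<in> S" and C: "Ck_on 2 S g"
  shows "partial j (partial i g) x = partial i (partial j g) x"
proof (rule ccontr)
  define P where "P = (\<lambda>y. partial j (partial i g) y)"
  define R where "R = (\<lambda>y. partial i (partial j g) y)"
  assume "partial j (partial i g) x \<noteq> partial i (partial j g) x"
  then have e: "\<bar>P x - R x\<bar> / 2 > 0" by (simp add: P_def R_def)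
  have d1: "g differentiable at y" if "y \<in> S" for y
    using C that unfolding Ck_on_def by (metis list.size(3) pds.simps(1) pos2)
  have d2: "partial l g differentiable at y" if "y \<in> S" for y l
  proof -
    have "length [l] < 2" by simp
    then have "pds [l] g differentiable at y" using C that unfolding Ck_on_def by blast
    then show ?thesis by simp
  qed
  have c2: "continuous_on S (partial a (partial l g))" for a l
  proof -
    have "length [a,l] \<le> 2" by simp
    then have "continuous_on S (pds [a,l] g)" using C unfolding Ck_on_def by blast
    then show ?thesis by simp
  qed
  have "isCont P x" "isCont R x"
    using c2 S by (auto simp: P_def R_def continuous_on_eq_continuous_at)
  then obtain r1 r2 where r: "r1 > 0" "\<And>y. dist y x < r1 \<Longrightarrow> \<bar>P y - P x\<bar> < \<bar>P x - R x\<bar> / 2"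
      "r2 > 0" "\<And>y. dist y x < r2 \<Longrightarrow> \<bar>R y - R x\<bar> < \<bar>P x - R x\<bar> / 2"
    using e unfolding continuous_at_eps_delta dist_real_def by metis
  obtain r3 where r3: "r3 > 0" "cball x r3 \<subseteq> S" using S open_contains_cball by blast
  define s where "s = min r3 (min r1 r2) / 4"
  have s: "0 < s" "2 * s < r1" "2 * s < r2" "2 * s \<le> r3" using r r3 by (auto simp: s_def)
  have sub: "cball x (2 * s) \<subseteq> S" using r3 s by (meson order_trans subset_cball)
  obtain y where y: "y \<in> cball x (2 * s)" "g (x + s *\<^sub>R axis i 1 + s *\<^sub>R axis j 1) - g (x + s *\<^sub>R axis i 1)
     - g (x + s *\<^sub>R axis j 1) + g x = s\<^sup>2 * P y"
    using second_difference[OF s(1) sub d1 d2, where i=i and j=j] unfolding P_def by auto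
  obtain z where z: "z \<in> cball x (2 * s)" "g (x + s *\<^sub>R axis j 1 + s *\<^sub>R axis i 1) - g (x + s *\<^sub>R axis j 1)
     - g (x + s *\<^sub>R axis i 1) + g x = s\<^sup>2 * R z"
    using second_difference[OF s(1) sub d1 d2, where i=j and j=i] unfolding R_def by auto
  have "s\<^sup>2 * P y = s\<^sup>2 * R z" using y(2) z(2) by (simp add: algebra_simps)
  then have "P y = R z" using s by simp
  moreover have "\<bar>P y - P x\<bar> < \<bar>P x - R x\<bar> / 2" using y(1) s by (intro r) (auto simp: dist_commute)
  moreover have "\<bar>R z - R x\<bar> < \<bar>P x - R x\<bar> / 2" using z(1) s by (intro r) (auto simp: dist_commute)
  moreover have "\<bar>P x - R x\<bar> \<le> \<bar>P y - P x\<bar> + \<bar>P y - R x\<bar>"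
    using abs_triangle_ineq4[of "P y - R x" "P y - P x"] by simp
  moreover have "\<And>a b c::real. a < c / 2 \<Longrightarrow> b < c / 2 \<Longrightarrow> c \<le> a + b \<Longrightarrow> False" by linarith
  ultimately show False by metis
qed

text \<open>Gradient \<open>G\<close> and Hessian \<open>D\<close> are carried as data with full
  derivatives, so that a rigid change of coordinates is a plain chain rule instead of a computation
  with iterated partials.\<close>

definition C2fun :: "(real^'n) set \<Rightarrow> (real^'n \<Rightarrow> real) \<Rightarrow> (real^'n \<Rightarrow> real^'n) \<Rightarrow> (real^'n \<Rightarrow> real^'n^'n) \<Rightarrow> bool" where
  "C2fun U g G D \<longleftrightarrow> open U \<and> (\<forall>x\<in>U. (g has_derivative (\<lambda>h. G x \<bullet> h)) (at x)) \<and>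
     (\<forall>x\<in>U. (G has_derivative (\<lambda>h. D x *v h)) (at x)) \<and>
     continuous_on U D \<and> (\<forall>x\<in>U. transpose (D x) = D x)"

lemma Ck_on_2_C2fun:
  assumes S: "open S" and C: "Ck_on 2 S g"
  shows "C2fun S g (\<lambda>x. \<chi> i. partial i g x) (hess g)"
proof -
  have sym: "hess g x $ i $ j = hess g x $ j $ i" if "x \<in> S" for x i j
    using mixed_partials_commute[OF S that C] by (simp add: hess_def)
  have d1: "g differentiable at y" if "y \<in> S" for y
    using C that unfolding Ck_on_def by (metis list.size(3) pds.simps(1) pos2)
  have d2: "partial l g differentiable at y" if "y \<in> S" for y l
  proof -
    have "length [l] < 2" by simp
    then have "pds [l] g differentiable at y" using C that unfolding Ck_on_def by blast
    then show ?thesis by simp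
  qed
  have G: "((\<lambda>x. \<chi> i. partial i g x) has_derivative (\<lambda>h. hess g x *v h)) (at x)" if x: "x \<in> S" for x
  proof -
    have "((\<lambda>x. \<chi> i. partial i g x) has_derivative (\<lambda>h. \<chi> i. (\<chi> j. partial j (partial i g) x) \<bullet> h)) (at x)"
      using has_derivative_gradient[OF d2[OF x]] by (rule has_derivative_vec_lambda)
    moreover have "(\<lambda>h. \<chi> i. (\<chi> j. partial j (partial i g) x) \<bullet> h) = (\<lambda>h. hess g x *v h)"
      using sym[OF x] by (auto simp: hess_def matrix_vector_mult_def inner_vec_def vec_eq_iff)
    ultimately show ?thesis by simp
  qed
  have "continuous_on S (pds [i, j] g)" for i j
  proof -
    have "length [i, j] \<le> 2" by simp
    then show ?thesis using C unfolding Ck_on_def by blast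
  qed
  then have "continuous_on S (hess g)"
    unfolding hess_def by (intro continuous_on_vec_lambda) simp
  then show ?thesis
    unfolding C2fun_def using S has_derivative_gradient[OF d1] G sym
    by (auto simp: transpose_def vec_eq_iff)
qed

lemma C2fun_grad_cont: "C2fun U g G D \<Longrightarrow> continuous_on U G"
  unfolding C2fun_def by (meson continuous_at_imp_continuous_on has_derivative_continuous)

lemma C2fun_cont: "C2fun U g G D \<Longrightarrow> continuous_on U g"
  unfolding C2fun_def by (meson continuous_at_imp_continuous_on has_derivative_continuous)

text \<open>Subtracting the quadratic Taylor polynomial along the segment leaves a function whose
  derivative is controlled by the first order expansion of \<open>G\<close> at \<open>x\<close>; the
  mean value theorem does the rest.\<close>

lemma C2fun_taylor:
  assumes C: "C2fun U g G D" and x: "x \<in> U" and e: "e > 0"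
  shows "\<exists>r>0. \<forall>h. norm h < r \<longrightarrow>
     \<bar>g (x + h) - g x - G x \<bullet> h - (h \<bullet> (D x *v h)) / 2\<bar> \<le> e * (norm h)\<^sup>2"
proof -
  have "(G has_derivative (\<lambda>h. D x *v h)) (at x)" using C x by (simp add: C2fun_def)
  then obtain d where d: "d > 0" "\<And>y. norm (y - x) < d \<Longrightarrow> norm (G y - G x - D x *v (y - x)) \<le> e * norm (y - x)"
    using e unfolding has_derivative_at_alt by blast
  obtain d' where d': "d' > 0" "ball x d' \<subseteq> U" using C x by (auto simp: C2fun_def open_contains_ball)
  have "\<bar>g (x + h) - g x - G x \<bullet> h - (h \<bullet> (D x *v h)) / 2\<bar> \<le> e * (norm h)\<^sup>2" if h: "norm h < min d d'" for h
  proof -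
    define q where "q t = g (x + t *\<^sub>R h) - t * (G x \<bullet> h) - t\<^sup>2 * (h \<bullet> (D x *v h)) / 2" for t
    define q' where "q' t = (G (x + t *\<^sub>R h) - G x - t *\<^sub>R (D x *v h)) \<bullet> h" for t
    have nt: "norm (t *\<^sub>R h) \<le> norm h" if "0 \<le> t" "t \<le> 1" for t
      using that by (simp add: mult_left_le_one_le)
    have "\<exists>z>0. z < 1 \<and> q 1 - q 0 = (1 - 0) * q' z"
    proof (rule MVT2)
      fix t :: real assume t: "0 \<le> t" "t \<le> 1"
      have "norm (t *\<^sub>R h) < d'" using nt[OF t] h by simp
      then have "x + t *\<^sub>R h \<in> ball x d'" by (simp add: dist_norm)
      then have "x + t *\<^sub>R h \<in> U" using d' by blast
      then have "((\<lambda>t. g (x + t *\<^sub>R h)) has_real_derivative G (x + t *\<^sub>R h) \<bullet> h) (at t)"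
        using C by (intro has_real_derivative_along) (simp add: C2fun_def)
      then show "DERIV q t :> q' t"
        unfolding q_def q'_def
        by (auto intro!: derivative_eq_intros simp: inner_diff_left inner_commute algebra_simps)
    qed simp
    then obtain z where z: "0 < z" "z < 1" "q 1 - q 0 = q' z" by auto
    have "norm (G (x + z *\<^sub>R h) - G x - z *\<^sub>R (D x *v h)) \<le> e * norm (z *\<^sub>R h)"
      using d(2)[of "x + z *\<^sub>R h"] nt[of z] z h by (simp add: matrix_vector_mult_scaleR)
    also have "\<dots> \<le> e * norm h" using nt[of z] z e by (simp add: mult_left_mono)
    finally have "\<bar>q' z\<bar> \<le> e * norm h * norm h"
      unfolding q'_def by (meson Cauchy_Schwarz_ineq2 mult_right_mono norm_ge_zero order_trans)
    then show ?thesis using z(3) by (simp add: q_def power2_eq_square algebra_simps)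
  qed
  then show ?thesis using d d' by (intro exI[of _ "min d d'"]) auto
qed

text \<open>Here the base point varies as well. A bound for \<open>D\<close> near \<open>x\<close>
  makes \<open>G\<close> Lipschitz on a ball, and the mean value theorem on a segment turns this
  into a quadratic error with one constant.\<close>

lemma C2fun_quadratic_bound:
  assumes C: "C2fun U g G D" and x: "x \<in> U"
  shows "\<exists>r>0. \<exists>K. ball x r \<subseteq> U \<and> (\<forall>y\<in>ball x r. \<forall>z\<in>ball x r. \<bar>g z - g y - G y \<bullet> (z - y)\<bar> \<le> K * (norm (z - y))\<^sup>2)"
proof -
  have U: "open U" using C by (simp add: C2fun_def)
  then have "isCont D x" using C x by (auto simp: C2fun_def continuous_on_eq_continuous_at)
  then obtain r1 where r1: "r1 > 0" "\<And>y. dist y x < r1 \<Longrightarrow> dist (D y) (D x) < 1"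
    unfolding continuous_at_eps_delta using zero_less_one by blast
  obtain r2 where r2: "r2 > 0" "ball x r2 \<subseteq> U" using U x by (auto simp: open_contains_ball)
  define r where "r = min r1 r2"
  define K where "K = norm (D x) + 1"
  have sub: "ball x r \<subseteq> U" using r2 by (auto simp: r_def)
  have DK: "norm (D y) \<le> K" if "y \<in> ball x r" for y
    using r1(2)[of y] that norm_triangle_ineq2[of "D y" "D x"] by (auto simp: r_def K_def dist_norm norm_minus_commute)
  have Lip: "norm (G z - G y) \<le> K * norm (z - y)" if "y \<in> ball x r" "z \<in> ball x r" for y z
  proof (rule differentiable_bound[where S="ball x r" and f'="\<lambda>y h. D y *v h"])
    fix w assume w: "w \<in> ball x r"
    show "(G has_derivative (*v) (D w)) (at w within ball x r)"
      by (rule has_derivative_at_withinI) (use C w sub in \<open>simp add: C2fun_def subset_iff\<close>)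
    show "onorm ((*v) (D w)) \<le> K"
      by (rule onorm_le) (rule order_trans[OF matrix_vector_norm_bound mult_right_mono[OF DK[OF w]]], simp)
  qed (use that in auto)
  have "\<bar>g z - g y - G y \<bullet> (z - y)\<bar> \<le> K * (norm (z - y))\<^sup>2" if yz: "y \<in> ball x r" "z \<in> ball x r" for y z
  proof -
    define h where "h = z - y"
    define q where "q t = g (y + t *\<^sub>R h) - t * (G y \<bullet> h)" for t
    have inb: "y + t *\<^sub>R h \<in> ball x r" if "0 \<le> t" "t \<le> 1" for t
    proof -
      have "y + t *\<^sub>R h = (1 - t) *\<^sub>R y + t *\<^sub>R z" by (simp add: h_def algebra_simps)
      then show ?thesis using convex_ball[of x r] yz that unfolding convex_alt by auto
    qed
    have "\<exists>t>0. t < 1 \<and> q 1 - q 0 = (1 - 0) * ((G (y + t *\<^sub>R h) - G y) \<bullet> h)"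
    proof (rule MVT2)
      fix t :: real assume t: "0 \<le> t" "t \<le> 1"
      have "y + t *\<^sub>R h \<in> U" using inb[OF t] sub by blast
      then have "((\<lambda>t. g (y + t *\<^sub>R h)) has_real_derivative G (y + t *\<^sub>R h) \<bullet> h) (at t)"
        using C by (intro has_real_derivative_along) (simp add: C2fun_def)
      then show "DERIV q t :> (G (y + t *\<^sub>R h) - G y) \<bullet> h"
        unfolding q_def
        by (auto intro!: derivative_eq_intros simp: inner_diff_left inner_commute algebra_simps)
    qed simp
    then obtain t where t: "0 < t" "t < 1" "q 1 - q 0 = (G (y + t *\<^sub>R h) - G y) \<bullet> h" by auto
    have "norm (G (y + t *\<^sub>R h) - G y) \<le> K * norm (t *\<^sub>R h)"
      using Lip[OF yz(1) inb[of t]] t by simp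
    also have "\<dots> \<le> K * norm h"
      using t by (intro mult_left_mono) (auto simp: K_def mult_left_le_one_le)
    finally have "\<bar>q 1 - q 0\<bar> \<le> K * norm h * norm h"
      unfolding t(3) by (meson Cauchy_Schwarz_ineq2 mult_right_mono norm_ge_zero order_trans)
    then show ?thesis by (simp add: q_def h_def power2_eq_square mult.assoc)
  qed
  then have "\<forall>y\<in>ball x r. \<forall>z\<in>ball x r. \<bar>g z - g y - G y \<bullet> (z - y)\<bar> \<le> K * (norm (z - y))\<^sup>2" by blast
  moreover have "r > 0" using r1 r2 by (simp add: r_def)
  ultimately show ?thesis using sub by blast
qed

lemma real_taylor2:
  fixes g g' :: "real \<Rightarrow> real"
  assumes d: "d > 0" "\<And>s. \<bar>s - t\<bar> < d \<Longrightarrow> (g has_real_derivative g' s) (at s)"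
    and g'': "(g' has_real_derivative g'') (at t)" and e: "e > 0"
  shows "\<exists>r>0. \<forall>s. \<bar>s\<bar> < r \<longrightarrow> \<bar>g (t + s) - g t - g' t * s - g'' * s\<^sup>2 / 2\<bar> \<le> e * s\<^sup>2"
proof -
  have "(g' has_derivative (\<lambda>h. g'' * h)) (at t)" using g'' by (simp add: has_field_derivative_def)
  then obtain c where c: "c > 0" "\<And>y. norm (y - t) < c \<Longrightarrow> norm (g' y - g' t - g'' * (y - t)) \<le> e * norm (y - t)"
    using e unfolding has_derivative_at_alt by blast
  have "\<bar>g (t + s) - g t - g' t * s - g'' * s\<^sup>2 / 2\<bar> \<le> e * s\<^sup>2" if s: "\<bar>s\<bar> < min c d" for s
  proof -
    define q where "q a = g (t + a *\<^sub>R s) - a * (g' t * s) - a\<^sup>2 * (g'' * s\<^sup>2) / 2" for a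
    have le: "\<bar>a * s\<bar> \<le> \<bar>s\<bar>" if "0 \<le> a" "a \<le> 1" for a
      using that by (simp add: abs_mult mult_left_le_one_le)
    have "\<exists>a>0. a < 1 \<and> q 1 - q 0 = (1 - 0) * ((g' (t + a * s) - g' t - g'' * (a * s)) * s)"
    proof (rule MVT2)
      fix a :: real assume a: "0 \<le> a" "a \<le> 1"
      have "(g has_derivative (\<lambda>h. g' (t + a * s) * h)) (at (t + a *\<^sub>R s))"
        using d(2)[of "t + a * s"] le[OF a] s by (simp add: has_field_derivative_def)
      from has_real_derivative_along[OF this]
      show "DERIV q a :> (g' (t + a * s) - g' t - g'' * (a * s)) * s"
        unfolding q_def
        by (auto intro!: derivative_eq_intros simp: algebra_simps power2_eq_square)
    qed simp
    then obtain a where a: "0 < a" "a < 1" "q 1 - q 0 = (g' (t + a * s) - g' t - g'' * (a * s)) * s" by auto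
    have "\<bar>g' (t + a * s) - g' t - g'' * (a * s)\<bar> \<le> e * \<bar>a * s\<bar>"
      using c(2)[of "t + a * s"] le[of a] a s by simp
    also have "\<dots> \<le> e * \<bar>s\<bar>" using le[of a] a e by simp
    finally have "\<bar>q 1 - q 0\<bar> \<le> e * \<bar>s\<bar> * \<bar>s\<bar>"
      unfolding a(3) abs_mult by (rule mult_right_mono) simp
    moreover have "e * \<bar>s\<bar> * \<bar>s\<bar> = e * s\<^sup>2" by (simp add: power2_eq_square mult.assoc)
    moreover have "q 1 - q 0 = g (t + s) - g t - g' t * s - g'' * s\<^sup>2 / 2" by (simp add: q_def)
    ultimately show ?thesis by simp
  qed
  then show ?thesis using c d by (intro exI[of _ "min c d"]) auto
qed

text \<open>The Hessian of a quadratic polynomial is constant, so admissibility on a whole domain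
  reduces to a condition on one matrix. All test functions inserted into the viscosity inequalities
  are of this form.\<close>

lemma quadratic_poly_C2:
  fixes H :: "real^'n^'n" and p x0 :: "real^'n" and c :: real
  assumes sym: "transpose H = H"
  defines "\<psi> \<equiv> \<lambda>x. c + p \<bullet> (x - x0) + ((x - x0) \<bullet> (H *v (x - x0))) / 2"
  shows "Ck_on 2 A \<psi>" "hess \<psi> x = H"
proof -
  have bl: "bounded_linear (\<lambda>x. H *v x)" by (rule matrix_vector_mul_bounded_linear)
  note hd = bounded_linear.has_derivative[OF bl]
  have ax: "v \<bullet> axis i 1 = v $ i" for v :: "real^'n" and i
    by (simp add: inner_axis)
  have D: "(\<psi> has_derivative (\<lambda>h. (p + H *v (x - x0)) \<bullet> h)) (at x)" for x
  proof -
    have "(\<psi> has_derivative (\<lambda>h. p \<bullet> h + (h \<bullet> (H *v (x - x0)) + (x - x0) \<bullet> (H *v h)) / 2)) (at x)"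
      unfolding \<psi>_def by (rule derivative_eq_intros hd refl | simp add: algebra_simps)+
    moreover have "(x - x0) \<bullet> (H *v h) = (H *v (x - x0)) \<bullet> h" for h
      using inner_symmetric_matrix[OF sym] by simp
    ultimately show ?thesis by (simp add: inner_add inner_commute)
  qed
  have p1: "partial i \<psi> = (\<lambda>x. (p + H *v (x - x0)) $ i)" for i
    using partial_has_derivative[OF D] by (auto simp: ax)
  have D2: "((\<lambda>x. (p + H *v (x - x0)) $ i) has_derivative (\<lambda>h. (H *v h) $ i)) (at x)" for i x
  proof -
    have "((\<lambda>x. (p + H *v (x - x0)) $ i) has_derivative (\<lambda>h. (0 + H *v (h - 0)) $ i)) (at x)"
      by (intro bounded_linear.has_derivative[OF bounded_linear_vec_nth] derivative_intros hd)
    then show ?thesis by simp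
  qed
  have p2: "partial j (partial i \<psi>) = (\<lambda>x. H $ j $ i)" for i j
  proof
    fix x
    have "partial j (partial i \<psi>) x = (H *v axis j 1) $ i"
      unfolding p1 by (rule partial_has_derivative[OF D2])
    also have "\<dots> = H $ i $ j" by (simp add: matrix_vector_mul_component inner_axis)
    also have "\<dots> = H $ j $ i" using sym by (metis transpose_def vec_lambda_beta)
    finally show "partial j (partial i \<psi>) x = H $ j $ i" .
  qed
  show "hess \<psi> x = H" by (simp add: hess_def p2 vec_eq_iff)
  have l: "is = [] \<or> (\<exists>i. is = [i]) \<or> (\<exists>i j. is = [i,j])" if "length is \<le> 2" for "is" :: "'n list"
    using that by (cases "is" rule: remdups_adj.cases) auto
  have diff: "pds is \<psi> differentiable at x" if "length is < 2" for "is" x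
  proof -
    have "is = [] \<or> (\<exists>i. is = [i])" using that l[of "is"] by fastforce
    then show ?thesis
      using D[THEN differentiableI] D2[THEN differentiableI] p1 by auto
  qed
  have "continuous_on A (pds is \<psi>)" if "length is \<le> 2" for "is"
  proof (cases "length is < 2")
    case True
    then show ?thesis using diff[OF True] by (intro continuous_at_imp_continuous_on ballI differentiable_imp_continuous_within)
  next
    case False
    then have "\<exists>i j. is = [i, j]" using l[OF that] by auto
    then show ?thesis by (auto simp: p2)
  qed
  with diff show "Ck_on 2 A \<psi>" unfolding Ck_on_def by blast
qed

section \<open>Normal and second fundamental form of the boundary\<close>

lemma adjoint_matrix_inner: "(A *v x) \<bullet> y = x \<bullet> (transpose A *v (y::real^'n))" for A :: "real^'m^'n"
  by (metis dot_lmul_matrix transpose_matrix_vector transpose_transpose)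

text \<open>A local defining function of the domain. The bound 1 on the gradient is what a graph
  gives: \<open>y $ i0 - \<phi> y\<close> has derivative 1 in direction \<open>i0\<close>, because
  \<open>\<phi>\<close> does not depend on that coordinate.\<close>

definition bdfun :: "(real^'n) set \<Rightarrow> (real^'n) set \<Rightarrow> (real^'n \<Rightarrow> real) \<Rightarrow> (real^'n \<Rightarrow> real^'n) \<Rightarrow> (real^'n \<Rightarrow> real^'n^'n) \<Rightarrow> bool" where
  "bdfun \<Omega> U g G D \<longleftrightarrow> C2fun U g G D \<and> (\<forall>x\<in>U. x \<in> \<Omega> \<longleftrightarrow> g x > 0) \<and> (\<forall>x\<in>U. norm (G x) \<ge> 1)"

text \<open>The defining function is \<open>y $ i0 - \<phi> y\<close> read in the rotated
  coordinates. Since the gradient of \<open>\<phi>\<close> vanishes at 0, its gradient at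
  \<open>p\<close> is the rotated axis and its Hessian the rotated \<open>- hess \<phi> 0\<close>;
  conjugation by \<open>Q\<close> preserves every \<open>csig j\<close>.\<close>

lemma chart_bdfun:
  fixes \<Omega> :: "(real^'n) set"
  assumes ch: "boundary_chart \<Omega> p Q i0 \<phi> r"
  defines "\<nu> \<equiv> Q *v axis i0 1" and "C \<equiv> Q ** hess \<phi> 0 ** transpose Q"
  shows "norm \<nu> = 1" "transpose C = C" "C *v \<nu> = 0" "csig j C = Sk j (hess \<phi> 0)"
    "\<exists>U g G D. p \<in> U \<and> bdfun \<Omega> U g G D \<and> G p = \<nu> \<and> D p = - C"
proof -
  let ?e = "axis i0 1 :: real^'n"
  have oQ: "orthogonal_matrix Q" and r: "0 < r" and \<phi>0: "\<phi> 0 = 0" "\<And>i. partial i \<phi> 0 = 0"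
    and ind: "\<And>y. \<phi> y = \<phi> (y - (y $ i0) *\<^sub>R ?e)" and Ck: "Ck_on 2 (ball 0 r) \<phi>"
    and sgn: "\<And>y. y \<in> ball 0 r \<Longrightarrow> (p + Q *v y \<in> \<Omega>) \<longleftrightarrow> \<phi> y < y $ i0"
    using ch by (auto simp: boundary_chart_def)
  have QQ: "Q ** transpose Q = mat 1" "transpose Q ** Q = mat 1"
    using oQ by (auto simp: orthogonal_matrix_def)
  have ot: "orthogonal_transformation ((*v) Q)" "orthogonal_transformation ((*v) (transpose Q))"
    using oQ by (auto simp: orthogonal_transformation_matrix orthogonal_matrix_transpose)
  have nQ: "norm (Q *v x) = norm x" "norm (transpose Q *v x) = norm x" for x
    by (rule orthogonal_transformation_norm[OF ot(1)], rule orthogonal_transformation_norm[OF ot(2)])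
  have nQ': "norm (x v* Q) = norm x" for x using nQ(2) by simp
  show n1: "norm \<nu> = 1" by (simp add: \<nu>_def nQ)
  define g where "g = (\<lambda>x. \<chi> i. partial i \<phi> x)"
  have C2: "C2fun (ball 0 r) \<phi> g (hess \<phi>)" unfolding g_def using Ck by (intro Ck_on_2_C2fun) auto
  have symB: "transpose (hess \<phi> y) = hess \<phi> y" if "y \<in> ball 0 r" for y using C2 that by (simp add: C2fun_def)
  have z: "0 \<in> ball (0::real^'n) r" using r by simp
  have symc: "transpose (Q ** A ** transpose Q) = Q ** A ** transpose Q" if "transpose A = A" for A
    using that by (simp add: matrix_transpose_mul matrix_mul_assoc)
  show "transpose C = C" unfolding C_def by (intro symc symB z)
  \<comment> \<open>Proved on the whole ball, so that it can be differentiated once more to see that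
    \<open>hess \<phi> 0\<close> kills the \<open>i0\<close> axis.\<close>
  have p0: "partial i0 \<phi> y = 0" if y: "y \<in> ball 0 r" for y
  proof -
    have const: "\<phi> (y + s *\<^sub>R ?e) = \<phi> y" for s
      by (subst (1 2) ind) (simp add: algebra_simps)
    have "(\<phi> has_derivative (\<lambda>h. g y \<bullet> h)) (at (y + 0 *\<^sub>R ?e))" using C2 y by (simp add: C2fun_def)
    from has_real_derivative_along[OF this] have "((\<lambda>s. \<phi> y) has_real_derivative g y \<bullet> ?e) (at 0)"
      by (simp add: const)
    then have "g y \<bullet> ?e = 0" using DERIV_const DERIV_unique by blast
    then show ?thesis by (simp add: g_def inner_axis)
  qed
  have B0: "hess \<phi> 0 *v ?e = 0"
  proof -
    have "((\<lambda>_. 0) has_derivative (\<lambda>h. 0)) (at (0::real^'n))" by (rule has_derivative_const)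
    then have "(partial i0 \<phi> has_derivative (\<lambda>h. 0)) (at 0)"
      by (rule has_derivative_transform_within_open[OF _ open_ball z]) (use p0 in auto)
    then have "partial i (partial i0 \<phi>) 0 = 0" for i by (rule partial_has_derivative)
    then show ?thesis by (simp add: vec_eq_iff matrix_vector_mul_component inner_axis hess_def)
  qed
  show "C *v \<nu> = 0"
    unfolding C_def \<nu>_def
    by (simp add: matrix_vector_mul_assoc) (metis B0 QQ(2) matrix_mul_assoc matrix_mul_rid matrix_vector_mul_assoc matrix_vector_mult_0_right)
  show "csig j C = Sk j (hess \<phi> 0)"
    unfolding C_def using csig_orthogonal_conj[OF oQ] Sk_eq_csig[OF symB[OF z]] by simp
  define T where "T x = transpose Q *v (x - p)" for x
  define \<rho> where "\<rho> x = T x $ i0 - \<phi> (T x)" for x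
  define G where "G x = Q *v (?e - g (T x))" for x
  define D where "D x = - (Q ** hess \<phi> (T x) ** transpose Q)" for x
  have Tb: "T x \<in> ball 0 r" if "x \<in> ball p r" for x
    using that by (simp add: T_def nQ' dist_norm norm_minus_commute)
  have Tx: "p + Q *v T x = x" for x unfolding T_def matrix_vector_mul_assoc QQ by simp
  have dT: "(T has_derivative (\<lambda>h. transpose Q *v h)) (at x)" for x
  proof -
    have "(T has_derivative (\<lambda>h. transpose Q *v (h - 0))) (at x)"
      unfolding T_def by (intro bounded_linear.has_derivative[OF matrix_vector_mul_bounded_linear] derivative_intros)
    then show ?thesis by simp
  qed
  have d\<rho>: "(\<rho> has_derivative (\<lambda>h. G x \<bullet> h)) (at x)" if x: "x \<in> ball p r" for x
  proof -
    have "(\<phi> has_derivative (\<lambda>h. g (T x) \<bullet> h)) (at (T x))" using C2 Tb[OF x] by (simp add: C2fun_def)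
    from has_derivative_compose[OF dT this]
    have "((\<lambda>x. \<phi> (T x)) has_derivative (\<lambda>h. g (T x) \<bullet> (transpose Q *v h))) (at x)" .
    then have "(\<rho> has_derivative (\<lambda>h. (transpose Q *v h) $ i0 - g (T x) \<bullet> (transpose Q *v h))) (at x)"
      unfolding \<rho>_def by (intro has_derivative_diff bounded_linear.has_derivative[OF bounded_linear_vec_nth] dT)
    moreover have "(transpose Q *v h) $ i0 - g (T x) \<bullet> (transpose Q *v h) = G x \<bullet> h" for h
      unfolding G_def adjoint_matrix_inner by (simp add: inner_diff_left inner_axis')
    ultimately show ?thesis by simp
  qed
  have dG: "(G has_derivative (\<lambda>h. D x *v h)) (at x)" if x: "x \<in> ball p r" for x
  proof -
    have "(g has_derivative (\<lambda>h. hess \<phi> (T x) *v h)) (at (T x))" using C2 Tb[OF x] by (simp add: C2fun_def)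
    from has_derivative_compose[OF dT this]
    have "((\<lambda>x. g (T x)) has_derivative (\<lambda>h. hess \<phi> (T x) *v (transpose Q *v h))) (at x)" .
    then have "(G has_derivative (\<lambda>h. Q *v (0 - hess \<phi> (T x) *v (transpose Q *v h)))) (at x)"
      unfolding G_def
      by (intro bounded_linear.has_derivative[OF matrix_vector_mul_bounded_linear] has_derivative_diff has_derivative_const)
    moreover have "Q *v (0 - hess \<phi> (T x) *v (transpose Q *v h)) = D x *v h" for h
    proof -
      have "(- A) *v h = - (A *v h)" for A :: "real^'n^'n"
        using matrix_vector_mult_diff_rdistrib[of 0 A h] by simp
      moreover have "Q *v (0 - w) = - (Q *v w)" for w
        by (simp only: matrix_vector_mult_diff_distrib) simp
      ultimately show ?thesis unfolding D_def by (simp only: matrix_vector_mul_assoc matrix_mul_assoc)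
    qed
    ultimately show ?thesis by simp
  qed
  have cT: "continuous_on (ball p r) T"
    using dT by (meson continuous_at_imp_continuous_on has_derivative_continuous)
  have "continuous_on (ball p r) (\<lambda>x. hess \<phi> (T x))"
    by (rule continuous_on_compose2[OF _ cT]) (use C2 Tb in \<open>auto simp: C2fun_def\<close>)
  then have "continuous_on (ball p r) D"
    unfolding D_def matrix_matrix_mult_def
    by (intro continuous_intros) (auto intro!: continuous_intros)
  moreover have "transpose (D x) = D x" if "x \<in> ball p r" for x
  proof -
    have "transpose (- A) = - transpose A" for A :: "real^'n^'n" by (simp add: transpose_def vec_eq_iff)
    then show ?thesis unfolding D_def using symc[OF symB[OF Tb[OF that]]] by simp
  qed
  ultimately have "C2fun (ball p r) \<rho> G D"
    using d\<rho> dG by (simp add: C2fun_def)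
  moreover have "x \<in> \<Omega> \<longleftrightarrow> \<rho> x > 0" if "x \<in> ball p r" for x
    using sgn[OF Tb[OF that]] unfolding Tx by (simp add: \<rho>_def)
  moreover have "norm (G x) \<ge> 1" if "x \<in> ball p r" for x
  proof -
    have "(?e - g (T x)) $ i0 = 1" using p0[OF Tb[OF that]] by (simp add: g_def)
    then show ?thesis using component_le_norm_cart[of "?e - g (T x)" i0] by (simp add: G_def nQ)
  qed
  ultimately have "bdfun \<Omega> (ball p r) \<rho> G D" by (simp add: bdfun_def)
  moreover have "T p = 0" by (simp add: T_def)
  moreover have "g 0 = 0" using \<phi>0(2) by (simp add: g_def vec_eq_iff)
  ultimately have "G p = \<nu>" "D p = - C" "bdfun \<Omega> (ball p r) \<rho> G D"
    by (simp_all add: G_def \<nu>_def D_def C_def)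
  then show "\<exists>U g G D. p \<in> U \<and> bdfun \<Omega> U g G D \<and> G p = \<nu> \<and> D p = - C"
    using r by (intro exI[of _ "ball p r"]) auto
qed

lemma bdfun_frontier:
  assumes "open \<Omega>" "bdfun \<Omega> U g G D" "x \<in> U" "x \<in> frontier \<Omega>"
  shows "g x = 0"
proof -
  have U: "open U" and cg: "continuous_on U g"
    using assms(2) C2fun_cont by (auto simp: bdfun_def C2fun_def)
  have "x \<notin> \<Omega>" using assms by (simp add: frontier_def interior_open)
  then have "g x \<le> 0" using assms by (auto simp: bdfun_def not_less)
  moreover have "\<not> g x < 0"
  proof
    assume "g x < 0"
    moreover have "open {y \<in> U. g y < 0}"
      using continuous_open_preimage[OF cg U, of "{..<0}"] by (simp add: vimage_def Int_def)
    ultimately have "{y \<in> U. g y < 0} \<inter> \<Omega> \<noteq> {}"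
      using assms(3,4) open_Int_closure_eq_empty[of "{y \<in> U. g y < 0}" \<Omega>] by (auto simp: frontier_def)
    then show False using assms(2) by (auto simp: bdfun_def)
  qed
  ultimately show ?thesis by simp
qed

text \<open>The linear term keeps the moving direction \<open>w t\<close>: with \<open>w0\<close> in
  its place, division by \<open>t\<^sup>2\<close> would leave an uncontrolled remainder.\<close>

lemma C2fun_along_curve:
  assumes C: "C2fun U g G D" and x: "x \<in> U" and w: "(w \<longlongrightarrow> w0) (at 0)"
  shows "((\<lambda>t. (g (x + t *\<^sub>R w t) - g x - t * (G x \<bullet> w t)) / t\<^sup>2) \<longlongrightarrow> (w0 \<bullet> (D x *v w0)) / 2) (at 0)"
proof -
  define R where "R h = g (x + h) - g x - G x \<bullet> h - (h \<bullet> (D x *v h)) / 2" for h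
  have lim: "((\<lambda>t. R (t *\<^sub>R w t) / t\<^sup>2) \<longlongrightarrow> 0) (at 0)"
  proof (rule tendstoI)
    fix e :: real assume e: "e > 0"
    define W where "W = norm w0 + 1"
    have W: "W > 0" by (simp add: W_def add_nonneg_pos)
    then have W2: "W\<^sup>2 > 0" by simp
    note W = W W2
    obtain r where r: "r > 0" "\<And>h. norm h < r \<Longrightarrow> \<bar>R h\<bar> \<le> e / (2 * W\<^sup>2) * (norm h)\<^sup>2"
      using C2fun_taylor[OF C x, of "e / (2 * W\<^sup>2)"] e W unfolding R_def by auto
    have "((\<lambda>t. norm (w t)) \<longlongrightarrow> norm w0) (at 0)" by (intro tendsto_intros w)
    then have "\<forall>\<^sub>F t in at 0. norm (w t) < W" by (rule order_tendstoD) (simp add: W_def)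
    moreover have "\<forall>\<^sub>F t in at (0::real). \<bar>t\<bar> < r / W"
      using r W by (auto simp: eventually_at dist_real_def intro!: exI[of _ "r / W"])
    moreover have "\<forall>\<^sub>F t in at (0::real). t \<noteq> 0" by (simp add: eventually_at_filter)
    ultimately show "\<forall>\<^sub>F t in at 0. dist (R (t *\<^sub>R w t) / t\<^sup>2) 0 < e"
    proof eventually_elim
      case (elim t)
      have "norm (t *\<^sub>R w t) \<le> \<bar>t\<bar> * W" using elim by (simp add: mult_left_mono)
      also have "\<dots> < r" using elim W by (simp add: field_simps)
      finally have "\<bar>R (t *\<^sub>R w t)\<bar> \<le> e / (2 * W\<^sup>2) * (norm (t *\<^sub>R w t))\<^sup>2" by (rule r(2))
      also have "\<dots> = e / (2 * W\<^sup>2) * (t\<^sup>2 * (norm (w t))\<^sup>2)" by (simp add: power_mult_distrib)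
      also have "\<dots> \<le> e / (2 * W\<^sup>2) * (t\<^sup>2 * W\<^sup>2)"
        using elim e W by (intro mult_left_mono power_mono) auto
      also have "\<dots> = e / 2 * t\<^sup>2" using W by (simp add: field_simps)
      also have "\<dots> < e * t\<^sup>2" using e elim by simp
      finally show ?case using elim by (simp add: divide_simps)
    qed
  qed
  have "((\<lambda>t. (w t \<bullet> (D x *v w t)) / 2) \<longlongrightarrow> (w0 \<bullet> (D x *v w0)) / 2) (at 0)"
    by (intro tendsto_intros bounded_linear.tendsto[OF matrix_vector_mul_bounded_linear] w) simp
  from tendsto_add[OF lim this]
  have "((\<lambda>t. R (t *\<^sub>R w t) / t\<^sup>2 + (w t \<bullet> (D x *v w t)) / 2) \<longlongrightarrow> (w0 \<bullet> (D x *v w0)) / 2) (at 0)" by simp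
  then show ?thesis
  proof (rule Lim_transform_eventually)
    have "\<forall>\<^sub>F t in at (0::real). t \<noteq> 0" by (simp add: eventually_at_filter)
    then show "\<forall>\<^sub>F t in at 0. R (t *\<^sub>R w t) / t\<^sup>2 + (w t \<bullet> (D x *v w t)) / 2
        = (g (x + t *\<^sub>R w t) - g x - t * (G x \<bullet> w t)) / t\<^sup>2"
    proof eventually_elim
      case (elim t)
      have "R (t *\<^sub>R w t) = g (x + t *\<^sub>R w t) - g x - t * (G x \<bullet> w t) - t\<^sup>2 * ((w t \<bullet> (D x *v w t)) / 2)"
        by (simp add: R_def matrix_vector_mult_scaleR power2_eq_square)
      then have "R (t *\<^sub>R w t) / t\<^sup>2 = (g (x + t *\<^sub>R w t) - g x - t * (G x \<bullet> w t)) / t\<^sup>2 - (w t \<bullet> (D x *v w t)) / 2"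
        using elim by (simp add: diff_divide_distrib)
      then show ?case by simp
    qed
  qed
qed

text \<open>Along the parabola \<open>x + t \<tau> + t^2 a \<nu>\<close> with tangential
  \<open>\<tau>\<close>, the sign of a defining function for small \<open>t\<close> is that of an
  affine function of \<open>a\<close> whose constant term is half the Hessian at
  \<open>\<tau>\<close>. Both defining functions are positive at the same points, so the two affine
  functions change sign at the same \<open>a\<close>, and the Hessians differ by the factor relating
  the gradients. This makes the curvatures independent of the chosen chart.\<close>

lemma bdfun_unique:
  assumes b1: "bdfun \<Omega> U1 g1 G1 D1" and b2: "bdfun \<Omega> U2 g2 G2 D2"
    and x: "x \<in> U1" "x \<in> U2" "g1 x = 0" "g2 x = 0" and n: "norm (G2 x) = 1"
  shows "G1 x = norm (G1 x) *\<^sub>R G2 x"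
    and "\<tau> \<bullet> G2 x = 0 \<Longrightarrow> \<tau> \<bullet> (D1 x *v \<tau>) = norm (G1 x) * (\<tau> \<bullet> (D2 x *v \<tau>))"
proof -
  define \<nu> where "\<nu> = G2 x"
  have nn: "\<nu> \<bullet> \<nu> = 1" using n by (simp add: \<nu>_def norm_eq_1)
  have C1: "C2fun U1 g1 G1 D1" and C2: "C2fun U2 g2 G2 D2" using b1 b2 by (auto simp: bdfun_def)
  have w: "((\<lambda>t. \<tau> + (t * a) *\<^sub>R \<nu>) \<longlongrightarrow> \<tau>) (at 0)" for \<tau> and a :: real
    by (auto intro!: tendsto_eq_intros)
  define h where "h \<tau> a t = t *\<^sub>R (\<tau> + (t * a) *\<^sub>R \<nu>)" for \<tau> and a t :: real
  have ev0: "\<forall>\<^sub>F t in at (0::real). t \<noteq> 0" by (simp add: eventually_at_filter)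
  have curve: "((\<lambda>t. (g (x + h \<tau> a t) - t * (G x \<bullet> \<tau>)) / t\<^sup>2) \<longlongrightarrow> a * (G x \<bullet> \<nu>) + (\<tau> \<bullet> (D x *v \<tau>)) / 2) (at 0)"
    if C: "C2fun U g G D" and "x \<in> U" "g x = 0" for U g G D \<tau> a
  proof -
    from C2fun_along_curve[OF C that(2) w, of \<tau> a]
    have "((\<lambda>t. (g (x + h \<tau> a t) - t * (G x \<bullet> (\<tau> + (t * a) *\<^sub>R \<nu>))) / t\<^sup>2 + a * (G x \<bullet> \<nu>)) \<longlongrightarrow> (\<tau> \<bullet> (D x *v \<tau>)) / 2 + a * (G x \<bullet> \<nu>)) (at 0)"
      unfolding h_def that(3) by (intro tendsto_add tendsto_const) simp
    then have "((\<lambda>t. (g (x + h \<tau> a t) - t * (G x \<bullet> \<tau>)) / t\<^sup>2) \<longlongrightarrow> (\<tau> \<bullet> (D x *v \<tau>)) / 2 + a * (G x \<bullet> \<nu>)) (at 0)"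
      by (rule Lim_transform_eventually) (use ev0 in \<open>eventually_elim, simp add: inner_add field_simps power2_eq_square\<close>)
    then show ?thesis by (simp add: add.commute)
  qed
  have inU: "\<forall>\<^sub>F t in at 0. x + h \<tau> a t \<in> U1 \<inter> U2" for \<tau> a
  proof -
    have "((\<lambda>t. x + h \<tau> a t) \<longlongrightarrow> x) (at 0)"
      unfolding h_def by (auto intro!: tendsto_eq_intros)
    moreover have "open (U1 \<inter> U2)" using C1 C2 by (auto simp: C2fun_def)
    ultimately show ?thesis using x topological_tendstoD by blast
  qed
  have sgn: "g1 y > 0 \<longleftrightarrow> g2 y > 0" if "y \<in> U1 \<inter> U2" for y
    using b1 b2 that by (auto simp: bdfun_def)
  \<comment> \<open>For \<open>a\<close> above its critical value the parabola lies inside the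
    domain for all small \<open>t \<noteq> 0\<close>; this information is then transferred from
    \<open>g2\<close> to \<open>g1\<close>.\<close>
  have pos: "\<forall>\<^sub>F t in at 0. g1 (x + h \<tau> a t) > 0"
    if \<tau>: "\<tau> \<bullet> \<nu> = 0" and a: "a + (\<tau> \<bullet> (D2 x *v \<tau>)) / 2 > 0" for \<tau> a
  proof -
    have G0: "G2 x \<bullet> \<tau> = 0" using \<tau> by (simp add: \<nu>_def inner_commute)
    have "\<forall>\<^sub>F t in at 0. 0 < (g2 (x + h \<tau> a t) - t * (G2 x \<bullet> \<tau>)) / t\<^sup>2"
      using curve[OF C2 x(2,4), of \<tau> a] a nn by (intro order_tendstoD(1)) (auto simp: \<nu>_def)
    with inU[of \<tau> a] ev0 show ?thesis
    proof eventually_elim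
      case (elim t)
      then have "g2 (x + h \<tau> a t) > 0" unfolding G0 by (simp add: zero_less_divide_iff)
      then show ?case using sgn[OF elim(1)] by simp
    qed
  qed
  have neg: "\<forall>\<^sub>F t in at 0. g1 (x + h \<tau> a t) \<le> 0"
    if \<tau>: "\<tau> \<bullet> \<nu> = 0" and a: "a + (\<tau> \<bullet> (D2 x *v \<tau>)) / 2 < 0" for \<tau> a
  proof -
    have G0: "G2 x \<bullet> \<tau> = 0" using \<tau> by (simp add: \<nu>_def inner_commute)
    have "\<forall>\<^sub>F t in at 0. (g2 (x + h \<tau> a t) - t * (G2 x \<bullet> \<tau>)) / t\<^sup>2 < 0"
      using curve[OF C2 x(2,4), of \<tau> a] a nn by (intro order_tendstoD(2)) (auto simp: \<nu>_def)
    with inU[of \<tau> a] ev0 show ?thesis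
    proof eventually_elim
      case (elim t)
      then have "\<not> g2 (x + h \<tau> a t) > 0" unfolding G0 by (simp add: divide_less_0_iff)
      then show ?case using sgn[OF elim(1)] by simp
    qed
  qed
  have tang: "G1 x \<bullet> \<tau> = 0" if \<tau>: "\<tau> \<bullet> \<nu> = 0" for \<tau>
  proof -
    \<comment> \<open>Dividing by \<open>t\<close> instead of \<open>t\<^sup>2\<close> isolates the
      tangential slope of \<open>g1\<close>. Positivity for \<open>t > 0\<close> bounds it from
      below, and \<open>- \<tau>\<close> supplies the opposite bound.\<close>
    have ge: "G1 x \<bullet> \<tau> \<ge> 0" if \<tau>: "\<tau> \<bullet> \<nu> = 0" for \<tau>
    proof -
      define a where "a = 1 - (\<tau> \<bullet> (D2 x *v \<tau>)) / 2"
      have "((\<lambda>t. t * ((g1 (x + h \<tau> a t) - t * (G1 x \<bullet> \<tau>)) / t\<^sup>2) + G1 x \<bullet> \<tau>) \<longlongrightarrow>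
          0 * (a * (G1 x \<bullet> \<nu>) + (\<tau> \<bullet> (D1 x *v \<tau>)) / 2) + G1 x \<bullet> \<tau>) (at_right 0)"
        by (rule tendsto_within_subset[where S=UNIV]) (intro tendsto_intros curve[OF C1 x(1,3)] | simp)+
      moreover have "\<forall>\<^sub>F t in at_right 0. t * ((g1 (x + h \<tau> a t) - t * (G1 x \<bullet> \<tau>)) / t\<^sup>2) + G1 x \<bullet> \<tau> \<ge> 0"
      proof -
        have "\<forall>\<^sub>F t in at_right 0. g1 (x + h \<tau> a t) > 0"
          using pos[OF \<tau>, of a] by (simp add: a_def eventually_at_split)
        moreover have "\<forall>\<^sub>F t in at_right (0::real). t > 0" by (simp add: eventually_at_right_less)
        ultimately show ?thesis
        proof eventually_elim
          case (elim t)
          have "t * ((g1 (x + h \<tau> a t) - t * (G1 x \<bullet> \<tau>)) / t\<^sup>2) + G1 x \<bullet> \<tau> = g1 (x + h \<tau> a t) / t"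
            using elim by (simp add: field_simps power2_eq_square)
          then show ?case using elim by simp
        qed
      qed
      ultimately have "0 * (a * (G1 x \<bullet> \<nu>) + (\<tau> \<bullet> (D1 x *v \<tau>)) / 2) + G1 x \<bullet> \<tau> \<ge> 0"
        by (intro tendsto_lowerbound) auto
      then show ?thesis by simp
    qed
    from ge[OF \<tau>] ge[of "- \<tau>"] \<tau> show ?thesis by simp
  qed
  define l where "l = G1 x \<bullet> \<nu>"
  have G1: "G1 x = l *\<^sub>R \<nu>"
  proof -
    define v where "v = G1 x - l *\<^sub>R \<nu>"
    have "v \<bullet> \<nu> = 0" by (simp add: v_def inner_diff_left l_def nn)
    then have "G1 x \<bullet> v = 0" by (rule tang)
    with \<open>v \<bullet> \<nu> = 0\<close> have "v \<bullet> v = 0" by (simp add: v_def inner_diff_left inner_diff_right inner_commute)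
    then show ?thesis by (simp add: v_def)
  qed
  have up: "a * l + (\<tau> \<bullet> (D1 x *v \<tau>)) / 2 \<ge> 0"
    if \<tau>: "\<tau> \<bullet> \<nu> = 0" and a: "a + (\<tau> \<bullet> (D2 x *v \<tau>)) / 2 > 0" for \<tau> a
    unfolding l_def
  proof (rule tendsto_lowerbound[OF curve[OF C1 x(1,3)]])
    show "\<forall>\<^sub>F t in at 0. 0 \<le> (g1 (x + h \<tau> a t) - t * (G1 x \<bullet> \<tau>)) / t\<^sup>2"
      using pos[OF \<tau> a] by eventually_elim (simp add: tang[OF \<tau>])
  qed simp
  have lo: "a * l + (\<tau> \<bullet> (D1 x *v \<tau>)) / 2 \<le> 0"
    if \<tau>: "\<tau> \<bullet> \<nu> = 0" and a: "a + (\<tau> \<bullet> (D2 x *v \<tau>)) / 2 < 0" for \<tau> a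
    unfolding l_def
  proof (rule tendsto_upperbound[OF curve[OF C1 x(1,3)]])
    show "\<forall>\<^sub>F t in at 0. (g1 (x + h \<tau> a t) - t * (G1 x \<bullet> \<tau>)) / t\<^sup>2 \<le> 0"
      using neg[OF \<tau> a] by eventually_elim (simp add: tang[OF \<tau>] divide_nonpos_nonneg)
  qed simp
  have "l \<ge> 0" using up[of 0 1] by simp
  then have l: "l = norm (G1 x)" using G1 n by (simp add: \<nu>_def)
  show "G1 x = norm (G1 x) *\<^sub>R G2 x" using G1 unfolding l \<nu>_def .
  assume "\<tau> \<bullet> G2 x = 0"
  then have \<tau>: "\<tau> \<bullet> \<nu> = 0" by (simp add: \<nu>_def)
  define q where "q = (\<tau> \<bullet> (D2 x *v \<tau>)) / 2"
  define q1 where "q1 = (\<tau> \<bullet> (D1 x *v \<tau>)) / 2"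
  \<comment> \<open>The parameter \<open>a\<close> is placed at distance \<open>e\<close> on either
    side of the critical value \<open>- q\<close>.\<close>
  have "q1 - q * l \<ge> - (e * l)" if "e > 0" for e :: real
    using up[OF \<tau>, of "e - q"] that by (simp add: q_def[symmetric] q1_def[symmetric] algebra_simps)
  moreover have "q1 - q * l \<le> e * l" if "e > 0" for e :: real
    using lo[OF \<tau>, of "- e - q"] that by (simp add: q_def[symmetric] q1_def[symmetric] algebra_simps)
  ultimately have b: "\<bar>q1 - q * l\<bar> \<le> e * l" if "e > 0" for e :: real
    unfolding abs_le_iff using that by (metis minus_le_iff)
  have "\<bar>q1 - q * l\<bar> \<le> 0"
  proof (rule field_le_epsilon)
    fix e :: real assume e: "e > 0"
    have "e / (l + 1) * l \<le> e" using e \<open>l \<ge> 0\<close> by (simp add: field_simps)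
    then show "\<bar>q1 - q * l\<bar> \<le> 0 + e" using b[of "e / (l + 1)"] e \<open>l \<ge> 0\<close> by simp
  qed
  then show "\<tau> \<bullet> (D1 x *v \<tau>) = norm (G1 x) * (\<tau> \<bullet> (D2 x *v \<tau>))"
    unfolding l[symmetric] by (simp add: q_def q1_def)
qed

section \<open>The chart-independent frame of normal and second fundamental form\<close>

lemma symmetric_matrix_eqI:
  fixes A B :: "real^'n^'n"
  assumes "transpose A = A" "transpose B = B" "\<And>v. v \<bullet> (A *v v) = v \<bullet> (B *v v)"
  shows "A = B"
proof -
  have "u \<bullet> (A *v v) = u \<bullet> (B *v v)" for u v
  proof -
    have *: "(u + v) \<bullet> (M *v (u + v)) = u \<bullet> (M *v u) + v \<bullet> (M *v v) + 2 * (u \<bullet> (M *v v))"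
      if "transpose M = M" for M :: "real^'n^'n"
      using inner_symmetric_matrix[OF that, of u v]
      by (simp add: matrix_vector_right_distrib inner_add inner_commute)
    show ?thesis using *[OF assms(1)] *[OF assms(2)] assms(3) by simp
  qed
  then have "A *v v = B *v v" for v by (metis vector_eq_ldot)
  then show ?thesis by (simp add: matrix_eq)
qed

text \<open>For a unit vector \<open>v\<close> this is the orthogonal projection onto the hyperplane
  normal to \<open>v\<close>, hence onto the tangent space when \<open>v\<close> is a boundary
  normal.\<close>

definition tproj :: "real^'n \<Rightarrow> real^'n^'n" where
  "tproj v = mat 1 - outer v"

lemma tproj_mult_vec: "tproj v *v x = x - (v \<bullet> x) *\<^sub>R v"
  by (simp add: tproj_def matrix_vector_mult_diff_rdistrib outer_mult_vec)

lemma transpose_tproj [simp]: "transpose (tproj v) = tproj v"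
proof -
  have "transpose (A - B) = transpose A - transpose B" for A B :: "real^'n^'n"
    by (simp add: transpose_def vec_eq_iff)
  from this[of "mat 1" "outer v"] show ?thesis by (simp add: tproj_def)
qed

text \<open>\<open>\<nu>\<close> is the inner unit normal and \<open>C\<close> the second
  fundamental form, extended by zero in the normal direction. The data at different boundary points
  come from unrelated charts; continuity in \<open>p\<close> is a theorem proved afterwards.\<close>

definition boundary_frame :: "(real^'n) set \<Rightarrow> (real^'n \<Rightarrow> real^'n) \<Rightarrow> (real^'n \<Rightarrow> real^'n^'n) \<Rightarrow> bool" where
  "boundary_frame \<Omega> \<nu> C \<longleftrightarrow> (\<forall>p\<in>frontier \<Omega>. norm (\<nu> p) = 1 \<and> transpose (C p) = C p \<and> C p *v \<nu> p = 0 \<and>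
     (\<forall>j. csig j (C p) = curv_sigma \<Omega> j p) \<and>
     (\<exists>U g G D. p \<in> U \<and> bdfun \<Omega> U g G D \<and> G p = \<nu> p \<and> D p = - C p))"

lemma boundary_frame_exists:
  assumes "C31_boundary \<Omega>"
  shows "\<exists>\<nu> C. boundary_frame \<Omega> \<nu> C"
proof -
  have "\<exists>n A. norm n = 1 \<and> transpose A = A \<and> A *v n = 0 \<and>
     (\<forall>j. csig j A = curv_sigma \<Omega> j p) \<and>
     (\<exists>U g G D. p \<in> U \<and> bdfun \<Omega> U g G D \<and> G p = n \<and> D p = - A)" if p: "p \<in> frontier \<Omega>" for p
  proof -
    \<comment> \<open>The very chart function that \<open>curv_sigma\<close> selects, so that the
      symmetric functions of the frame match it.\<close>
    define \<phi> where "\<phi> = (SOME \<phi>. \<exists>Q i0 r. boundary_chart \<Omega> p Q i0 \<phi> r)"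
    have "\<exists>\<phi> Q i0 r. boundary_chart \<Omega> p Q i0 \<phi> r" using assms p unfolding C31_boundary_def by blast
    then have "\<exists>Q i0 r. boundary_chart \<Omega> p Q i0 \<phi> r" unfolding \<phi>_def by (rule someI_ex)
    then obtain Q i0 r where ch: "boundary_chart \<Omega> p Q i0 \<phi> r" by blast
    have "curv_sigma \<Omega> j p = Sk j (hess \<phi> 0)" for j by (simp add: curv_sigma_def \<phi>_def Let_def)
    then show ?thesis
      using chart_bdfun[OF ch] by (intro exI[of _ "Q *v axis i0 1"] exI[of _ "Q ** hess \<phi> 0 ** transpose Q"]) simp
  qed
  then show ?thesis unfolding boundary_frame_def
    by (metis (no_types, lifting))
qed

text \<open>One fixed defining function determines the frame at every boundary point of its domain
  \<open>U\<close>. Uniqueness controls \<open>D\<close> only on tangential vectors, hence the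
  projections on both sides.\<close>

lemma bdfun_frame:
  assumes \<Omega>: "open \<Omega>" and fr: "boundary_frame \<Omega> \<nu> C" and b: "bdfun \<Omega> U g G D"
    and x: "x \<in> U" "x \<in> frontier \<Omega>"
  shows "G x = norm (G x) *\<^sub>R \<nu> x"
    and "C x = - (1 / norm (G x)) *\<^sub>R (tproj (G x /\<^sub>R norm (G x)) ** D x ** tproj (G x /\<^sub>R norm (G x)))"
proof -
  obtain U2 g2 G2 D2 where b2: "x \<in> U2" "bdfun \<Omega> U2 g2 G2 D2" "G2 x = \<nu> x" "D2 x = - C x"
    and n: "norm (\<nu> x) = 1" "transpose (C x) = C x" "C x *v \<nu> x = 0"
    using fr x(2) unfolding boundary_frame_def by blast
  have z: "g x = 0" "g2 x = 0" using bdfun_frontier[OF \<Omega>] b b2 x by auto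
  note u = bdfun_unique[OF b b2(2) x(1) b2(1) z, unfolded b2(3), OF n(1)]
  have G1: "norm (G x) \<ge> 1" using b x by (simp add: bdfun_def)
  show "G x = norm (G x) *\<^sub>R \<nu> x" by (rule u(1))
  then have \<nu>: "\<nu> x = G x /\<^sub>R norm (G x)" using G1
    by (metis divideR_right norm_zero not_one_le_zero scaleR_zero_left)
  have symD: "transpose (D x) = D x" using b x by (simp add: bdfun_def C2fun_def)
  let ?P = "tproj (\<nu> x)"
  have sc: "transpose (c *\<^sub>R A) = c *\<^sub>R transpose A" for c and A :: "real^'a^'a"
    by (simp add: transpose_def vec_eq_iff)
  have "C x = - (1 / norm (G x)) *\<^sub>R (?P ** D x ** ?P)"
  proof (rule symmetric_matrix_eqI)
    show "transpose (C x) = C x" by (rule n(2))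
    show "transpose (- (1 / norm (G x)) *\<^sub>R (?P ** D x ** ?P)) = - (1 / norm (G x)) *\<^sub>R (?P ** D x ** ?P)"
      unfolding sc matrix_transpose_mul transpose_tproj symD by (simp add: matrix_mul_assoc)
    fix v
    define \<tau> where "\<tau> = ?P *v v"
    have v: "v = \<tau> + (\<nu> x \<bullet> v) *\<^sub>R \<nu> x" by (simp add: \<tau>_def tproj_mult_vec)
    have \<tau>: "\<tau> \<bullet> \<nu> x = 0" using n(1) by (simp add: \<tau>_def tproj_mult_vec inner_diff inner_commute norm_eq_1)
    have Cv: "C x *v v = C x *v \<tau>"
      by (subst v) (simp add: matrix_vector_right_distrib matrix_vector_mult_scaleR n(3))
    have "v \<bullet> (C x *v v) = (C x *v v) \<bullet> \<tau>"
      unfolding Cv by (subst inner_symmetric_matrix[OF n(2), symmetric]) (simp add: Cv)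
    also have "\<dots> = \<tau> \<bullet> (C x *v \<tau>)" by (simp add: Cv inner_commute)
    finally have l: "v \<bullet> (C x *v v) = \<tau> \<bullet> (C x *v \<tau>)" .
    have neg: "(- A) *v h = - (A *v h)" for A :: "real^'a^'a" and h
      using matrix_vector_mult_diff_rdistrib[of 0 A h] by simp
    have "v \<bullet> ((?P ** D x ** ?P) *v v) = v \<bullet> (?P *v (D x *v \<tau>))"
      by (simp add: \<tau>_def matrix_vector_mul_assoc matrix_mul_assoc)
    also have "\<dots> = \<tau> \<bullet> (D x *v \<tau>)"
      unfolding \<tau>_def by (rule inner_symmetric_matrix[OF transpose_tproj, symmetric])
    also have "\<dots> = - norm (G x) * (\<tau> \<bullet> (C x *v \<tau>))"
      using u(2)[OF \<tau>] by (simp add: b2(4) neg)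
    finally show "v \<bullet> (C x *v v) = v \<bullet> ((- (1 / norm (G x)) *\<^sub>R (?P ** D x ** ?P)) *v v)"
      unfolding l scaleR_matrix_vector_assoc[symmetric] inner_scaleR_right using G1 by auto
  qed
  then show "C x = - (1 / norm (G x)) *\<^sub>R (tproj (G x /\<^sub>R norm (G x)) ** D x ** tproj (G x /\<^sub>R norm (G x)))"
    unfolding \<nu> .
qed

lemma continuous_on_matrix_mult:
  fixes A :: "'a::topological_space \<Rightarrow> real^'n^'m" and B :: "'a \<Rightarrow> real^'k^'n"
  assumes "continuous_on S A" "continuous_on S B"
  shows "continuous_on S (\<lambda>x. A x ** B x)"
  unfolding matrix_matrix_mult_def using assms by (auto intro!: continuous_intros)

lemma continuous_on_tproj:
  assumes "continuous_on S v"
  shows "continuous_on S (\<lambda>x. tproj (v x))"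
  unfolding tproj_def outer_def using assms by (auto intro!: continuous_intros)

text \<open>Although \<open>C\<close> is assembled from independent choices, near each boundary
  point it is a single continuous expression in the gradient and Hessian of one chart.\<close>

lemma boundary_frame_continuous:
  assumes \<Omega>: "open \<Omega>" and fr: "boundary_frame \<Omega> \<nu> C"
  shows "continuous_on (frontier \<Omega>) C"
  unfolding continuous_on_eq_continuous_within
proof
  fix p assume p: "p \<in> frontier \<Omega>"
  obtain U g G D where b: "p \<in> U" "bdfun \<Omega> U g G D"
    using fr p unfolding boundary_frame_def by blast
  have C2: "C2fun U g G D" and U: "open U" using b by (auto simp: bdfun_def C2fun_def)
  have G0: "G x \<noteq> 0" if "x \<in> U" for x using b that by (fastforce simp: bdfun_def)
  have cG: "continuous_on U G" by (rule C2fun_grad_cont[OF C2])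
  have cD: "continuous_on U D" using C2 by (simp add: C2fun_def)
  have "continuous_on U (\<lambda>x. G x /\<^sub>R norm (G x))"
    by (intro continuous_intros cG) (use G0 in auto)
  then have "continuous_on U (\<lambda>x. - (1 / norm (G x)) *\<^sub>R (tproj (G x /\<^sub>R norm (G x)) ** D x ** tproj (G x /\<^sub>R norm (G x))))"
    by (intro continuous_intros cG continuous_on_matrix_mult continuous_on_tproj cD) (use G0 in auto)
  then have "continuous_on (frontier \<Omega> \<inter> U) (\<lambda>x. - (1 / norm (G x)) *\<^sub>R (tproj (G x /\<^sub>R norm (G x)) ** D x ** tproj (G x /\<^sub>R norm (G x))))"
    by (rule continuous_on_subset) auto
  then have "continuous_on (frontier \<Omega> \<inter> U) C"
    by (rule continuous_on_eq) (use bdfun_frame(2)[OF \<Omega> fr b(2)] in auto)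
  then have "continuous (at p within (frontier \<Omega> \<inter> U)) C"
    using p b(1) by (auto simp: continuous_on_eq_continuous_within)
  moreover have "at p within (frontier \<Omega> \<inter> U) = at p within frontier \<Omega>"
    by (rule at_within_nhd[OF b(1) U]) auto
  ultimately show "continuous (at p within frontier \<Omega>) C" by simp
qed

text \<open>Compactness: since \<open>\<nu>\<close> has unit length, a pair violating the bound with
  a large constant must be close together, so along a subsequence both points fall into one chart.
  There they are zeros of \<open>g\<close>, and the quadratic bound for \<open>g\<close> contradicts
  the violation.\<close>

lemma boundary_frame_uniform:
  assumes \<Omega>: "open \<Omega>" "bounded \<Omega>" and fr: "boundary_frame \<Omega> \<nu> C"
  shows "\<exists>K>0. \<forall>x\<in>frontier \<Omega>. \<forall>z\<in>frontier \<Omega>. \<bar>\<nu> x \<bullet> (z - x)\<bar> \<le> K * (norm (z - x))\<^sup>2"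
proof (rule ccontr)
  assume neg: "\<not> ?thesis"
  have "\<exists>x z. x \<in> frontier \<Omega> \<and> z \<in> frontier \<Omega> \<and> \<bar>\<nu> x \<bullet> (z - x)\<bar> > real (Suc n) * (norm (z - x))\<^sup>2" for n
    using neg by (simp only: not_ex de_Morgan_conj not_le not_less) (metis not_le of_nat_0_less_iff zero_less_Suc)
  then obtain X Z where XZ: "\<And>n. X n \<in> frontier \<Omega>" "\<And>n. Z n \<in> frontier \<Omega>"
      "\<And>n. \<bar>\<nu> (X n) \<bullet> (Z n - X n)\<bar> > real (Suc n) * (norm (Z n - X n))\<^sup>2"
    by metis
  have comp: "compact (frontier \<Omega>)" using \<Omega> by (simp add: compact_frontier_bounded)
  obtain p s where p: "p \<in> frontier \<Omega>" and s: "strict_mono (s :: nat \<Rightarrow> nat)" "(X \<circ> s) \<longlonglongrightarrow> p"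
    using comp XZ(1) unfolding compact_def by metis
  have close: "norm (Z n - X n) \<le> 1 / real (Suc n)" for n
  proof (cases "Z n = X n")
    case False
    have "\<bar>\<nu> (X n) \<bullet> (Z n - X n)\<bar> \<le> norm (Z n - X n)"
      using Cauchy_Schwarz_ineq2[of "\<nu> (X n)" "Z n - X n"] fr XZ(1) by (simp add: boundary_frame_def)
    with XZ(3)[of n] have "real (Suc n) * (norm (Z n - X n))\<^sup>2 < norm (Z n - X n)" by linarith
    then have "real (Suc n) * norm (Z n - X n) < 1" using False by (simp add: power2_eq_square)
    then show ?thesis by (simp add: field_simps)
  qed simp
  obtain U g G D where b: "p \<in> U" "bdfun \<Omega> U g G D"
    using fr p unfolding boundary_frame_def by blast
  then have C2: "C2fun U g G D" by (simp add: bdfun_def)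
  obtain r K where r: "r > 0" "ball p r \<subseteq> U"
    and K: "\<And>y z. y \<in> ball p r \<Longrightarrow> z \<in> ball p r \<Longrightarrow> \<bar>g z - g y - G y \<bullet> (z - y)\<bar> \<le> K * (norm (z - y))\<^sup>2"
    using C2fun_quadratic_bound[OF C2 b(1)] by metis
  have "(\<lambda>n. norm (X (s n) - p) + 1 / real (Suc (s n))) \<longlonglongrightarrow> norm (p - p) + 0"
  proof (intro tendsto_add tendsto_norm tendsto_diff tendsto_const)
    show "(\<lambda>n. X (s n)) \<longlonglongrightarrow> p" using s(2) by (simp add: comp_def)
    show "(\<lambda>n. 1 / real (Suc (s n))) \<longlonglongrightarrow> 0"
      using LIMSEQ_subseq_LIMSEQ[OF LIMSEQ_inverse_real_of_nat s(1)] by (simp add: comp_def inverse_eq_divide)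
  qed
  then have "\<forall>\<^sub>F n in sequentially. norm (X (s n) - p) + 1 / real (Suc (s n)) < r"
    by (rule order_tendstoD) (use r in simp)
  moreover have "\<forall>\<^sub>F n in sequentially. real (Suc (s n)) > K"
    using filterlim_compose[OF filterlim_real_sequentially filterlim_compose[OF filterlim_Suc filterlim_subseq[OF s(1)]]]
    by (simp add: filterlim_at_top_dense)
  ultimately have "\<forall>\<^sub>F n in sequentially. norm (X (s n) - p) + 1 / real (Suc (s n)) < r \<and> real (Suc (s n)) > K"
    by eventually_elim simp
  then obtain n where n: "norm (X (s n) - p) + 1 / real (Suc (s n)) < r" "real (Suc (s n)) > K"
    using eventually_happens'[OF sequentially_bot] by blast
  define x z where "x = X (s n)" and "z = Z (s n)"
  have "norm (z - x) \<le> 1 / real (Suc (s n))" using close by (simp add: x_def z_def)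
  moreover have "norm (z - p) \<le> norm (z - x) + norm (x - p)"
    using norm_triangle_ineq[of "z - x" "x - p"] by simp
  moreover have "norm (x - p) < r" using n(1) by (simp add: x_def) (smt (verit) divide_nonneg_nonneg of_nat_0_le_iff)
  ultimately have inb: "x \<in> ball p r" "z \<in> ball p r"
    using n(1) by (auto simp: x_def dist_norm norm_minus_commute)
  have fx: "x \<in> frontier \<Omega>" "z \<in> frontier \<Omega>" using XZ by (auto simp: x_def z_def)
  have "g x = 0" "g z = 0" using bdfun_frontier[OF \<Omega>(1) b(2)] inb fx r by auto
  then have "\<bar>G x \<bullet> (z - x)\<bar> \<le> K * (norm (z - x))\<^sup>2" using K[OF inb] by simp
  moreover have "\<bar>G x \<bullet> (z - x)\<bar> = norm (G x) * \<bar>\<nu> x \<bullet> (z - x)\<bar>"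
    by (subst bdfun_frame(1)[OF \<Omega>(1) fr b(2)]) (use inb r fx in \<open>auto simp: abs_mult\<close>)
  moreover have "norm (G x) \<ge> 1" using b(2) inb r by (auto simp: bdfun_def)
  then have "norm (G x) * \<bar>\<nu> x \<bullet> (z - x)\<bar> \<ge> \<bar>\<nu> x \<bullet> (z - x)\<bar>" by (simp add: mult_le_cancel_right1)
  moreover have "K * (norm (z - x))\<^sup>2 \<le> real (Suc (s n)) * (norm (z - x))\<^sup>2"
    using n(2) by (intro mult_right_mono) auto
  ultimately show False using XZ(3)[of "s n"] by (simp add: x_def z_def)
qed

text \<open>Membership is the sign of \<open>g\<close>, which at \<open>p\<close> expands as
  \<open>\<nu> p \<bullet> h\<close> minus half of \<open>h \<bullet> (C p *v h)\<close>. The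
  boundary is thereby caught between two paraboloids.\<close>

lemma boundary_frame_second_order:
  assumes \<Omega>: "open \<Omega>" and fr: "boundary_frame \<Omega> \<nu> C" and p: "p \<in> frontier \<Omega>" and e: "e > 0"
  shows "\<exists>r>0. \<forall>h. norm h < r \<longrightarrow>
     (p + h \<in> \<Omega> \<longrightarrow> \<nu> p \<bullet> h > (h \<bullet> (C p *v h)) / 2 - e * (norm h)\<^sup>2) \<and>
     (p + h \<notin> \<Omega> \<longrightarrow> \<nu> p \<bullet> h \<le> (h \<bullet> (C p *v h)) / 2 + e * (norm h)\<^sup>2)"
proof -
  obtain U g G D where b: "p \<in> U" "bdfun \<Omega> U g G D" "G p = \<nu> p" "D p = - C p"
    using fr p unfolding boundary_frame_def by blast
  then have C2: "C2fun U g G D" by (simp add: bdfun_def)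
  have g0: "g p = 0" by (rule bdfun_frontier[OF \<Omega> b(2,1) p])
  have neg: "(- A) *v h = - (A *v h)" for A :: "real^'a^'a" and h
    using matrix_vector_mult_diff_rdistrib[of 0 A h] by simp
  obtain r1 where r1: "r1 > 0" "\<And>h. norm h < r1 \<Longrightarrow> \<bar>g (p + h) - \<nu> p \<bullet> h + (h \<bullet> (C p *v h)) / 2\<bar> \<le> e * (norm h)\<^sup>2"
    using C2fun_taylor[OF C2 b(1) e] by (auto simp: b g0 neg)
  obtain r2 where r2: "r2 > 0" "ball p r2 \<subseteq> U" using C2 b(1) by (auto simp: C2fun_def open_contains_ball)
  have "(p + h \<in> \<Omega> \<longrightarrow> \<nu> p \<bullet> h > (h \<bullet> (C p *v h)) / 2 - e * (norm h)\<^sup>2) \<and>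
     (p + h \<notin> \<Omega> \<longrightarrow> \<nu> p \<bullet> h \<le> (h \<bullet> (C p *v h)) / 2 + e * (norm h)\<^sup>2)" if h: "norm h < min r1 r2" for h
  proof -
    have "p + h \<in> ball p r2" using h by (simp add: dist_norm)
    then have "p + h \<in> \<Omega> \<longleftrightarrow> g (p + h) > 0" using b(2) r2 by (auto simp: bdfun_def)
    then show ?thesis using r1(2)[of h] h by (auto simp: abs_le_iff)
  qed
  then show ?thesis using r1 r2 by (intro exI[of _ "min r1 r2"]) auto
qed

section \<open>Second order expansion of the distance function\<close>

lemma frontier_bounded_nonempty:
  fixes \<Omega> :: "(real^'n) set"
  assumes "bounded \<Omega>" "\<Omega> \<noteq> {}"
  shows "frontier \<Omega> \<noteq> {}"
  using assms not_bounded_UNIV by (auto simp: frontier_eq_empty)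

lemma dist_bd_le: "p \<in> frontier \<Omega> \<Longrightarrow> dist_bd \<Omega> x \<le> norm (x - p)"
  unfolding dist_bd_def by (metis dist_norm infdist_le)

lemma dist_bd_attained:
  assumes "frontier \<Omega> \<noteq> {}"
  obtains p where "p \<in> frontier \<Omega>" "dist_bd \<Omega> x = norm (x - p)"
  using infdist_attains_inf[OF frontier_closed assms, of x] unfolding dist_bd_def dist_norm by blast

lemma dist_bd_pos:
  assumes "open \<Omega>" "frontier \<Omega> \<noteq> {}" "x \<in> \<Omega>"
  shows "dist_bd \<Omega> x > 0"
proof -
  have "x \<notin> frontier \<Omega>" using assms by (simp add: frontier_def interior_open)
  then show ?thesis unfolding dist_bd_def
    using infdist_pos_not_in_closed[OF frontier_closed assms(2)] by blast
qed

lemma ball_dist_bd_subset: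
  assumes "open \<Omega>" "x \<in> \<Omega>"
  shows "ball x (dist_bd \<Omega> x) \<subseteq> \<Omega>"
proof
  fix y assume y: "y \<in> ball x (dist_bd \<Omega> x)"
  show "y \<in> \<Omega>"
  proof (rule ccontr)
    assume "y \<notin> \<Omega>"
    moreover have "x \<in> ball x (dist_bd \<Omega> x)" using y by (metis ball_eq_empty centre_in_ball empty_iff not_le)
    ultimately have "ball x (dist_bd \<Omega> x) \<inter> frontier \<Omega> \<noteq> {}"
      using assms(2) y connected_Int_frontier[OF connected_ball, of x "dist_bd \<Omega> x" \<Omega>] by blast
    then show False using dist_bd_le[of _ \<Omega> x] by (force simp: dist_norm)
  qed
qed

lemma quad_form_le: "\<bar>u \<bullet> (A *v v)\<bar> \<le> norm A * norm u * norm v" for A :: "real^'n^'n"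
proof -
  have "\<bar>u \<bullet> (A *v v)\<bar> \<le> norm u * norm (A *v v)" by (rule Cauchy_Schwarz_ineq2)
  also have "\<dots> \<le> norm u * (norm A * norm v)" by (intro mult_left_mono matrix_vector_norm_bound) simp
  finally show ?thesis by (simp add: mult_ac)
qed

text \<open>If the direction of \<open>x - p\<close> were not the normal, some boundary direction
  \<open>w\<close> would point out of the domain to first order and yet into the ball around
  \<open>x\<close> of radius \<open>dist_bd \<Omega> x\<close>, which lies inside the
  domain.\<close>

lemma nearest_point_normal:
  assumes \<Omega>: "open \<Omega>" and fr: "boundary_frame \<Omega> \<nu> C"
    and x: "x \<in> \<Omega>" and p: "p \<in> frontier \<Omega>" "dist_bd \<Omega> x = norm (x - p)"
  shows "x - p = dist_bd \<Omega> x *\<^sub>R \<nu> p"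
proof (rule ccontr)
  define d where "d = dist_bd \<Omega> x"
  assume neg: "x - p \<noteq> dist_bd \<Omega> x *\<^sub>R \<nu> p"
  have d: "d > 0" unfolding d_def using \<Omega> p(1) x by (intro dist_bd_pos) auto
  have n: "\<nu> p \<bullet> \<nu> p = 1" using fr p by (simp add: boundary_frame_def norm_eq_1)
  define v where "v = x - p"
  have vv: "v \<bullet> v = d\<^sup>2" using p(2) by (simp add: d_def v_def power2_norm_eq_inner)
  \<comment> \<open>Its normal component is \<open>- W / 2\<close>, while \<open>p + t w\<close>
    remains in the ball around \<open>x\<close> for \<open>0 < t < d\<close>.\<close>
  define w where "w = v /\<^sub>R d - \<nu> p"
  have w0: "w \<noteq> 0" 
  proof
    assume "w = 0"
    then have "\<nu> p = v /\<^sub>R d" by (simp add: w_def)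
    then have "v = d *\<^sub>R \<nu> p" using d by simp
    then show False using neg by (simp add: v_def d_def)
  qed
  define W where "W = w \<bullet> w"
  have W: "W > 0" using w0 by (simp add: W_def)
  have W1: "W = 2 - 2 * (\<nu> p \<bullet> v) / d"
    using d vv n by (simp add: W_def w_def inner_diff inner_commute power2_eq_square field_simps)
  have wv: "w \<bullet> v = d * W / 2"
    unfolding W1 using d vv by (simp add: w_def inner_diff inner_commute power2_eq_square field_simps)
  have wn: "\<nu> p \<bullet> w = - W / 2"
    unfolding W1 using d n by (simp add: w_def inner_diff inner_commute field_simps)
  obtain r where r: "r > 0" "\<And>h. norm h < r \<Longrightarrow> p + h \<in> \<Omega> \<Longrightarrow> \<nu> p \<bullet> h > (h \<bullet> (C p *v h)) / 2 - 1 * (norm h)\<^sup>2"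
    using boundary_frame_second_order[OF \<Omega> fr p(1), of 1] by auto
  define c where "c = norm (C p) / 2 + 1"
  have c: "c > 0" by (simp add: c_def add_nonneg_pos)
  \<comment> \<open>The three bounds keep the point in the ball, make the outward term
    \<open>t W / 2\<close> at least as large as the quadratic error \<open>t^2 c W\<close>, and keep
    the increment within the range of the expansion.\<close>
  define t where "t = min (d / 2) (min (1 / (2 * c)) (r / (2 * norm w)))"
  have t: "0 < t" "t < d" "t \<le> 1 / (2 * c)" "t \<le> r / (2 * norm w)"
    using d c r w0 by (auto simp: t_def)
  have "(norm (t *\<^sub>R w - v))\<^sup>2 = t * (t - d) * W + d\<^sup>2"
  proof -
    have "(norm (t *\<^sub>R w - v))\<^sup>2 = t * t * W - 2 * t * (w \<bullet> v) + v \<bullet> v"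
      unfolding power2_norm_eq_inner by (simp add: inner_diff inner_commute W_def)
    then show ?thesis unfolding wv vv by (simp add: algebra_simps)
  qed
  also have "\<dots> < d\<^sup>2" using t W by (simp add: mult_less_0_iff)
  finally have "norm (t *\<^sub>R w - v) < d" using d by (simp add: power2_less_imp_less)
  then have "p + t *\<^sub>R w \<in> ball x (dist_bd \<Omega> x)"
    by (simp add: d_def v_def dist_norm norm_minus_commute algebra_simps)
  then have "p + t *\<^sub>R w \<in> \<Omega>" using ball_dist_bd_subset[OF \<Omega> x] by blast
  moreover have "norm (t *\<^sub>R w) < r"
  proof -
    have "norm (t *\<^sub>R w) \<le> r / (2 * norm w) * norm w" using t by (simp add: mult_right_mono del: times_divide_eq_left)
    also have "\<dots> < r" using w0 r by simp
    finally show ?thesis .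
  qed
  ultimately have "\<nu> p \<bullet> (t *\<^sub>R w) > ((t *\<^sub>R w) \<bullet> (C p *v (t *\<^sub>R w))) / 2 - 1 * (norm (t *\<^sub>R w))\<^sup>2"
    by (intro r)
  moreover have "(norm (t *\<^sub>R w))\<^sup>2 = t\<^sup>2 * W"
    unfolding power2_norm_eq_inner by (simp add: W_def power2_eq_square)
  ultimately have "- (t * W / 2) > t\<^sup>2 * ((w \<bullet> (C p *v w)) / 2 - W)"
    by (simp add: wn matrix_vector_mult_scaleR power2_eq_square algebra_simps)
  moreover have "(w \<bullet> (C p *v w)) / 2 - W \<ge> - (c * W)"
  proof -
    have "norm (C p) * norm w * norm w = norm (C p) * W"
      unfolding W_def power2_norm_eq_inner[symmetric] by (simp add: power2_eq_square)
    then have "w \<bullet> (C p *v w) \<ge> - (norm (C p) * W)" using quad_form_le[of w "C p" w] by linarith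
    then show ?thesis by (simp add: c_def algebra_simps)
  qed
  then have "t\<^sup>2 * ((w \<bullet> (C p *v w)) / 2 - W) \<ge> t\<^sup>2 * (- (c * W))" by (intro mult_left_mono) auto
  ultimately have "t * (t * c * W) > t * (W / 2)" by (simp add: power2_eq_square algebra_simps)
  then have "t * c * W > W / 2" using t(1) by (metis mult_less_cancel_left_pos)
  moreover have "t * c \<le> 1 / 2" using t(3) c by (simp add: field_simps)
  then have "t * c * W \<le> 1 / 2 * W" using W by (intro mult_right_mono) auto
  ultimately show False by simp
qed

lemma boundary_frame_decomp:
  assumes n: "norm \<nu> = (1::real)" and C: "transpose C = C" "C *v \<nu> = 0"
  shows "(tproj \<nu> *v h + s *\<^sub>R \<nu>) \<bullet> (C *v (tproj \<nu> *v h + s *\<^sub>R \<nu>)) = h \<bullet> (C *v h)"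
    "h \<bullet> (C *v h) = (tproj \<nu> *v h) \<bullet> (C *v (tproj \<nu> *v h))"
    "h \<bullet> (tproj \<nu> *v h) = (norm (tproj \<nu> *v h))\<^sup>2"
    "\<nu> \<bullet> (tproj \<nu> *v h) = 0" "norm (tproj \<nu> *v h) \<le> norm h"
    "h = tproj \<nu> *v h + (\<nu> \<bullet> h) *\<^sub>R \<nu>"
proof -
  have nn: "\<nu> \<bullet> \<nu> = 1" using n by (simp add: norm_eq_1)
  define \<tau> where "\<tau> = tproj \<nu> *v h"
  show z: "\<nu> \<bullet> (tproj \<nu> *v h) = 0" by (simp add: tproj_mult_vec inner_diff nn)
  show h: "h = tproj \<nu> *v h + (\<nu> \<bullet> h) *\<^sub>R \<nu>" by (simp add: tproj_mult_vec)
  have g: "(\<tau> + s *\<^sub>R \<nu>) \<bullet> (C *v (\<tau> + s *\<^sub>R \<nu>)) = \<tau> \<bullet> (C *v \<tau>)" for s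
    using inner_symmetric_matrix[OF C(1), of \<nu> \<tau>]
    by (simp add: matrix_vector_right_distrib matrix_vector_mult_scaleR C inner_add)
  have h': "h = \<tau> + (\<nu> \<bullet> h) *\<^sub>R \<nu>" using h unfolding \<tau>_def .
  show 2: "h \<bullet> (C *v h) = (tproj \<nu> *v h) \<bullet> (C *v (tproj \<nu> *v h))"
    using g[of "\<nu> \<bullet> h"] h' unfolding \<tau>_def by metis
  show "(tproj \<nu> *v h + s *\<^sub>R \<nu>) \<bullet> (C *v (tproj \<nu> *v h + s *\<^sub>R \<nu>)) = h \<bullet> (C *v h)"
    using g 2 unfolding \<tau>_def by simp
  have "h \<bullet> \<tau> = \<tau> \<bullet> \<tau>" by (subst h') (simp add: inner_add z[folded \<tau>_def])
  then show 3: "h \<bullet> (tproj \<nu> *v h) = (norm (tproj \<nu> *v h))\<^sup>2" by (simp add: \<tau>_def power2_norm_eq_inner)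
  have "(norm \<tau>)\<^sup>2 \<le> norm h * norm \<tau>" using Cauchy_Schwarz_ineq2[of h \<tau>] 3 by (simp add: \<tau>_def)
  then show "norm (tproj \<nu> *v h) \<le> norm h"
    unfolding \<tau>_def[symmetric] by (cases "\<tau> = 0") (auto simp: power2_eq_square)
qed

lemma norm_add_normal:
  assumes "norm v = 1" "v \<bullet> \<tau> = 0"
  shows "(norm (\<tau> + t *\<^sub>R v))\<^sup>2 = (norm \<tau>)\<^sup>2 + t\<^sup>2"
proof -
  have "v \<bullet> v = 1" using assms by (simp add: norm_eq_1)
  then show ?thesis unfolding power2_norm_eq_inner using assms(2)
    by (simp add: inner_add inner_commute power2_eq_square)
qed

text \<open>An upper bound needs only one competitor. Descending from \<open>x + h\<close> along
  \<open>- \<nu> p\<close> to a point just below the osculating paraboloid leaves the domain, so the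
  segment meets the boundary and its explicit length bounds the distance.\<close>

lemma dist_bd_upper:
  assumes \<Omega>: "open \<Omega>" and fr: "boundary_frame \<Omega> \<nu> C"
    and x: "x \<in> \<Omega>" and p: "p \<in> frontier \<Omega>" "dist_bd \<Omega> x = norm (x - p)" and e: "\<eta> > 0"
  shows "\<exists>r>0. \<forall>h. norm h < r \<longrightarrow>
     dist_bd \<Omega> (x + h) \<le> dist_bd \<Omega> x + \<nu> p \<bullet> h - (h \<bullet> (C p *v h) - \<eta> * (h \<bullet> (tproj (\<nu> p) *v h))) / 2"
proof -
  define d where "d = dist_bd \<Omega> x"
  have d: "d > 0" unfolding d_def using \<Omega> p(1) x by (intro dist_bd_pos) auto
  have xp: "x = p + d *\<^sub>R \<nu> p"
    using nearest_point_normal[OF \<Omega> fr x p] by (simp add: d_def algebra_simps)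
  have n: "norm (\<nu> p) = 1" "transpose (C p) = C p" "C p *v \<nu> p = 0"
    using fr p by (auto simp: boundary_frame_def)
  note dec = boundary_frame_decomp[OF n]
  obtain r1 where r1: "r1 > 0" "\<And>h. norm h < r1 \<Longrightarrow> p + h \<in> \<Omega> \<Longrightarrow> \<nu> p \<bullet> h > (h \<bullet> (C p *v h)) / 2 - \<eta> / 4 * (norm h)\<^sup>2"
    using boundary_frame_second_order[OF \<Omega> fr p(1), of "\<eta> / 4"] e by auto
  obtain r2 where r2: "r2 > 0" "ball x r2 \<subseteq> \<Omega>" using \<Omega> x open_contains_ball by blast
  define K where "K = norm (C p) + \<eta> + 1"
  have K: "K \<ge> 1" using e by (simp add: K_def)
  define r where "r = min (min r2 (r1 / 2)) (min (1 / K) (d / 4))"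
  have r: "r > 0" "r \<le> r2" "r \<le> r1 / 2" "r \<le> 1 / K" "r \<le> d / 4" using r1 r2 K d by (auto simp: r_def)
  have "dist_bd \<Omega> (x + h) \<le> d + \<nu> p \<bullet> h - (h \<bullet> (C p *v h) - \<eta> * (h \<bullet> (tproj (\<nu> p) *v h))) / 2"
    if h: "norm h < r" for h
  proof -
    define \<tau> where "\<tau> = tproj (\<nu> p) *v h"
    define s where "s = \<nu> p \<bullet> h"
    \<comment> \<open>The height of the paraboloid lowered by \<open>\<eta> / 2\<close>. The
      expansion error has constant \<open>\<eta> / 4\<close> but involves the full displacement,
      whose square is at most twice that of \<open>\<tau>\<close>.\<close>
    define t where "t = (\<tau> \<bullet> (C p *v \<tau>)) / 2 - \<eta> * (norm \<tau>)\<^sup>2 / 2"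
    have hs: "h = \<tau> + s *\<^sub>R \<nu> p" using dec(6)[of h] by (simp add: \<tau>_def s_def)
    have \<tau>n: "\<nu> p \<bullet> \<tau> = 0" "norm \<tau> \<le> norm h" using dec(4,5) by (auto simp: \<tau>_def)
    have tab: "\<bar>t\<bar> \<le> K * (norm \<tau>)\<^sup>2"
    proof -
      have "\<bar>\<tau> \<bullet> (C p *v \<tau>)\<bar> \<le> norm (C p) * (norm \<tau>)\<^sup>2"
        using quad_form_le[of \<tau> "C p" \<tau>] by (simp add: power2_eq_square mult.assoc)
      moreover have "K * (norm \<tau>)\<^sup>2 = norm (C p) * (norm \<tau>)\<^sup>2 + \<eta> * (norm \<tau>)\<^sup>2 + (norm \<tau>)\<^sup>2"
        by (simp add: K_def algebra_simps)
      moreover have "\<eta> * (norm \<tau>)\<^sup>2 \<ge> 0" "norm (C p) * (norm \<tau>)\<^sup>2 \<ge> 0" using e by auto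
      moreover have "(norm \<tau>)\<^sup>2 \<ge> 0" by simp
      ultimately show ?thesis unfolding t_def by linarith
    qed
    have K\<tau>: "K * norm \<tau> \<le> 1" using \<tau>n h r(4) K by (simp add: field_simps) (smt (verit) mult_left_mono)
    have tt: "\<bar>t\<bar> \<le> norm \<tau>"
      using tab mult_right_mono[OF K\<tau>, of "norm \<tau>"] by (simp add: power2_eq_square mult.assoc)
    define y where "y = p + (\<tau> + t *\<^sub>R \<nu> p)"
    have ny: "(norm (\<tau> + t *\<^sub>R \<nu> p))\<^sup>2 = (norm \<tau>)\<^sup>2 + t\<^sup>2"
      by (rule norm_add_normal[OF n(1) \<tau>n(1)])
    have yO: "y \<notin> \<Omega>"
    proof
      assume "y \<in> \<Omega>"
      have "norm (\<tau> + t *\<^sub>R \<nu> p) \<le> norm \<tau> + \<bar>t\<bar>" using norm_triangle_ineq[of \<tau> "t *\<^sub>R \<nu> p"] n(1) by simp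
      also have "\<dots> < r1" using tt \<tau>n h r(3) by linarith
      finally have "\<nu> p \<bullet> (\<tau> + t *\<^sub>R \<nu> p) > ((\<tau> + t *\<^sub>R \<nu> p) \<bullet> (C p *v (\<tau> + t *\<^sub>R \<nu> p))) / 2 - \<eta> / 4 * (norm (\<tau> + t *\<^sub>R \<nu> p))\<^sup>2"
        using \<open>y \<in> \<Omega>\<close> by (intro r1(2)) (auto simp: y_def)
      moreover have "\<nu> p \<bullet> (\<tau> + t *\<^sub>R \<nu> p) = t" using \<tau>n(1) n(1) by (simp add: inner_add norm_eq_1)
      moreover have "(\<tau> + t *\<^sub>R \<nu> p) \<bullet> (C p *v (\<tau> + t *\<^sub>R \<nu> p)) = \<tau> \<bullet> (C p *v \<tau>)"
        unfolding \<tau>_def dec(1) by (rule dec(2))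
      ultimately have "\<eta> / 4 * ((norm \<tau>)\<^sup>2 + t\<^sup>2) > \<eta> * (norm \<tau>)\<^sup>2 / 2" unfolding ny by (simp add: t_def)
      moreover have "t\<^sup>2 \<le> (norm \<tau>)\<^sup>2" using tt by (metis abs_norm_cancel abs_le_square_iff)
      then have "\<eta> / 4 * ((norm \<tau>)\<^sup>2 + t\<^sup>2) \<le> \<eta> / 4 * (2 * (norm \<tau>)\<^sup>2)" using e by (intro mult_left_mono) auto
      ultimately show False by simp
    qed
    have xO: "x + h \<in> \<Omega>" using r2 h r(2) by (auto simp: dist_norm)
    have "closed_segment (x + h) y \<inter> frontier \<Omega> \<noteq> {}"
      using xO yO connected_Int_frontier[OF connected_segment(1), of "x + h" y \<Omega>] by (metis Diff_iff Int_iff empty_iff ends_in_segment)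
    then obtain z where z: "z \<in> closed_segment (x + h) y" "z \<in> frontier \<Omega>" by blast
    have "dist_bd \<Omega> (x + h) \<le> norm (z - (x + h))" using dist_bd_le[OF z(2), of "x + h"] by (simp add: norm_minus_commute)
    also have "\<dots> \<le> norm (y - (x + h))" by (rule segment_bound(1)[OF z(1)])
    also have "y - (x + h) = (t - d - s) *\<^sub>R \<nu> p" unfolding y_def xp by (subst hs) (simp add: algebra_simps)
    also have "norm \<dots> = d + s - t"
    proof -
      have "\<bar>s\<bar> \<le> norm h" unfolding s_def using Cauchy_Schwarz_ineq2[of "\<nu> p" h] n(1) by simp
      then have "t - d - s \<le> 0" using tt \<tau>n h r(5) d by linarith
      then show ?thesis using n(1) by simp
    qed
    also have "d + s - t = d + \<nu> p \<bullet> h - (h \<bullet> (C p *v h) - \<eta> * (h \<bullet> (tproj (\<nu> p) *v h))) / 2"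
      unfolding dec(2)[of h] dec(3)[of h] s_def t_def \<tau>_def by (simp add: field_simps)
    finally show ?thesis .
  qed
  then show ?thesis using r(1) unfolding d_def by blast
qed

text \<open>Every boundary point competes here, so the nearest point \<open>z\<close> of
  \<open>x + h\<close> must first be localized near \<open>p\<close>. Then \<open>z\<close> lies
  below a paraboloid with margin \<open>\<eta>\<close>, and the distance from \<open>x + h\<close>
  to that paraboloid is estimated by completing squares; the tangential offset of \<open>z\<close>
  pays for the curvature terms once \<open>dist_bd \<Omega> x\<close> is small against
  \<open>K\<close> and \<open>\<eta>\<close>.\<close>

lemma dist_bd_lower:
  assumes \<Omega>: "open \<Omega>" and fr: "boundary_frame \<Omega> \<nu> C"
    and KU: "KU > 0" "\<And>x z. x \<in> frontier \<Omega> \<Longrightarrow> z \<in> frontier \<Omega> \<Longrightarrow> \<bar>\<nu> x \<bullet> (z - x)\<bar> \<le> KU * (norm (z - x))\<^sup>2"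
    and x: "x \<in> \<Omega>" and p: "p \<in> frontier \<Omega>" "dist_bd \<Omega> x = norm (x - p)" and e: "\<eta> > 0"
    and K: "norm (C p) + \<eta> \<le> K"
    and small: "dist_bd \<Omega> x \<le> 1" "4 * KU * dist_bd \<Omega> x \<le> 1" "6 * K * dist_bd \<Omega> x \<le> 1" "6 * K\<^sup>2 * dist_bd \<Omega> x \<le> \<eta>"
  shows "\<exists>r>0. \<forall>h. norm h < r \<longrightarrow>
     dist_bd \<Omega> (x + h) \<ge> dist_bd \<Omega> x + \<nu> p \<bullet> h - (h \<bullet> (C p *v h) + \<eta> * (h \<bullet> (tproj (\<nu> p) *v h))) / 2"
proof -
  define d where "d = dist_bd \<Omega> x"
  have d: "d > 0" unfolding d_def using \<Omega> p(1) x by (intro dist_bd_pos) auto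
  have xp: "x = p + d *\<^sub>R \<nu> p"
    using nearest_point_normal[OF \<Omega> fr x p] by (simp add: d_def algebra_simps)
  have n: "norm (\<nu> p) = 1" "transpose (C p) = C p" "C p *v \<nu> p = 0"
    using fr p by (auto simp: boundary_frame_def)
  note dec = boundary_frame_decomp[OF n]
  have K0: "K > 0" using K e by (smt (verit) norm_ge_zero)
  obtain r2 where r2: "r2 > 0" "\<And>h. norm h < r2 \<Longrightarrow> p + h \<notin> \<Omega> \<Longrightarrow> \<nu> p \<bullet> h \<le> (h \<bullet> (C p *v h)) / 2 + \<eta> / 8 * (norm h)\<^sup>2"
    using boundary_frame_second_order[OF \<Omega> fr p(1), of "\<eta> / 8"] e by auto
  have fne: "frontier \<Omega> \<noteq> {}" using p by auto
  define r where "r = min (min 1 (r2\<^sup>2 / 16)) (min (1 / (32 * KU\<^sup>2)) (min (d / 4) (d / (64 * K))))"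
  have r: "r > 0" "r \<le> 1" "r \<le> r2\<^sup>2 / 16" "r \<le> 1 / (32 * KU\<^sup>2)" "r \<le> d / 4" "r \<le> d / (64 * K)"
    using r2 KU d K0 by (auto simp: r_def)
  have "dist_bd \<Omega> (x + h) \<ge> d + \<nu> p \<bullet> h - (h \<bullet> (C p *v h) + \<eta> * (h \<bullet> (tproj (\<nu> p) *v h))) / 2"
    if h: "norm h < r" for h
  proof -
    define \<tau> where "\<tau> = tproj (\<nu> p) *v h"
    define s where "s = \<nu> p \<bullet> h"
    have hs: "h = \<tau> + s *\<^sub>R \<nu> p" using dec(6)[of h] by (simp add: \<tau>_def s_def)
    have \<tau>n: "\<nu> p \<bullet> \<tau> = 0" "norm \<tau> \<le> norm h" using dec(4,5) by (auto simp: \<tau>_def)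
    have sh: "\<bar>s\<bar> \<le> norm h" unfolding s_def using Cauchy_Schwarz_ineq2[of "\<nu> p" h] n(1) by simp
    obtain z where z: "z \<in> frontier \<Omega>" "dist_bd \<Omega> (x + h) = norm (x + h - z)"
      using dist_bd_attained[OF fne] by blast
    define \<zeta> where "\<zeta> = z - p"
    have zO: "p + \<zeta> \<notin> \<Omega>" using z(1) \<Omega> by (simp add: \<zeta>_def frontier_def interior_open)
    have \<zeta>U: "\<bar>\<nu> p \<bullet> \<zeta>\<bar> \<le> KU * (norm \<zeta>)\<^sup>2" using KU(2)[OF p(1) z(1)] by (simp add: \<zeta>_def)
    \<comment> \<open>Tangency of order two and \<open>4 * KU * d \<le> 1\<close> give that
      \<open>norm (x - z)\<close> squared is at least \<open>d^2\<close> plus half of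
      \<open>norm \<zeta>\<close> squared, whereas it is at most
      \<open>(d + 2 * norm h)^2\<close>.\<close>
    have \<zeta>h: "(norm \<zeta>)\<^sup>2 \<le> 16 * norm h"
    proof -
      have "norm (x + h - z) \<le> norm (x + h - p)" using dist_bd_le[OF p(1), of "x + h"] z(2) by simp
      also have "\<dots> \<le> d + norm h"
        using norm_triangle_ineq[of "x - p" h] p(2) by (simp add: d_def algebra_simps)
      finally have "norm (x - z) \<le> d + 2 * norm h"
        using norm_triangle_ineq4[of "x + h - z" h] by (simp add: algebra_simps)
      then have "(norm (x - z))\<^sup>2 \<le> (d + 2 * norm h)\<^sup>2" by (intro power_mono) auto
      moreover have "(norm (x - z))\<^sup>2 = d\<^sup>2 - 2 * d * (\<nu> p \<bullet> \<zeta>) + (norm \<zeta>)\<^sup>2"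
      proof -
        have "x - z = d *\<^sub>R \<nu> p - \<zeta>" by (simp add: xp \<zeta>_def)
        moreover have "\<nu> p \<bullet> \<nu> p = 1" using n(1) by (simp add: norm_eq_1)
        ultimately show ?thesis unfolding power2_norm_eq_inner
          by (simp add: inner_diff inner_commute power2_eq_square)
      qed
      moreover have "2 * d * (\<nu> p \<bullet> \<zeta>) \<le> (norm \<zeta>)\<^sup>2 / 2"
      proof -
        have "2 * d * (\<nu> p \<bullet> \<zeta>) \<le> 2 * d * (KU * (norm \<zeta>)\<^sup>2)" using \<zeta>U d by (intro mult_left_mono) auto
        also have "\<dots> = (4 * KU * d) * ((norm \<zeta>)\<^sup>2 / 2)" by simp
        also have "\<dots> \<le> 1 * ((norm \<zeta>)\<^sup>2 / 2)" using small(2) by (intro mult_right_mono) (auto simp: d_def)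
        finally show ?thesis by simp
      qed
      moreover have "(d + 2 * norm h)\<^sup>2 \<le> d\<^sup>2 + 8 * norm h"
      proof -
        have "d * norm h \<le> 1 * norm h" using small(1) by (intro mult_right_mono) (auto simp: d_def)
        moreover have "norm h * norm h \<le> 1 * norm h" using h r(2) by (intro mult_right_mono) auto
        ultimately show ?thesis by (simp add: power2_eq_square algebra_simps)
      qed
      ultimately show ?thesis by simp
    qed
    define v where "v = tproj (\<nu> p) *v \<zeta>"
    define c where "c = \<nu> p \<bullet> \<zeta>"
    have \<zeta>v: "\<zeta> = v + c *\<^sub>R \<nu> p" using dec(6)[of \<zeta>] by (simp add: v_def c_def)
    have vn: "\<nu> p \<bullet> v = 0" "norm v \<le> norm \<zeta>" using dec(4,5) by (auto simp: v_def)
    have n\<zeta>: "(norm \<zeta>)\<^sup>2 = (norm v)\<^sup>2 + c\<^sup>2" by (subst \<zeta>v) (rule norm_add_normal[OF n(1) vn(1)])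
    have "(norm \<zeta>)\<^sup>2 < r2\<^sup>2" using \<zeta>h h r(3) by simp
    then have "norm \<zeta> < r2" using r2(1) by (simp add: power2_less_imp_less)
    then have c1: "c \<le> (\<zeta> \<bullet> (C p *v \<zeta>)) / 2 + \<eta> / 8 * (norm \<zeta>)\<^sup>2" unfolding c_def using zO by (rule r2(2))
    \<comment> \<open>The normal offset is quadratically small, so \<open>norm \<zeta>\<close>
      squared is at most twice the tangential part; this turns the error \<open>\<eta> / 8\<close>
      into the \<open>\<eta> / 4\<close> of \<open>q\<close>.\<close>
    have "c\<^sup>2 \<le> (norm \<zeta>)\<^sup>2 / 2"
    proof -
      have "c\<^sup>2 \<le> (KU * (norm \<zeta>)\<^sup>2)\<^sup>2" using \<zeta>U by (metis c_def abs_ge_zero power2_abs power_mono)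
      also have "\<dots> = (KU\<^sup>2 * (norm \<zeta>)\<^sup>2) * (norm \<zeta>)\<^sup>2" by (simp add: power2_eq_square)
      also have "\<dots> \<le> (1 / 2) * (norm \<zeta>)\<^sup>2"
      proof (rule mult_right_mono)
        have "norm h \<le> 1 / (32 * KU\<^sup>2)" using h r(4) by linarith
        then have "norm h * (32 * KU\<^sup>2) \<le> 1" using KU(1) by (simp add: field_simps)
        then have "KU\<^sup>2 * (16 * norm h) \<le> 1 / 2" by (simp add: mult_ac)
        then show "KU\<^sup>2 * (norm \<zeta>)\<^sup>2 \<le> 1 / 2" using mult_left_mono[OF \<zeta>h, of "KU\<^sup>2"] by simp
      qed simp
      finally show ?thesis by simp
    qed
    then have \<zeta>v2: "(norm \<zeta>)\<^sup>2 \<le> 2 * (norm v)\<^sup>2" using n\<zeta> by simp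
    define q where "q w = (w \<bullet> (C p *v w)) / 2 + \<eta> / 4 * (norm w)\<^sup>2" for w
    have qK: "\<bar>q w\<bar> \<le> K * (norm w)\<^sup>2" for w
    proof -
      have "\<bar>w \<bullet> (C p *v w)\<bar> \<le> norm (C p) * (norm w)\<^sup>2"
        using quad_form_le[of w "C p" w] by (simp add: power2_eq_square mult.assoc)
      moreover have "(norm (C p) + \<eta>) * (norm w)\<^sup>2 \<le> K * (norm w)\<^sup>2" using K by (intro mult_right_mono) auto
      moreover have "\<eta> * (norm w)\<^sup>2 \<ge> 0" "norm (C p) * (norm w)\<^sup>2 \<ge> 0" using e by auto
      ultimately show ?thesis unfolding q_def by (simp add: abs_le_iff algebra_simps)
    qed
    have cq: "c \<le> q v"
    proof -
      have "\<eta> / 8 * (norm \<zeta>)\<^sup>2 \<le> \<eta> / 8 * (2 * (norm v)\<^sup>2)" using \<zeta>v2 e by (intro mult_left_mono) auto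
      then show ?thesis using c1 unfolding q_def dec(2)[of \<zeta>] v_def[symmetric] by simp
    qed
    \<comment> \<open>\<open>A - Q\<close> is the claimed lower bound. \<open>Q\<close> exceeds
      \<open>q \<tau>\<close> by another \<open>\<eta> / 4\<close>, a reserve for the mixed term in
      \<open>q \<tau> - q v\<close>.\<close>
    define A where "A = d + s"
    define Q where "Q = q \<tau> + \<eta> / 4 * (norm \<tau>)\<^sup>2"
    have QK: "\<bar>Q\<bar> \<le> 2 * K * (norm \<tau>)\<^sup>2"
    proof -
      have "\<eta> * (norm \<tau>)\<^sup>2 \<le> K * (norm \<tau>)\<^sup>2" using K by (intro mult_right_mono) (auto intro: order_trans[rotated])
      moreover have "\<eta> * (norm \<tau>)\<^sup>2 \<ge> 0" using e by simp
      ultimately show ?thesis using qK[of \<tau>] unfolding Q_def by (simp add: abs_le_iff)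
    qed
    have Kh: "K * (16 * norm h) \<le> d / 4"
    proof -
      have "norm h \<le> d / (64 * K)" using h r(6) by linarith
      then have "norm h * (64 * K) \<le> d" using K0 by (simp add: field_simps)
      then show ?thesis by (simp add: mult_ac)
    qed
    have qv: "\<bar>q v\<bar> \<le> d / 4"
    proof -
      have "(norm v)\<^sup>2 \<le> 16 * norm h" using vn(2) \<zeta>h by (meson norm_ge_zero order_trans power_mono)
      then have "K * (norm v)\<^sup>2 \<le> K * (16 * norm h)" using K0 by (intro mult_left_mono) auto
      then show ?thesis using qK[of v] Kh by simp
    qed
    have Qd: "\<bar>Q\<bar> \<le> d / 4"
    proof -
      have "(norm \<tau>)\<^sup>2 \<le> norm h * norm h" unfolding power2_eq_square using \<tau>n(2) by (intro mult_mono) auto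
      also have "\<dots> \<le> 1 * norm h" using h r(2) by (intro mult_right_mono) auto
      finally have "2 * (norm \<tau>)\<^sup>2 \<le> 16 * norm h" using norm_ge_zero[of h] by linarith
      then have "K * (2 * (norm \<tau>)\<^sup>2) \<le> K * (16 * norm h)" using K0 by (intro mult_left_mono) auto
      then show ?thesis using QK Kh by simp
    qed
    define T where "T = 2 * A - q v - Q"
    have T: "0 < T" "T \<le> 3 * d" using qv Qd sh h r(5) d unfolding T_def A_def by (auto simp: abs_le_iff)
    define a where "a = norm (v - \<tau>)"
    have qdiff: "q \<tau> - q v \<ge> - (K * norm \<tau> * a) - K * a\<^sup>2"
    proof -
      define w where "w = v - \<tau>"
      have "q v = q (\<tau> + w)" by (simp add: w_def)
      also have "\<dots> = q \<tau> + \<tau> \<bullet> (C p *v w) + \<eta> / 2 * (\<tau> \<bullet> w) + q w"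
        using inner_symmetric_matrix[OF n(2), of \<tau> w]
        by (simp add: q_def power2_norm_eq_inner matrix_vector_right_distrib inner_add inner_commute algebra_simps)
      finally have eq: "q \<tau> - q v = - (\<tau> \<bullet> (C p *v w)) - \<eta> / 2 * (\<tau> \<bullet> w) - q w" by simp
      have "\<tau> \<bullet> (C p *v w) \<le> norm (C p) * (norm \<tau> * norm w)" using quad_form_le[of \<tau> "C p" w] by (simp add: abs_le_iff mult.assoc)
      moreover have "\<eta> / 2 * (\<tau> \<bullet> w) \<le> \<eta> / 2 * (norm \<tau> * norm w)"
        using e by (intro mult_left_mono norm_cauchy_schwarz) auto
      moreover have "\<eta> / 2 * (norm \<tau> * norm w) \<le> \<eta> * (norm \<tau> * norm w)" using e by (intro mult_right_mono) auto
      moreover have "(norm (C p) + \<eta>) * (norm \<tau> * norm w) \<le> K * (norm \<tau> * norm w)" using K by (intro mult_right_mono) auto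
      moreover have "q w \<le> K * a\<^sup>2" using qK[of w] by (simp add: a_def w_def abs_le_iff)
      moreover have "norm w = a" by (simp add: a_def w_def)
      ultimately show ?thesis unfolding eq by (simp add: algebra_simps)
    qed
    \<comment> \<open>The difference of the two squares is \<open>T * (Q - q v)\<close> with
      \<open>T \<le> 3 * d\<close>. After Young's inequality spends the reserve in \<open>Q\<close>,
      only multiples of \<open>a\<^sup>2\<close> remain, and the smallness of \<open>d\<close> makes
      their total coefficient at most 1.\<close>
    have main: "(A - Q)\<^sup>2 \<le> a\<^sup>2 + (A - q v)\<^sup>2"
    proof -
      have amgm: "K * norm \<tau> * a \<le> \<eta> / 4 * (norm \<tau>)\<^sup>2 + K\<^sup>2 / \<eta> * a\<^sup>2"
      proof -
        have "0 \<le> (\<eta> * norm \<tau> / 2 - K * a)\<^sup>2" by simp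
        then have "\<eta> * (K * norm \<tau> * a) \<le> \<eta> * (\<eta> / 4 * (norm \<tau>)\<^sup>2 + K\<^sup>2 / \<eta> * a\<^sup>2)"
          using e by (simp add: power2_eq_square algebra_simps)
        then show ?thesis using e by (metis mult_le_cancel_left_pos)
      qed
      have "T * K \<le> 1 / 2"
      proof -
        have "T * K \<le> 3 * d * K" using T K0 by (intro mult_right_mono) auto
        then show ?thesis using small(3) by (simp add: d_def mult_ac)
      qed
      then have 1: "T * K * a\<^sup>2 \<le> 1 / 2 * a\<^sup>2" by (intro mult_right_mono) auto
      have "T * (K\<^sup>2 / \<eta>) \<le> 1 / 2"
      proof -
        have "T * (K\<^sup>2 / \<eta>) \<le> 3 * d * (K\<^sup>2 / \<eta>)" using T e by (intro mult_right_mono) auto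
        also have "\<dots> \<le> 1 / 2" using small(4) e by (simp add: d_def field_simps)
        finally show ?thesis .
      qed
      then have 2: "T * (K\<^sup>2 / \<eta>) * a\<^sup>2 \<le> 1 / 2 * a\<^sup>2" by (intro mult_right_mono) auto
      have "Q - q v \<ge> - (K\<^sup>2 / \<eta> * a\<^sup>2) - K * a\<^sup>2" using qdiff amgm unfolding Q_def by linarith
      then have "T * (Q - q v) \<ge> T * (- (K\<^sup>2 / \<eta> * a\<^sup>2) - K * a\<^sup>2)" using T by (intro mult_left_mono) auto
      then have "T * (Q - q v) \<ge> - (T * (K\<^sup>2 / \<eta>) * a\<^sup>2) - T * K * a\<^sup>2"
        by (simp add: algebra_simps)
      then have "T * (Q - q v) \<ge> - a\<^sup>2" using 1 2 by linarith
      moreover have "(A - q v)\<^sup>2 - (A - Q)\<^sup>2 = T * (Q - q v)" by (simp add: T_def power2_eq_square algebra_simps)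
      ultimately show ?thesis by linarith
    qed
    have "(A - q v)\<^sup>2 \<le> (A - c)\<^sup>2"
    proof (rule power_mono)
      show "A - q v \<le> A - c" using cq by simp
      show "0 \<le> A - q v" using qv sh h r(5) d unfolding A_def by (auto simp: abs_le_iff)
    qed
    moreover have "(norm (x + h - z))\<^sup>2 = a\<^sup>2 + (A - c)\<^sup>2"
    proof -
      have "x + h - z = (\<tau> - v) + (A - c) *\<^sub>R \<nu> p"
      proof -
        have "x + h - z = d *\<^sub>R \<nu> p + h - \<zeta>" by (simp add: xp \<zeta>_def)
        also have "\<dots> = d *\<^sub>R \<nu> p + (\<tau> + s *\<^sub>R \<nu> p) - (v + c *\<^sub>R \<nu> p)" using hs \<zeta>v by simp
        finally show ?thesis by (simp add: A_def algebra_simps)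
      qed
      moreover have "\<nu> p \<bullet> (\<tau> - v) = 0" using \<tau>n vn by (simp add: inner_diff)
      ultimately show ?thesis using norm_add_normal[OF n(1)] by (simp add: a_def norm_minus_commute)
    qed
    ultimately have "(A - Q)\<^sup>2 \<le> (dist_bd \<Omega> (x + h))\<^sup>2" using main z(2) by simp
    then have "A - Q \<le> dist_bd \<Omega> (x + h)"
      by (rule power2_le_imp_le) (simp add: dist_bd_def infdist_nonneg)
    moreover have "A - Q = d + \<nu> p \<bullet> h - (h \<bullet> (C p *v h) + \<eta> * (h \<bullet> (tproj (\<nu> p) *v h))) / 2"
      unfolding dec(2)[of h] dec(3)[of h] A_def Q_def q_def s_def \<tau>_def by (simp add: field_simps)
    ultimately show ?thesis by simp
  qed
  then show ?thesis using r(1) unfolding d_def by blast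
qed

text \<open>One boundary point serves both sides of the squeeze, and \<open>\<delta>\<close> is
  uniform because its constants come from the compact boundary. The radius \<open>r\<close> may
  depend on \<open>x\<close>, which is enough for jets.\<close>

lemma dist_bd_second_order:
  assumes \<Omega>: "open \<Omega>" "bounded \<Omega>" "\<Omega> \<noteq> {}" and fr: "boundary_frame \<Omega> \<nu> C" and e: "\<eta> > 0"
    and K0: "\<And>p. p \<in> frontier \<Omega> \<Longrightarrow> norm (C p) \<le> K0"
  shows "\<exists>\<delta>>0. \<forall>x\<in>\<Omega>. dist_bd \<Omega> x < \<delta> \<longrightarrow> (\<exists>p\<in>frontier \<Omega>. \<exists>r>0. \<forall>h. norm h < r \<longrightarrow>
     dist_bd \<Omega> (x + h) \<ge> dist_bd \<Omega> x + \<nu> p \<bullet> h - (h \<bullet> (C p *v h) + \<eta> * (h \<bullet> (tproj (\<nu> p) *v h))) / 2 \<and>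
     dist_bd \<Omega> (x + h) \<le> dist_bd \<Omega> x + \<nu> p \<bullet> h - (h \<bullet> (C p *v h) - \<eta> * (h \<bullet> (tproj (\<nu> p) *v h))) / 2)"
proof -
  obtain KU where KU: "KU > 0" "\<And>x z. x \<in> frontier \<Omega> \<Longrightarrow> z \<in> frontier \<Omega> \<Longrightarrow> \<bar>\<nu> x \<bullet> (z - x)\<bar> \<le> KU * (norm (z - x))\<^sup>2"
    using boundary_frame_uniform[OF \<Omega>(1,2) fr] by blast
  have fne: "frontier \<Omega> \<noteq> {}" using \<Omega> frontier_bounded_nonempty by blast
  define K where "K = \<bar>K0\<bar> + \<eta>"
  have K: "K > 0" using e by (simp add: K_def)
  define \<delta> where "\<delta> = min (min 1 (1 / (4 * KU))) (min (1 / (6 * K)) (\<eta> / (6 * K\<^sup>2)))"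
  have \<delta>: "\<delta> > 0" "\<delta> \<le> 1" "4 * KU * \<delta> \<le> 1" "6 * K * \<delta> \<le> 1" "6 * K\<^sup>2 * \<delta> \<le> \<eta>"
  proof -
    show "\<delta> > 0" "\<delta> \<le> 1" using KU K e by (auto simp: \<delta>_def)
    have "\<delta> \<le> 1 / (4 * KU)" "\<delta> \<le> 1 / (6 * K)" "\<delta> \<le> \<eta> / (6 * K\<^sup>2)" by (auto simp: \<delta>_def)
    then show "4 * KU * \<delta> \<le> 1" "6 * K * \<delta> \<le> 1" "6 * K\<^sup>2 * \<delta> \<le> \<eta>"
      using KU K by (auto simp: field_simps)
  qed
  have "\<exists>p\<in>frontier \<Omega>. \<exists>r>0. \<forall>h. norm h < r \<longrightarrow>
     dist_bd \<Omega> (x + h) \<ge> dist_bd \<Omega> x + \<nu> p \<bullet> h - (h \<bullet> (C p *v h) + \<eta> * (h \<bullet> (tproj (\<nu> p) *v h))) / 2 \<and>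
     dist_bd \<Omega> (x + h) \<le> dist_bd \<Omega> x + \<nu> p \<bullet> h - (h \<bullet> (C p *v h) - \<eta> * (h \<bullet> (tproj (\<nu> p) *v h))) / 2"
    if x: "x \<in> \<Omega>" "dist_bd \<Omega> x < \<delta>" for x
  proof -
    obtain p where p: "p \<in> frontier \<Omega>" "dist_bd \<Omega> x = norm (x - p)" using dist_bd_attained[OF fne] by blast
    have sm: "4 * KU * dist_bd \<Omega> x \<le> 1" "6 * K * dist_bd \<Omega> x \<le> 1" "6 * K\<^sup>2 * dist_bd \<Omega> x \<le> \<eta>"
      using \<delta> x(2) KU(1) K
      by (auto intro: order_trans[OF mult_left_mono[OF less_imp_le[OF x(2)]]])
    have nK: "norm (C p) + \<eta> \<le> K" using K0[OF p(1)] by (simp add: K_def)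
    have "\<exists>r>0. \<forall>h. norm h < r \<longrightarrow>
     dist_bd \<Omega> (x + h) \<ge> dist_bd \<Omega> x + \<nu> p \<bullet> h - (h \<bullet> (C p *v h) + \<eta> * (h \<bullet> (tproj (\<nu> p) *v h))) / 2"
      by (rule dist_bd_lower[OF \<Omega>(1) fr KU x(1) p e nK _ sm]) (use x \<delta> in auto)
    moreover have "\<exists>r>0. \<forall>h. norm h < r \<longrightarrow>
     dist_bd \<Omega> (x + h) \<le> dist_bd \<Omega> x + \<nu> p \<bullet> h - (h \<bullet> (C p *v h) - \<eta> * (h \<bullet> (tproj (\<nu> p) *v h))) / 2"
      by (rule dist_bd_upper[OF \<Omega>(1) fr x(1) p e])
    ultimately obtain r1 r2 where r: "r1 > 0" "\<And>h. norm h < r1 \<Longrightarrow>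
     dist_bd \<Omega> (x + h) \<ge> dist_bd \<Omega> x + \<nu> p \<bullet> h - (h \<bullet> (C p *v h) + \<eta> * (h \<bullet> (tproj (\<nu> p) *v h))) / 2"
     "r2 > 0" "\<And>h. norm h < r2 \<Longrightarrow> dist_bd \<Omega> (x + h) \<le> dist_bd \<Omega> x + \<nu> p \<bullet> h - (h \<bullet> (C p *v h) - \<eta> * (h \<bullet> (tproj (\<nu> p) *v h))) / 2"
      by blast
    then show ?thesis using p(1) by (intro bexI[of _ p] exI[of _ "min r1 r2"]) auto
  qed
  then show ?thesis using \<delta>(1) by blast
qed

section \<open>The blow-up profile\<close>

text \<open>Continuity is available only away from 0, so the fundamental theorem is applied from an
  interior base point and the initial piece is a constant.\<close>

lemma has_real_derivative_integral_interior:
  fixes h :: "real \<Rightarrow> real"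
  assumes int: "\<And>t. t \<in> {0<..<c} \<Longrightarrow> h integrable_on {0..t}" and cont: "continuous_on {0<..<c} h"
    and t: "t \<in> {0<..<c}"
  shows "((\<lambda>x. integral {0..x} h) has_real_derivative h t) (at t)"
proof -
  define a b where "a = t / 2" and "b = (t + c) / 2"
  have ab: "0 < a" "a < t" "t < b" "b < c" using t by (auto simp: a_def b_def)
  have "continuous_on {a..b} h" by (rule continuous_on_subset[OF cont]) (use ab in auto)
  then have "((\<lambda>x. integral {a..x} h) has_real_derivative h t) (at t within {a..b})"
    by (rule integral_has_real_derivative) (use ab in auto)
  then have "((\<lambda>x. integral {a..x} h) has_real_derivative h t) (at t)"
    using ab by (simp add: at_within_Icc_at)
  then have "((\<lambda>x. integral {0..a} h + integral {a..x} h) has_real_derivative 0 + h t) (at t)"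
    by (intro DERIV_add DERIV_const)
  moreover have "integral {0..a} h + integral {a..x} h = integral {0..x} h" if "x \<in> {a<..<b}" for x
    using that ab int[of x] by (intro Henstock_Kurzweil_Integration.integral_combine) auto
  ultimately show ?thesis
    using ab has_field_derivative_transform_within_open[of _ _ t "{a<..<b}" "\<lambda>x. integral {0..x} h"] by auto
qed

lemma integral_improper_limit:
  fixes g :: "real \<Rightarrow> real"
  assumes "g integrable_on {s..}"
  shows "((\<lambda>x. integral {s..x} g) \<longlongrightarrow> integral {s..} g) at_top"
proof (rule tendstoI)
  fix e :: real assume e: "e > 0"
  have "(g has_integral integral {s..} g) {s..}" using assms by (simp add: integrable_integral)
  then obtain B where B: "B > 0" "\<And>a b. ball 0 B \<subseteq> cbox a b \<Longrightarrow>
      norm (integral (cbox a b) (\<lambda>x. if x \<in> {s..} then g x else 0) - integral {s..} g) < e"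
    using e unfolding has_integral_alt' by blast
  have "dist (integral {s..x} g) (integral {s..} g) < e" if x: "x \<ge> max B \<bar>s\<bar>" for x
  proof -
    have "ball 0 B \<subseteq> cbox (- x) x" using x by (auto simp: dist_real_def)
    from B(2)[OF this] have "norm (integral {-x..x} (\<lambda>x. if x \<in> {s..} then g x else 0) - integral {s..} g) < e" by simp
    moreover have "integral {-x..x} (\<lambda>x. if x \<in> {s..} then g x else 0) = integral ({-x..x} \<inter> {s..}) g"
      using integral_restrict_Int[of "{-x..x}" "{s..}" g] by (simp add: Int_commute)
    moreover have "{-x..x} \<inter> {s..} = {s..x}" using x by auto
    ultimately show ?thesis unfolding dist_real_def by (simp only: real_norm_def)
  qed
  then show "\<forall>\<^sub>F x in at_top. dist (integral {s..x} g) (integral {s..} g) < e"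
    using eventually_at_top_linorder by blast
qed

section \<open>The Keller-Osserman integral and its inverse\<close>

locale keller_osserman =
  fixes k :: nat and f :: "real \<Rightarrow> real" and Cf :: real
  assumes f1: "f C1_differentiable_on {0<..}" "\<forall>s>0. f s > 0" "mono_on {0<..} f"
    and f2: "\<forall>s>0. (\<lambda>\<tau>. 1 / Hf k f \<tau>) integrable_on {s..}"
    and f3: "Cf > 0" "((\<lambda>s. deriv (Hf k f) s * Phi k f s) \<longlongrightarrow> Cf) at_top"
begin

abbreviation "H \<equiv> Hf k f"

lemma f_pos: "s > 0 \<Longrightarrow> f s > 0" using f1 by simp

lemma f_mono: "0 < s \<Longrightarrow> s \<le> t \<Longrightarrow> f s \<le> f t"
  using f1(3) by (simp add: mono_on_def)

lemma f_cont: "continuous_on {0<..} f"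
  using f1(1) C1_differentiable_imp_continuous_on by blast

text \<open>The value of \<open>f\<close> at 0 is arbitrary; resetting it to 0 makes
  \<open>f\<close> monotone on the closed interval and changes a single point.\<close>

lemma f_integrable: "t > 0 \<Longrightarrow> f integrable_on {0..t}"
proof -
  assume t: "t > 0"
  define f' where "f' s = (if s \<le> 0 then 0 else f s)" for s
  have "mono_on {0..t} f'"
    by (auto simp: mono_on_def f'_def intro: f_mono less_imp_le[OF f_pos])
  then have "f' integrable_on {0..t}" by (rule integrable_on_mono_on)
  then show ?thesis by (rule integrable_spike_finite[of "{0}", rotated 2]) (auto simp: f'_def)
qed

lemma Fint_deriv: "t > 0 \<Longrightarrow> (Fint f has_real_derivative f t) (at t)"
  unfolding Fint_def
  by (rule has_real_derivative_integral_interior[where c="t + 1", OF f_integrable continuous_on_subset[OF f_cont]]) auto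

lemma Fint_pos: "t > 0 \<Longrightarrow> Fint f t > 0"
proof -
  assume t: "t > 0"
  have "Fint f (t/2) < Fint f t"
  proof (rule DERIV_pos_imp_increasing[where f="Fint f"])
    fix x assume "t/2 \<le> x"
    then have "x > 0" using t by simp
    then show "\<exists>y. (Fint f has_real_derivative y) (at x) \<and> 0 < y" using Fint_deriv f_pos by blast
  qed (use t in simp)
  moreover have "Fint f (t/2) \<ge> 0"
  proof -
    have "integral {0..t/2} f = integral {0..t/2} (\<lambda>x. if x \<le> 0 then 0 else f x)"
      by (rule integral_spike[of "{0}"]) auto
    moreover have "(\<lambda>x. if x \<le> 0 then 0 else f x) integrable_on {0..t/2}"
      by (rule integrable_spike_finite[of "{0}" _ _ f]) (use f_integrable t in auto)
    then have "integral {0..t/2} (\<lambda>x. if x \<le> 0 then 0 else f x) \<ge> 0"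
      by (rule Henstock_Kurzweil_Integration.integral_nonneg) (use f_pos in \<open>auto intro: less_imp_le\<close>)
    ultimately show ?thesis by (simp add: Fint_def)
  qed
  ultimately show ?thesis by simp
qed

lemma H_pos: "t > 0 \<Longrightarrow> H t > 0"
  using Fint_pos[of t] by (simp add: Hf_def)

text \<open>Differentiation of \<open>H ^ (k + 1) = (k + 1) F\<close>, whose derivative is
  \<open>(k + 1) f\<close>.\<close>

lemma H_deriv: "t > 0 \<Longrightarrow> (H has_real_derivative f t / H t ^ k) (at t)"
proof -
  assume t: "t > 0"
  define n where "n = real (k + 1)"
  have n: "n > 0" by (simp add: n_def)
  have p: "n * Fint f t > 0" using Fint_pos[OF t] n by simp
  have "((\<lambda>t. n * Fint f t) has_real_derivative n * f t) (at t)"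
    using DERIV_cmult[OF Fint_deriv[OF t]] .
  from DERIV_powr[OF this p DERIV_const[of "1/n"]]
  have "((\<lambda>t. (n * Fint f t) powr (1/n)) has_real_derivative (n * Fint f t) powr (1/n) * (1 / n * (n * f t) / (n * Fint f t))) (at t)"
    by simp
  moreover have "(n * Fint f t) powr (1/n) * (1 / n * (n * f t) / (n * Fint f t)) = f t / H t ^ k"
  proof -
    have "H t ^ k * H t = (H t) powr n" using H_pos[OF t] by (simp add: n_def powr_realpow[symmetric] powr_add)
    also have "\<dots> = n * Fint f t" using n p unfolding Hf_def n_def[symmetric] by (simp add: powr_powr)
    finally have "n * Fint f t = H t ^ k * H t" by simp
    moreover have "(n * Fint f t) powr (1/n) = H t" by (simp add: Hf_def n_def)
    ultimately show ?thesis using n H_pos[OF t] by simp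
  qed
  moreover have "H = (\<lambda>t. (n * Fint f t) powr (1/n))" by (simp add: Hf_def n_def fun_eq_iff)
  ultimately show ?thesis by simp
qed

lemma deriv_H: "t > 0 \<Longrightarrow> deriv H t = f t / H t ^ k"
  by (intro DERIV_imp_deriv H_deriv)

lemma H_cont: "continuous_on {0<..} H"
  by (intro continuous_at_imp_continuous_on) (auto intro: DERIV_isCont H_deriv)

lemma Phi_split:
  assumes "0 < a" "a \<le> s"
  shows "Phi k f s = Phi k f a - integral {a..s} (\<lambda>\<tau>. 1 / H \<tau>)"
proof -
  let ?g = "\<lambda>\<tau>. 1 / H \<tau>"
  have 1: "?g integrable_on {a..s}"
    by (intro integrable_continuous_real continuous_intros continuous_on_subset[OF H_cont] ballI less_imp_neq[OF H_pos, symmetric]) (use assms in auto)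
  have 2: "?g integrable_on {s..}" using f2 assms by simp
  have "integral ({a..s} \<union> {s..}) ?g = integral {a..s} ?g + integral {s..} ?g"
    by (rule integral_Un[OF 1 2]) (rule negligible_subset[of "{s}"], auto)
  moreover have "{a..s} \<union> {s..} = {a..}" using assms by auto
  ultimately show ?thesis by (simp add: Phi_def)
qed

lemma Phi_deriv: "s > 0 \<Longrightarrow> (Phi k f has_real_derivative - (1 / H s)) (at s)"
proof -
  assume s: "s > 0"
  define a b where "a = s / 2" and "b = s + 1"
  have ab: "0 < a" "a < s" "s < b" using s by (auto simp: a_def b_def)
  have "continuous_on {a..b} (\<lambda>\<tau>. 1 / H \<tau>)"
    by (intro continuous_intros continuous_on_subset[OF H_cont] ballI less_imp_neq[OF H_pos, symmetric]) (use ab in auto)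
  then have "((\<lambda>x. integral {a..x} (\<lambda>\<tau>. 1 / H \<tau>)) has_real_derivative 1 / H s) (at s within {a..b})"
    by (rule integral_has_real_derivative) (use ab in auto)
  then have "((\<lambda>x. integral {a..x} (\<lambda>\<tau>. 1 / H \<tau>)) has_real_derivative 1 / H s) (at s)"
    using ab by (simp add: at_within_Icc_at)
  then have "((\<lambda>x. Phi k f a - integral {a..x} (\<lambda>\<tau>. 1 / H \<tau>)) has_real_derivative 0 - 1 / H s) (at s)"
    by (intro DERIV_diff DERIV_const)
  then have "(Phi k f has_real_derivative 0 - 1 / H s) (at s)"
    by (rule has_field_derivative_transform_within_open[where S="{a<..<b}", OF _ _ _ Phi_split[OF ab(1), symmetric]])
      (use ab in auto)
  then show ?thesis by simp
qed

lemma Phi_strict: "0 < s \<Longrightarrow> s < t \<Longrightarrow> Phi k f t < Phi k f s"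
proof (rule DERIV_neg_imp_decreasing[where f="Phi k f"])
  fix x assume "0 < s" "s \<le> x"
  then have "x > 0" by simp
  then have "- (1 / H x) < 0" using H_pos by simp
  then show "\<exists>y. (Phi k f has_real_derivative y) (at x) \<and> y < 0" using Phi_deriv[OF \<open>x > 0\<close>] by blast
qed simp

lemma Phi_cont: "continuous_on {0<..} (Phi k f)"
  by (intro continuous_at_imp_continuous_on) (auto intro: DERIV_isCont Phi_deriv)

lemma Phi_tendsto: "(Phi k f \<longlongrightarrow> 0) at_top"
proof -
  have "((\<lambda>x. Phi k f 1 - integral {1..x} (\<lambda>\<tau>. 1 / H \<tau>)) \<longlongrightarrow> Phi k f 1 - Phi k f 1) at_top"
    unfolding Phi_def by (intro tendsto_diff tendsto_const integral_improper_limit) (use f2 in auto)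
  moreover have "\<forall>\<^sub>F x in at_top. Phi k f 1 - integral {1..x} (\<lambda>\<tau>. 1 / H \<tau>) = Phi k f x"
    by (rule eventually_at_top_linorderI[of 1]) (rule Phi_split[symmetric], auto)
  ultimately have "(Phi k f \<longlongrightarrow> Phi k f 1 - Phi k f 1) at_top" by (rule Lim_transform_eventually)
  then show ?thesis by simp
qed

lemma Phi_pos: "s > 0 \<Longrightarrow> Phi k f s > 0"
proof -
  assume s: "s > 0"
  have "Phi k f (s + 1) \<ge> 0"
    by (rule tendsto_upperbound[OF Phi_tendsto])
      (auto intro!: eventually_at_top_linorderI[of "s + 2"] less_imp_le[OF Phi_strict] add_pos_nonneg s)
  then show ?thesis using Phi_strict[of s "s + 1"] s by simp
qed

lemma varphi_Phi: "s > 0 \<Longrightarrow> varphi k f (Phi k f s) = s"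
  unfolding varphi_def by (rule the_equality) (auto, metis Phi_strict linorder_neq_iff)

text \<open>\<open>Phi\<close> decreases continuously to 0, but its range need not be all of the
  positive reals. The condition \<open>t < Phi k f a\<close> keeps \<open>t\<close> in the range,
  where the definite description in \<open>varphi\<close> is meaningful.\<close>

lemma varphi_exists:
  assumes a: "a > 0" and t: "0 < t" "t < Phi k f a"
  shows "varphi k f t > a" "Phi k f (varphi k f t) = t"
proof -
  obtain c where c: "Phi k f c < t" "c > a"
    using order_tendstoD(2)[OF Phi_tendsto t(1)] eventually_gt_at_top[of a]
    by (metis (mono_tags, lifting) eventually_at_top_linorder eventually_conj order_refl)
  have "\<exists>s\<ge>a. s \<le> c \<and> Phi k f s = t"
    by (rule IVT2') (use c t a in \<open>auto intro: continuous_on_subset[OF Phi_cont]\<close>)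
  then obtain s where s: "a \<le> s" "Phi k f s = t" by blast
  then have "s > a" using t by (cases "s = a") auto
  then show "varphi k f t > a" "Phi k f (varphi k f t) = t" using varphi_Phi[of s] a s by auto
qed

lemma varphi_deriv:
  assumes "0 < t" "t < Phi k f a" "a > 0"
  shows "(varphi k f has_real_derivative - H (varphi k f t)) (at t)"
proof -
  define s where "s = varphi k f t"
  have s: "s > 0" "Phi k f s = t" using varphi_exists[OF assms(3,1,2)] assms by (auto simp: s_def)
  have "(varphi k f has_derivative (\<lambda>h. - H s * h)) (at (Phi k f s))"
    by (rule has_derivative_inverse_strong[OF _ _ Phi_cont varphi_Phi Phi_deriv[OF s(1), unfolded has_field_derivative_def]])
      (use s H_pos[OF s(1)] in auto)
  then show ?thesis unfolding s(2) by (simp only: s_def has_field_derivative_def)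
qed

lemma varphi_at_top: "filterlim (varphi k f) at_top (at_right 0)"
  unfolding filterlim_at_top
proof
  fix Z :: real
  define a where "a = max 1 Z"
  have "\<forall>\<^sub>F t in at_right 0. t < Phi k f a"
    using Phi_pos[of a] by (intro order_tendstoD[OF tendsto_ident_at]) (auto simp: a_def)
  moreover have "\<forall>\<^sub>F t in at_right (0::real). t > 0" by (simp add: eventually_at_right_less)
  ultimately show "\<forall>\<^sub>F t in at_right 0. Z \<le> varphi k f t"
  proof eventually_elim
    case (elim t)
    moreover have "a > 0" "Z \<le> a" by (auto simp: a_def)
    ultimately show ?case using varphi_exists(1)[of a t] by simp
  qed
qed

text \<open>The derivative of \<open>Phi * H\<close> is \<open>H' * Phi - 1\<close>, which by the
  limit hypothesis is eventually below \<open>Cf\<close>. Hence \<open>Phi * H\<close> grows at most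
  like \<open>Cf * s\<close> plus a constant.\<close>

lemma Phi_H_linear: "\<exists>s2>0. \<forall>s\<ge>s2. Phi k f s * H s \<le> (Cf + 1) * s"
proof -
  have "\<forall>\<^sub>F s in at_top. deriv H s * Phi k f s < Cf + 1"
    by (rule order_tendstoD[OF f3(2)]) simp
  then obtain s0 where s0: "\<And>s. s \<ge> s0 \<Longrightarrow> deriv H s * Phi k f s < Cf + 1"
    by (auto simp: eventually_at_top_linorder)
  define s1 where "s1 = max 1 s0"
  \<comment> \<open>Beyond this point the constant of integration is absorbed by one additional
    \<open>s\<close>, which is the origin of the slope \<open>Cf + 1\<close>.\<close>
  define s2 where "s2 = max s1 (Phi k f s1 * H s1)"
  have s1: "s1 \<ge> 1" "s1 \<ge> s0" by (auto simp: s1_def)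
  have "Phi k f s * H s \<le> (Cf + 1) * s" if s: "s \<ge> s2" for s
  proof -
    have s': "s \<ge> s1" "s \<ge> Phi k f s1 * H s1" using s by (auto simp: s2_def)
    have "Cf * s1 - Phi k f s1 * H s1 \<le> Cf * s - Phi k f s * H s"
    proof (rule DERIV_nonneg_imp_nondecreasing[OF s'(1)])
      fix x assume x: "s1 \<le> x" "x \<le> s"
      have xp: "x > 0" using x s1 by simp
      have "((\<lambda>s. Cf * s - Phi k f s * H s) has_real_derivative Cf * 1 - (- (1 / H x) * H x + (f x / H x ^ k) * Phi k f x)) (at x)"
        by (intro DERIV_diff DERIV_cmult DERIV_ident DERIV_mult Phi_deriv H_deriv xp)
      moreover have "Cf * 1 - (- (1 / H x) * H x + (f x / H x ^ k) * Phi k f x) \<ge> 0"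
        using s0[of x] x s1 H_pos[OF xp] unfolding deriv_H[OF xp] by simp
      ultimately show "\<exists>y. ((\<lambda>s. Cf * s - Phi k f s * H s) has_real_derivative y) (at x) \<and> 0 \<le> y" by blast
    qed
    then have "Phi k f s * H s \<le> Cf * s + Phi k f s1 * H s1 - Cf * s1" by simp
    also have "\<dots> \<le> Cf * s + s - 0" using s' s1 f3(1) by (intro diff_mono add_left_mono) auto
    finally show ?thesis by (simp add: algebra_simps)
  qed
  moreover have "s2 > 0" using s1 by (simp add: s2_def)
  ultimately show ?thesis by blast
qed

text \<open>The derivative of \<open>x powr (Cf + 1) * varphi k f x\<close> has the sign of
  \<open>(Cf + 1) * varphi k f x - x * H (varphi k f x)\<close>, nonnegative by the linear bound at
  \<open>s = varphi k f x\<close>. This is a one-sided substitute for regular variation: the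
  exponent need not be sharp, since the factor tends to 1 with \<open>t' / t\<close>.\<close>

lemma varphi_ratio: "\<exists>t0>0. \<forall>t t'. 0 < t \<longrightarrow> t \<le> t' \<longrightarrow> t' < t0 \<longrightarrow>
    varphi k f t > 0 \<and> varphi k f t' > 0 \<and> varphi k f t \<le> (t' / t) powr (Cf + 1) * varphi k f t'"
proof -
  obtain s2 where s2: "s2 > 0" "\<And>s. s \<ge> s2 \<Longrightarrow> Phi k f s * H s \<le> (Cf + 1) * s"
    using Phi_H_linear by blast
  define t0 where "t0 = Phi k f s2"
  define c where "c = Cf + 1"
  have vp: "varphi k f t > s2" "Phi k f (varphi k f t) = t" if "0 < t" "t < t0" for t
    using varphi_exists[OF s2(1) that[unfolded t0_def]] by auto
  have "varphi k f t \<le> (t' / t) powr (Cf + 1) * varphi k f t'" if t: "0 < t" "t \<le> t'" "t' < t0" for t t'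
  proof -
    have "t powr c * varphi k f t \<le> t' powr c * varphi k f t'"
    proof (rule DERIV_nonneg_imp_nondecreasing[OF t(2)])
      fix x assume x: "t \<le> x" "x \<le> t'"
      have xp: "0 < x" "x < t0" using x t by auto
      have 1: "((\<lambda>x. x powr c) has_real_derivative c * x powr (c - 1)) (at x)"
        using has_real_derivative_powr[OF xp(1), of c] by simp
      have "((\<lambda>x. x powr c * varphi k f x) has_real_derivative c * x powr (c - 1) * varphi k f x + - H (varphi k f x) * x powr c) (at x)"
        by (rule DERIV_mult[OF 1 varphi_deriv[OF xp(1) xp(2)[unfolded t0_def] s2(1)]])
      moreover have "c * x powr (c - 1) * varphi k f x + - H (varphi k f x) * x powr c \<ge> 0"
      proof -
        have "x * H (varphi k f x) \<le> c * varphi k f x"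
          using s2(2)[of "varphi k f x"] vp[OF xp] by (simp add: c_def)
        then have "x powr (c - 1) * (x * H (varphi k f x)) \<le> x powr (c - 1) * (c * varphi k f x)" by (intro mult_left_mono) auto
        moreover have "x powr (c - 1) * x = x powr c" using xp(1) by (simp add: powr_mult_base mult.commute)
        ultimately show ?thesis by (simp add: algebra_simps) (metis mult.assoc mult.commute)
      qed
      ultimately show "\<exists>y. ((\<lambda>x. x powr c * varphi k f x) has_real_derivative y) (at x) \<and> 0 \<le> y" by blast
    qed
    then have "varphi k f t \<le> t' powr c * varphi k f t' / t powr c" using t by (simp add: field_simps)
    then show ?thesis using t by (simp add: c_def powr_divide)
  qed
  moreover have "t0 > 0" using Phi_pos[OF s2(1)] by (simp add: t0_def)
  ultimately show ?thesis using vp s2(1) by (intro exI[of _ t0]) (smt (verit, best))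
qed

end

section \<open>The barrier profile and its first two derivatives\<close>

locale blowup_profile = keller_osserman +
  fixes m M :: "real \<Rightarrow> real" and \<delta>0 Cm :: real
  assumes k1: "1 \<le> k"
    and m1: "\<delta>0 > 0" "m C1_differentiable_on {0<..<\<delta>0}" "\<forall>t\<in>{0<..<\<delta>0}. m t > 0" "mono_on {0<..<\<delta>0} m"
    and m2: "\<forall>t\<in>{0<..<\<delta>0}. m integrable_on {0..t}" "\<forall>t\<in>{0<..<\<delta>0}. M t = integral {0..t} m"
    and m3: "((\<lambda>t. deriv (\<lambda>s. M s / m s) t) \<longlongrightarrow> Cm) (at_right 0)"
begin

lemma m_pos: "0 < t \<Longrightarrow> t < \<delta>0 \<Longrightarrow> m t > 0" using m1 by simp

lemma m_mono: "0 < s \<Longrightarrow> s \<le> t \<Longrightarrow> t < \<delta>0 \<Longrightarrow> m s \<le> m t"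
  using m1(4) by (simp add: mono_on_def)

lemma m_deriv: "0 < t \<Longrightarrow> t < \<delta>0 \<Longrightarrow> (m has_real_derivative deriv m t) (at t)"
proof -
  assume "0 < t" "t < \<delta>0"
  then obtain D where "(m has_vector_derivative D) (at t)"
    using m1(2) unfolding C1_differentiable_on_def by (metis greaterThanLessThan_iff)
  then have "(m has_real_derivative D) (at t)" by (simp add: has_real_derivative_iff_has_vector_derivative)
  then show ?thesis using DERIV_imp_deriv by blast
qed

lemma M_deriv: "0 < t \<Longrightarrow> t < \<delta>0 \<Longrightarrow> (M has_real_derivative m t) (at t)"
proof -
  assume t: "0 < t" "t < \<delta>0"
  have "((\<lambda>x. integral {0..x} m) has_real_derivative m t) (at t)"
    by (rule has_real_derivative_integral_interior[where c=\<delta>0])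
      (use m2 t m1(2) C1_differentiable_imp_continuous_on in auto)
  then show ?thesis
    by (rule has_field_derivative_transform_within_open[where S="{0<..<\<delta>0}"]) (use t m2 in auto)
qed

text \<open>Monotonicity of \<open>m\<close> bounds the integrand by its value at \<open>t\<close>;
  the value at 0 is unconstrained and is replaced before comparing.\<close>

lemma M_bounds:
  assumes t: "0 < t" "t < \<delta>0"
  shows "M t > 0" "M t \<le> t * m t"
proof -
  have nonneg: "M s \<ge> 0" if "0 < s" "s < \<delta>0" for s
  proof -
    have "integral {0..s} m = integral {0..s} (\<lambda>x. if x \<le> 0 then 0 else m x)"
      by (rule integral_spike[of "{0}"]) auto
    moreover have "(\<lambda>x. if x \<le> 0 then 0 else m x) integrable_on {0..s}"
      by (rule integrable_spike_finite[of "{0}" _ _ m]) (use m2 that in auto)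
    then have "integral {0..s} (\<lambda>x. if x \<le> 0 then 0 else m x) \<ge> 0"
      by (rule Henstock_Kurzweil_Integration.integral_nonneg) (use that m_pos in \<open>auto intro: less_imp_le\<close>)
    ultimately show ?thesis using m2(2) that by simp
  qed
  have "M (t/2) < M t"
  proof (rule DERIV_pos_imp_increasing[where f=M])
    fix x assume "t/2 \<le> x" "x \<le> t"
    then have "0 < x" "x < \<delta>0" using t by auto
    then show "\<exists>y. (M has_real_derivative y) (at x) \<and> 0 < y" using M_deriv m_pos by blast
  qed (use t in simp)
  then show "M t > 0" using nonneg[of "t/2"] t by simp
  have "integral {0..t} m = integral {0..t} (\<lambda>x. if x \<le> 0 then m t else m x)"
    by (rule integral_spike[of "{0}"]) auto
  also have "\<dots> \<le> integral {0..t} (\<lambda>x. m t)"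
  proof (rule integral_le)
    show "(\<lambda>x. if x \<le> 0 then m t else m x) integrable_on {0..t}"
      by (rule integrable_spike_finite[of "{0}" _ _ m]) (use m2 t in auto)
  qed (use t m_mono in auto)
  also have "\<dots> = t * m t" using t by simp
  finally show "M t \<le> t * m t" using m2(2) t by simp
qed

lemma ev_small: "\<forall>\<^sub>F t in at_right 0. 0 < t \<and> t < \<delta>0"
  using m1(1) unfolding eventually_at_right_field by blast

lemma M_over_m_tendsto: "((\<lambda>t. M t / m t) \<longlongrightarrow> 0) (at_right 0)"
proof (rule tendsto_sandwich[of "\<lambda>_. 0" _ _ "\<lambda>t. t"])
  show "\<forall>\<^sub>F t in at_right 0. 0 \<le> M t / m t" using ev_small
    by eventually_elim (use M_bounds m_pos in \<open>force intro: divide_nonneg_nonneg less_imp_le\<close>)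
  show "\<forall>\<^sub>F t in at_right 0. M t / m t \<le> t" using ev_small
    by eventually_elim (use M_bounds m_pos in \<open>simp add: divide_le_eq\<close>)
qed (auto intro: tendsto_eq_intros)

lemma M_tendsto: "filterlim M (at_right 0) (at_right 0)"
proof -
  have "(M \<longlongrightarrow> 0) (at_right 0)"
  proof (rule tendsto_sandwich[of "\<lambda>_. 0" _ _ "\<lambda>t. t * m (\<delta>0 / 2)"])
    show "\<forall>\<^sub>F t in at_right 0. 0 \<le> M t" using ev_small
      by eventually_elim (use M_bounds in \<open>force intro: less_imp_le\<close>)
    have "\<delta>0 / 2 > 0" using m1(1) by simp
    then have "\<forall>\<^sub>F t in at_right 0. 0 < t \<and> t < \<delta>0 / 2" unfolding eventually_at_right_field by blast
    then show "\<forall>\<^sub>F t in at_right 0. M t \<le> t * m (\<delta>0 / 2)"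
    proof eventually_elim
      case (elim t)
      have "M t \<le> t * m t" using M_bounds elim m1 by simp
      also have "\<dots> \<le> t * m (\<delta>0 / 2)" using elim m1 m_mono[of t "\<delta>0 / 2"] by (intro mult_left_mono) auto
      finally show ?case .
    qed
  qed (auto intro!: tendsto_eq_intros)
  moreover have "\<forall>\<^sub>F t in at_right 0. M t \<in> {0<..} \<and> M t \<noteq> 0" using ev_small
    by eventually_elim (use M_bounds in force)
  ultimately show ?thesis by (simp add: filterlim_at)
qed

text \<open>Converts the hypothesis on \<open>(M / m)'\<close> into a limit of
  \<open>M m' / m^2\<close>, the form in which \<open>m'\<close> enters the second derivative of the
  profile.\<close>

lemma deriv_quotient:
  assumes "0 < t" "t < \<delta>0"
  shows "deriv (\<lambda>s. M s / m s) t = 1 - M t * deriv m t / (m t)\<^sup>2"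
proof -
  have "((\<lambda>s. M s / m s) has_real_derivative (m t * m t - M t * deriv m t) / (m t * m t)) (at t)"
    by (rule DERIV_divide[OF M_deriv[OF assms] m_deriv[OF assms]]) (use m_pos[OF assms] in simp)
  then have "deriv (\<lambda>s. M s / m s) t = (m t * m t - M t * deriv m t) / (m t * m t)" by (rule DERIV_imp_deriv)
  then show ?thesis using m_pos[OF assms] by (simp add: field_simps power2_eq_square)
qed

text \<open>\<open>lam * e\<close> and \<open>lam * E\<close> are \<open>- g'\<close> and
  \<open>g''\<close>, normalized so that \<open>E\<close> has a positive limit in the application
  and \<open>e\<close> measures the first derivative against the second. Since
  \<open>Phi k f (g t) = \<xi> * M t\<close>, the limit hypothesis says that
  \<open>H' (g t) * \<xi> * M t\<close> tends to \<open>Cf\<close>; with it, \<open>e\<close>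
  becomes a multiple of \<open>M / m\<close> and \<open>E\<close> a function of
  \<open>(M / m)'\<close>.\<close>

lemma profile:
  assumes \<xi>: "\<xi> > 0"
  defines "g \<equiv> \<lambda>t. varphi k f (\<xi> * M t)"
  shows "\<exists>t0 lam e E. 0 < t0 \<and> t0 \<le> \<delta>0 \<and> (\<forall>t. 0 < t \<longrightarrow> t < t0 \<longrightarrow>
      g t > 0 \<and> (g has_real_derivative - (lam t * e t)) (at t) \<and>
      ((\<lambda>t. - (lam t * e t)) has_real_derivative lam t * E t) (at t) \<and>
      lam t > 0 \<and> e t > 0 \<and> lam t ^ k * e t ^ (k - 1) = \<xi> ^ (k + 1) * m t ^ (k + 1) * f (g t)) \<and>
    (e \<longlongrightarrow> 0) (at_right 0) \<and> (E \<longlongrightarrow> 1 - (1 - Cm) / Cf) (at_right 0) \<and>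
    filterlim g at_top (at_right 0)"
proof -
  define Hd where "Hd s = f s / H s ^ k" for s
  define lam where "lam t = \<xi>\<^sup>2 * (m t)\<^sup>2 * H (g t) * Hd (g t)" for t
  define e where "e t = 1 / (\<xi> * m t * Hd (g t))" for t
  define E where "E t = 1 - deriv m t / (\<xi> * (m t)\<^sup>2 * Hd (g t))" for t
  have xM: "filterlim (\<lambda>t. \<xi> * M t) (at_right 0) (at_right 0)"
  proof -
    have "(M \<longlongrightarrow> 0) (at_right 0)" using M_tendsto by (simp add: filterlim_at)
    then have "((\<lambda>t. \<xi> * M t) \<longlongrightarrow> 0) (at_right 0)" by (auto intro!: tendsto_eq_intros)
    moreover have "\<forall>\<^sub>F t in at_right 0. \<xi> * M t \<in> {0<..} \<and> \<xi> * M t \<noteq> 0" using ev_small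
      by eventually_elim (use M_bounds \<xi> in force)
    ultimately show ?thesis by (simp add: filterlim_at)
  qed
  have gtop: "filterlim g at_top (at_right 0)"
    unfolding g_def by (rule filterlim_compose[OF varphi_at_top xM])
  \<comment> \<open>The argument 1 is an arbitrary positive number; it keeps
    \<open>\<xi> * M t\<close> in the range of \<open>Phi\<close>.\<close>
  have "\<forall>\<^sub>F y in at_right 0. y < Phi k f 1"
    using Phi_pos[of 1] by (intro order_tendstoD[OF tendsto_ident_at]) auto
  from eventually_compose_filterlim[OF this xM]
  have "\<forall>\<^sub>F t in at_right 0. \<xi> * M t < Phi k f 1" .
  then obtain c where c: "c > 0" "\<And>t. 0 < t \<Longrightarrow> t < c \<Longrightarrow> \<xi> * M t < Phi k f 1"
    unfolding eventually_at_right_field by auto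
  define t0 where "t0 = min c \<delta>0"
  have t0: "0 < t0" "t0 \<le> \<delta>0" using c m1 by (auto simp: t0_def)
  have base: "\<xi> * M t > 0" "g t > 1" "Phi k f (g t) = \<xi> * M t" "(g has_real_derivative - (\<xi> * m t * H (g t))) (at t)"
    if t: "0 < t" "t < t0" for t
  proof -
    have t': "t < \<delta>0" "t < c" using t by (auto simp: t0_def)
    show p: "\<xi> * M t > 0" using M_bounds t t' \<xi> by simp
    note lt = c(2)[OF t(1) t'(2)]
    show "g t > 1" "Phi k f (g t) = \<xi> * M t" unfolding g_def using varphi_exists[OF zero_less_one p lt] by auto
    have "((\<lambda>t. \<xi> * M t) has_real_derivative \<xi> * m t) (at t)" by (rule DERIV_cmult[OF M_deriv[OF t(1) t'(1)]])
    from DERIV_chain2[OF varphi_deriv[OF p lt zero_less_one] this]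
    show "(g has_real_derivative - (\<xi> * m t * H (g t))) (at t)" unfolding g_def by (simp add: mult_ac)
  qed
  have le: "lam t * e t = \<xi> * m t * H (g t)" if "0 < t" "t < t0" for t
  proof -
    have "m t > 0" using m_pos that t0 by simp
    moreover have "g t > 0" using base(2)[OF that] by simp
    then have "Hd (g t) > 0" using H_pos f_pos by (simp add: Hd_def)
    ultimately show ?thesis using \<xi> by (simp add: lam_def e_def power2_eq_square)
  qed
  have all: "g t > 0 \<and> (g has_real_derivative - (lam t * e t)) (at t) \<and>
      ((\<lambda>t. - (lam t * e t)) has_real_derivative lam t * E t) (at t) \<and>
      lam t > 0 \<and> e t > 0 \<and> lam t ^ k * e t ^ (k - 1) = \<xi> ^ (k + 1) * m t ^ (k + 1) * f (g t)"
    if t: "0 < t" "t < t0" for t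
  proof -
    have t': "t < \<delta>0" using t t0 by simp
    have m0: "m t > 0" using m_pos t t' by simp
    have g0: "g t > 0" using base(2)[OF t] by simp
    have Hd0: "Hd (g t) > 0" "H (g t) > 0" using H_pos f_pos g0 by (auto simp: Hd_def)
    have HD: "((\<lambda>t. H (g t)) has_real_derivative Hd (g t) * - (\<xi> * m t * H (g t))) (at t)"
      using DERIV_chain2[OF H_deriv[OF g0] base(4)[OF t]] by (simp add: Hd_def)
    have "((\<lambda>t. - (\<xi> * m t * H (g t))) has_real_derivative
        - ((\<xi> * deriv m t) * H (g t) + Hd (g t) * - (\<xi> * m t * H (g t)) * (\<xi> * m t))) (at t)"
      by (intro DERIV_minus DERIV_mult DERIV_cmult HD m_deriv t t')
    then have "((\<lambda>t. - (lam t * e t)) has_real_derivative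
        - ((\<xi> * deriv m t) * H (g t) + Hd (g t) * - (\<xi> * m t * H (g t)) * (\<xi> * m t))) (at t)"
      by (rule has_field_derivative_transform_within_open[where S="{0<..<t0}"]) (use t le in auto)
    moreover have "- ((\<xi> * deriv m t) * H (g t) + Hd (g t) * - (\<xi> * m t * H (g t)) * (\<xi> * m t)) = lam t * E t"
      using m0 Hd0 \<xi> by (simp add: lam_def E_def field_simps power2_eq_square)
    moreover have "lam t ^ k * e t ^ (k - 1) = \<xi> ^ (k + 1) * m t ^ (k + 1) * f (g t)"
    proof -
      obtain j where j: "k = Suc j" using k1 by (cases k) auto
      have "lam t ^ k * e t ^ (k - 1) = lam t * (lam t * e t) ^ j" by (simp add: j power_mult_distrib)
      also have "\<dots> = \<xi>\<^sup>2 * (m t)\<^sup>2 * H (g t) * (f (g t) / H (g t) ^ Suc j) * (\<xi> ^ j * m t ^ j * H (g t) ^ j)"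
        unfolding le[OF t] unfolding lam_def Hd_def by (simp add: power_mult_distrib j)
      also have "\<dots> = \<xi> ^ (k + 1) * m t ^ (k + 1) * f (g t)"
        using Hd0(2) by (simp add: j power2_eq_square field_simps)
      finally show ?thesis .
    qed
    ultimately show ?thesis using g0 base(4)[OF t] m0 Hd0 \<xi> by (simp add: le[OF t]) (simp add: lam_def e_def)
  qed
  have evt: "\<forall>\<^sub>F t in at_right 0. 0 < t \<and> t < t0" using t0(1) unfolding eventually_at_right_field by blast
  \<comment> \<open>Dividing \<open>M / m\<close> and \<open>1 - (M / m)'\<close> by this quantity
    gives \<open>e\<close> and \<open>1 - E\<close> respectively.\<close>
  have Q: "((\<lambda>t. Hd (g t) * (\<xi> * M t)) \<longlongrightarrow> Cf) (at_right 0)"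
  proof -
    have "((\<lambda>t. deriv H (g t) * Phi k f (g t)) \<longlongrightarrow> Cf) (at_right 0)"
      by (rule filterlim_compose[OF f3(2) gtop])
    then show ?thesis
    proof (rule Lim_transform_eventually)
      show "\<forall>\<^sub>F t in at_right 0. deriv H (g t) * Phi k f (g t) = Hd (g t) * (\<xi> * M t)"
        using evt
      proof eventually_elim
        case (elim t)
        then have "g t > 0" using base(2)[of t] by simp
        then show ?case using elim base(3)[of t] by (simp add: Hd_def deriv_H)
      qed
    qed
  qed
  have "((\<lambda>t. (M t / m t) / (Hd (g t) * (\<xi> * M t))) \<longlongrightarrow> 0 / Cf) (at_right 0)"
    by (intro tendsto_divide M_over_m_tendsto Q) (use f3 in simp)
  moreover have "\<forall>\<^sub>F t in at_right 0. (M t / m t) / (Hd (g t) * (\<xi> * M t)) = e t"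
    using evt
  proof eventually_elim
    case (elim t)
    then have "M t \<noteq> 0" using base(1)[of t] \<xi> by auto
    then show ?case by (simp add: e_def)
  qed
  ultimately have "(e \<longlongrightarrow> 0 / Cf) (at_right 0)" by (rule Lim_transform_eventually)
  then have e0: "(e \<longlongrightarrow> 0) (at_right 0)" by simp
  have "((\<lambda>t. 1 - (1 - deriv (\<lambda>s. M s / m s) t) / (Hd (g t) * (\<xi> * M t))) \<longlongrightarrow> 1 - (1 - Cm) / Cf) (at_right 0)"
    by (intro tendsto_diff tendsto_divide tendsto_const m3 Q) (use f3 in simp)
  then have E0: "(E \<longlongrightarrow> 1 - (1 - Cm) / Cf) (at_right 0)"
  proof (rule Lim_transform_eventually)
    show "\<forall>\<^sub>F t in at_right 0. 1 - (1 - deriv (\<lambda>s. M s / m s) t) / (Hd (g t) * (\<xi> * M t)) = E t"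
      using evt
    proof eventually_elim
      case (elim t)
      then have "M t \<noteq> 0" using base(1)[of t] \<xi> by auto
      then show ?case using elim t0 by (simp add: E_def deriv_quotient mult_ac)
    qed
  qed
  show ?thesis using t0 all e0 E0 gtop by blast
qed

end

section \<open>Jets, test functions and barriers\<close>

text \<open>The quadratic with Hessian \<open>A + \<eta> 1\<close> touches \<open>u\<close> from
  above. Positivity of the finitely many \<open>csig j\<close> is an open condition, so it is
  admissible for small \<open>\<eta>\<close>, and letting \<open>\<eta>\<close> tend to 0 recovers
  \<open>A\<close>.\<close>

lemma visc_sub_jet:
  fixes A :: "real^'n^'n"
  assumes \<Omega>: "open \<Omega>" "x \<in> \<Omega>" and u: "visc_sub k b f \<Omega> u"
    and sym: "transpose A = A" and pos: "\<And>j. j \<in> {1..k} \<Longrightarrow> csig j A > 0"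
    and jet: "\<And>\<eta>. \<eta> > 0 \<Longrightarrow> \<exists>r>0. \<forall>h. norm h < r \<longrightarrow> u (x + h) \<le> u x + p \<bullet> h + (h \<bullet> (A *v h) + \<eta> * (h \<bullet> h)) / 2"
  shows "b x * f (u x) \<le> csig k A"
proof -
  have cont: "isCont (csig j) B" for j and B :: "real^'n^'n"
    using continuous_on_csig[where X="UNIV :: (real^'n^'n) set" and j=j] by (simp add: continuous_on_eq_continuous_at)
  have lim: "((\<lambda>\<eta>. csig j (A + \<eta> *\<^sub>R mat 1)) \<longlongrightarrow> csig j A) (at_right 0)" for j
    by (rule isCont_tendsto_compose[OF cont]) (auto intro!: tendsto_eq_intros)
  have ev: "\<forall>\<^sub>F \<eta> in at_right 0. \<forall>j\<in>{1..k}. csig j (A + \<eta> *\<^sub>R mat 1) > 0"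
    by (intro eventually_ball_finite ballI order_tendstoD(1)[OF lim] pos) auto
  have "\<forall>\<^sub>F \<eta> in at_right 0. b x * f (u x) \<le> csig k (A + \<eta> *\<^sub>R mat 1)"
    using ev eventually_at_right_less[of "0::real"]
  proof eventually_elim
    case (elim \<eta>)
    define B where "B = A + \<eta> *\<^sub>R mat 1"
    have symB: "transpose B = B"
    proof -
      have "transpose B = transpose A + \<eta> *\<^sub>R transpose (mat 1)"
        by (simp add: B_def transpose_def vec_eq_iff)
      then show ?thesis by (simp add: sym B_def)
    qed
    define \<psi> where "\<psi> = (\<lambda>y. u x + p \<bullet> (y - x) + ((y - x) \<bullet> (B *v (y - x))) / 2)"
    have q: "Ck_on 2 \<Omega> \<psi>" "hess \<psi> y = B" for y
      unfolding \<psi>_def by (rule quadratic_poly_C2[OF symB])+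
    have "k_admissible_on k \<Omega> \<psi>"
      unfolding k_admissible_on_def q(2) Gamma_def using q(1) elim csig_eigvals[OF symB] by (simp add: B_def)
    moreover obtain r where r: "r > 0" "\<And>h. norm h < r \<Longrightarrow> u (x + h) \<le> u x + p \<bullet> h + (h \<bullet> (A *v h) + \<eta> * (h \<bullet> h)) / 2"
      using jet elim by blast
    have "u y - \<psi> y \<le> u x - \<psi> x" if "y \<in> \<Omega> \<inter> ball x r" for y
      using r(2)[of "y - x"] that
      by (simp add: \<psi>_def B_def dist_norm norm_minus_commute matrix_vector_mult_add_rdistrib inner_add_right[of "y - x"] scaleR_matrix_vector_assoc[symmetric])
    then have "\<exists>e>0. \<forall>y\<in>\<Omega> \<inter> ball x e. u y - \<psi> y \<le> u x - \<psi> x" using r(1) by blast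
    moreover have "\<psi> x = u x" by (simp add: \<psi>_def)
    ultimately have "Sk k (hess \<psi> x) \<ge> b x * f (\<psi> x)"
      using u \<Omega> unfolding visc_sub_def by blast
    then show ?case using \<open>\<psi> x = u x\<close> Sk_eq_csig[OF symB] by (simp add: q B_def)
  qed
  then show ?thesis by (intro tendsto_lowerbound[OF lim]) auto
qed

text \<open>Touching from below lowers the Hessian to \<open>A - \<eta> 1\<close>, which could leave
  the cone; the strict inequalities for \<open>A\<close> prevent this for small
  \<open>\<eta>\<close>.\<close>

lemma visc_super_jet:
  fixes A :: "real^'n^'n"
  assumes \<Omega>: "open \<Omega>" "x \<in> \<Omega>" and u: "visc_super k b f \<Omega> u"
    and sym: "transpose A = A" and pos: "\<And>j. j \<in> {1..k} \<Longrightarrow> csig j A > 0"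
    and jet: "\<And>\<eta>. \<eta> > 0 \<Longrightarrow> \<exists>r>0. \<forall>h. norm h < r \<longrightarrow> u (x + h) \<ge> u x + p \<bullet> h + (h \<bullet> (A *v h) - \<eta> * (h \<bullet> h)) / 2"
  shows "csig k A \<le> b x * f (u x)"
proof -
  have cont: "isCont (csig j) B" for j and B :: "real^'n^'n"
    using continuous_on_csig[where X="UNIV :: (real^'n^'n) set" and j=j] by (simp add: continuous_on_eq_continuous_at)
  have lim: "((\<lambda>\<eta>. csig j (A - \<eta> *\<^sub>R mat 1)) \<longlongrightarrow> csig j A) (at_right 0)" for j
    by (rule isCont_tendsto_compose[OF cont]) (auto intro!: tendsto_eq_intros)
  have ev: "\<forall>\<^sub>F \<eta> in at_right 0. \<forall>j\<in>{1..k}. csig j (A - \<eta> *\<^sub>R mat 1) > 0"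
    by (intro eventually_ball_finite ballI order_tendstoD(1)[OF lim] pos) auto
  have "\<forall>\<^sub>F \<eta> in at_right 0. csig k (A - \<eta> *\<^sub>R mat 1) \<le> b x * f (u x)"
    using ev eventually_at_right_less[of "0::real"]
  proof eventually_elim
    case (elim \<eta>)
    define B where "B = A - \<eta> *\<^sub>R mat 1"
    have symB: "transpose B = B"
    proof -
      have "transpose B = transpose A - \<eta> *\<^sub>R transpose (mat 1)"
        by (simp add: B_def transpose_def vec_eq_iff)
      then show ?thesis by (simp add: sym B_def)
    qed
    define \<psi> where "\<psi> = (\<lambda>y. u x + p \<bullet> (y - x) + ((y - x) \<bullet> (B *v (y - x))) / 2)"
    have q: "Ck_on 2 \<Omega> \<psi>" "hess \<psi> y = B" for y
      unfolding \<psi>_def by (rule quadratic_poly_C2[OF symB])+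
    have "k_admissible_on k \<Omega> \<psi>"
      unfolding k_admissible_on_def q(2) Gamma_def using q(1) elim csig_eigvals[OF symB] by (simp add: B_def)
    moreover obtain r where r: "r > 0" "\<And>h. norm h < r \<Longrightarrow> u (x + h) \<ge> u x + p \<bullet> h + (h \<bullet> (A *v h) - \<eta> * (h \<bullet> h)) / 2"
      using jet elim by blast
    have "u y - \<psi> y \<ge> u x - \<psi> x" if "y \<in> \<Omega> \<inter> ball x r" for y
      using r(2)[of "y - x"] that
      by (simp add: \<psi>_def B_def dist_norm norm_minus_commute matrix_vector_mult_diff_rdistrib inner_diff_right[of "y - x"] scaleR_matrix_vector_assoc[symmetric])
    then have "\<exists>e>0. \<forall>y\<in>\<Omega> \<inter> ball x e. u y - \<psi> y \<ge> u x - \<psi> x" using r(1) by blast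
    moreover have "\<psi> x = u x" by (simp add: \<psi>_def)
    ultimately have "Sk k (hess \<psi> x) \<le> b x * f (\<psi> x)"
      using u \<Omega> unfolding visc_super_def by blast
    then show ?case using \<open>\<psi> x = u x\<close> Sk_eq_csig[OF symB] by (simp add: q B_def)
  qed
  then show ?thesis by (intro tendsto_upperbound[OF lim]) auto
qed

text \<open>The inner increment is a linear form \<open>a\<close> minus a quadratic form
  \<open>q\<close>. The linear Taylor term of \<open>g\<close> turns \<open>q\<close> into the part
  \<open>- g1 t B\<close> of the Hessian; replacing the squared increment by
  \<open>a\<^sup>2\<close> costs a cubic term.\<close>

lemma composite_second_order:
  fixes \<nu> :: "real^'n" and g g1 :: "real \<Rightarrow> real"
  assumes d: "\<rho> > 0" "\<And>s. \<bar>s - t\<bar> < \<rho> \<Longrightarrow> (g has_real_derivative g1 s) (at s)"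
    and g2: "(g1 has_real_derivative g2) (at t)" and n: "norm \<nu> = 1" and \<eta>: "\<eta> > 0"
  shows "\<exists>r>0. \<forall>h. norm h < r \<longrightarrow>
    \<bar>\<nu> \<bullet> h - (h \<bullet> (B *v h)) / 2\<bar> < \<rho> \<and>
    \<bar>g (t + (\<nu> \<bullet> h - (h \<bullet> (B *v h)) / 2)) - g t - (g1 t *\<^sub>R \<nu>) \<bullet> h
      - (h \<bullet> ((g2 *\<^sub>R outer \<nu> - g1 t *\<^sub>R B) *v h)) / 2\<bar> \<le> \<eta> * (h \<bullet> h) / 2"
proof -
  obtain r1 where r1: "r1 > 0" "\<And>s. \<bar>s\<bar> < r1 \<Longrightarrow> \<bar>g (t + s) - g t - g1 t * s - g2 * s\<^sup>2 / 2\<bar> \<le> \<eta> / 16 * s\<^sup>2"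
    using real_taylor2[OF d g2, of "\<eta> / 16"] \<eta> by auto
  define K where "K = norm B + 1"
  define G where "G = \<bar>g2\<bar> + 1"
  have K: "K \<ge> 1" "norm B \<le> K" and G: "G \<ge> 1" "\<bar>g2\<bar> \<le> G" by (auto simp: K_def G_def)
  \<comment> \<open>The bound \<open>1 / K\<close> gives \<open>\<bar>q\<bar> \<le> N / 2\<close>,
    hence an increment of at most \<open>2 * N\<close>; the last bound turns the cubic error into
    \<open>\<eta> / 4 * N\<^sup>2\<close>.\<close>
  define r where "r = min (min (r1 / 2) (\<rho> / 2)) (min (1 / K) (\<eta> / (4 * G * K)))"
  have r: "r > 0" "r \<le> r1 / 2" "r \<le> \<rho> / 2" "r \<le> 1 / K" "r \<le> \<eta> / (4 * G * K)"
    using r1 d K G \<eta> by (auto simp: r_def)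
  show ?thesis
  proof (intro exI[of _ r] conjI allI impI r(1))
    fix h :: "real^'n" assume h: "norm h < r"
    define a where "a = \<nu> \<bullet> h"
    define q where "q = (h \<bullet> (B *v h)) / 2"
    define N where "N = norm h"
    have N: "N \<ge> 0" "N < r" using h by (auto simp: N_def)
    have a: "\<bar>a\<bar> \<le> N" using Cauchy_Schwarz_ineq2[of \<nu> h] n by (simp add: a_def N_def)
    have q: "\<bar>q\<bar> \<le> K / 2 * N\<^sup>2"
    proof -
      have "norm B * norm h * norm h \<le> K * norm h * norm h" using K by (intro mult_right_mono) auto
      then show ?thesis using quad_form_le[of h B h] by (simp add: q_def N_def power2_eq_square)
    qed
    have KN: "K * N \<le> 1"
    proof -
      have "K * N \<le> K * (1 / K)" using N r(4) K by (intro mult_left_mono) auto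
      then show ?thesis using K by simp
    qed
    have qN: "\<bar>q\<bar> \<le> N / 2"
    proof -
      have "K * N * N \<le> 1 * N" using KN N by (intro mult_right_mono) auto
      then show ?thesis using q by (simp add: power2_eq_square)
    qed
    define s where "s = a - q"
    have s: "\<bar>s\<bar> \<le> 2 * N" using a qN N unfolding s_def by linarith
    show "\<bar>\<nu> \<bullet> h - (h \<bullet> (B *v h)) / 2\<bar> < \<rho>"
      unfolding a_def[symmetric] q_def[symmetric] s_def[symmetric] using s N r(3) by linarith
    have T: "\<bar>g (t + s) - g t - g1 t * s - g2 * s\<^sup>2 / 2\<bar> \<le> \<eta> / 16 * s\<^sup>2" using s N r(2) by (intro r1(2)) linarith
    have s2: "s\<^sup>2 \<le> 4 * N\<^sup>2" using power_mono[OF s, of 2] by simp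
    have sa: "\<bar>g2 * s\<^sup>2 / 2 - g2 * a\<^sup>2 / 2\<bar> \<le> \<eta> / 4 * N\<^sup>2"
    proof -
      have "\<bar>s\<^sup>2 - a\<^sup>2\<bar> = \<bar>q\<bar> * \<bar>s + a\<bar>" by (simp add: s_def power2_eq_square algebra_simps flip: abs_mult)
      also have "\<dots> \<le> (K / 2 * N\<^sup>2) * (3 * N)" using q s a N by (intro mult_mono) auto
      also have "\<dots> \<le> (K / 2 * N\<^sup>2) * (4 * N)" using K N by (intro mult_left_mono) auto
      finally have 1: "\<bar>s\<^sup>2 - a\<^sup>2\<bar> \<le> 2 * K * N * N\<^sup>2" by (simp add: mult_ac)
      have "g2 * s\<^sup>2 / 2 - g2 * a\<^sup>2 / 2 = g2 / 2 * (s\<^sup>2 - a\<^sup>2)" by (simp add: algebra_simps)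
      then have "\<bar>g2 * s\<^sup>2 / 2 - g2 * a\<^sup>2 / 2\<bar> = \<bar>g2\<bar> / 2 * \<bar>s\<^sup>2 - a\<^sup>2\<bar>"
        by (simp only: abs_mult)
      also have "\<dots> \<le> G / 2 * (2 * K * N * N\<^sup>2)" using 1 G by (intro mult_mono) auto
      also have "\<dots> = (G * K * N) * N\<^sup>2" by simp
      also have "\<dots> \<le> (\<eta> / 4) * N\<^sup>2"
      proof (rule mult_right_mono)
        have "G * K * N \<le> G * K * (\<eta> / (4 * G * K))" using N r(5) G K by (intro mult_left_mono) auto
        then show "G * K * N \<le> \<eta> / 4" using G K by simp
      qed simp
      finally show ?thesis .
    qed
    have "\<eta> / 16 * s\<^sup>2 \<le> \<eta> / 16 * (4 * N\<^sup>2)" using s2 \<eta> by (intro mult_left_mono) auto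
    with T sa have main: "\<bar>g (t + s) - g t - g1 t * s - g2 * a\<^sup>2 / 2\<bar> \<le> \<eta> / 2 * N\<^sup>2"
      unfolding abs_le_iff by linarith
    have hh: "(h \<bullet> ((g2 *\<^sub>R outer \<nu> - g1 t *\<^sub>R B) *v h)) / 2 = g2 * a\<^sup>2 / 2 - g1 t * q"
      by (simp add: matrix_vector_mult_diff_rdistrib scaleR_matrix_vector_assoc[symmetric] outer_mult_vec
        inner_diff_right a_def q_def power2_eq_square inner_commute diff_divide_distrib)
    have eq: "g (t + s) - g t - (g1 t *\<^sub>R \<nu>) \<bullet> h - (g2 * a\<^sup>2 / 2 - g1 t * q)
        = g (t + s) - g t - g1 t * s - g2 * a\<^sup>2 / 2"
      by (simp add: s_def a_def right_diff_distrib)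
    have N2: "N\<^sup>2 = h \<bullet> h" by (simp add: N_def power2_norm_eq_inner)
    show "\<bar>g (t + (\<nu> \<bullet> h - (h \<bullet> (B *v h)) / 2)) - g t - (g1 t *\<^sub>R \<nu>) \<bullet> h
      - (h \<bullet> ((g2 *\<^sub>R outer \<nu> - g1 t *\<^sub>R B) *v h)) / 2\<bar> \<le> \<eta> * (h \<bullet> h) / 2"
      unfolding hh unfolding q_def[symmetric] a_def[symmetric] unfolding s_def[symmetric] eq
      using main by (simp add: N2)
  qed
qed

section \<open>Asymptotics of the symmetric functions of a radial Hessian\<close>

lemma csig_perturbed_uniform:
  fixes K :: real
  assumes "\<kappa> > 0"
  shows "\<exists>\<eta>0>0. \<exists>R. \<forall>\<eta> (\<nu>::real^'n) C. \<bar>\<eta>\<bar> < \<eta>0 \<longrightarrow> norm \<nu> = 1 \<longrightarrow> norm C \<le> K \<longrightarrow>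
    \<bar>csig j (C + \<eta> *\<^sub>R tproj \<nu>) - csig j C\<bar> < \<kappa> \<and> \<bar>csig j (C + \<eta> *\<^sub>R tproj \<nu>)\<bar> \<le> R"
proof -
  define F where "F = (\<lambda>z::(real^'n^'n) \<times> (real^'n) \<times> real. csig j (fst z + snd (snd z) *\<^sub>R tproj (fst (snd z))))"
  define X where "X = cball (0::real^'n^'n) K \<times> sphere (0::real^'n) 1 \<times> {-1..1::real}"
  have cX: "compact X" unfolding X_def by (intro compact_Times compact_cball compact_sphere compact_Icc)
  have cF: "continuous_on X F"
    unfolding F_def
    by (rule continuous_on_compose2[OF continuous_on_csig[of UNIV]]) (auto intro!: continuous_intros continuous_on_tproj)
  have "compact (F ` X)" by (rule compact_continuous_image[OF cF cX])
  then obtain R where R: "\<And>z. z \<in> X \<Longrightarrow> \<bar>F z\<bar> \<le> R"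
    using compact_imp_bounded bounded_real by (metis imageI)
  have "uniformly_continuous_on X F" by (rule compact_uniformly_continuous[OF cF cX])
  then obtain d where d: "d > 0" "\<And>z z'. z \<in> X \<Longrightarrow> z' \<in> X \<Longrightarrow> dist z' z < d \<Longrightarrow> dist (F z') (F z) < \<kappa>"
    using assms unfolding uniformly_continuous_on_def by metis
  have "\<bar>csig j (C + \<eta> *\<^sub>R tproj \<nu>) - csig j C\<bar> < \<kappa> \<and> \<bar>csig j (C + \<eta> *\<^sub>R tproj \<nu>)\<bar> \<le> R"
    if a: "\<bar>\<eta>\<bar> < min d 1" "norm \<nu> = 1" "norm C \<le> K" for \<eta> and \<nu> :: "real^'n" and C :: "real^'n^'n"
  proof
    have X: "(C, \<nu>, \<eta>) \<in> X" "(C, \<nu>, 0) \<in> X" using a by (auto simp: X_def)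
    have "dist (C, \<nu>, \<eta>) (C, \<nu>, 0) < d" using a by (simp add: dist_Pair_Pair)
    from d(2)[OF X(2,1) this] show "\<bar>csig j (C + \<eta> *\<^sub>R tproj \<nu>) - csig j C\<bar> < \<kappa>"
      by (simp add: F_def dist_real_def)
    show "\<bar>csig j (C + \<eta> *\<^sub>R tproj \<nu>)\<bar> \<le> R" using R[OF X(1)] by (simp add: F_def)
  qed
  moreover have "min d 1 > 0" using d by simp
  ultimately show ?thesis by meson
qed

text \<open>The rank-one formula gives \<open>csig (Suc j) A = lam ^ Suc j * e ^ j * w j\<close>,
  where \<open>w j\<close> is close to \<open>\<theta> * csig j C\<close>. All scales of
  \<open>lam\<close> and \<open>e\<close> sit in the prefactor, so one estimate of
  \<open>w j\<close> yields both admissibility and the asymptotic value at \<open>k\<close>.\<close>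

lemma radial_hessian_estimate:
  fixes K \<theta> c0 :: real
  assumes k: "1 \<le> k" and \<theta>: "\<theta> > 0" and c0: "c0 > 0" "c0 \<le> 1" and \<kappa>: "\<kappa> > 0"
  shows "\<exists>\<eta>0>0. \<exists>\<epsilon>>0. \<forall>\<eta> (\<nu>::real^'n) C E e lam. \<bar>\<eta>\<bar> < \<eta>0 \<longrightarrow> norm \<nu> = 1 \<longrightarrow> norm C \<le> K \<longrightarrow>
    C *v \<nu> = 0 \<longrightarrow> (\<forall>j<k. csig j C \<ge> c0) \<longrightarrow> \<bar>E - \<theta>\<bar> < \<epsilon> \<longrightarrow> 0 < e \<longrightarrow> e < \<epsilon> \<longrightarrow> lam > 0 \<longrightarrow>
    (\<forall>j\<in>{1..k}. csig j ((lam * E) *\<^sub>R outer \<nu> + (lam * e) *\<^sub>R (C + \<eta> *\<^sub>R tproj \<nu>)) > 0) \<and>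
    \<bar>csig k ((lam * E) *\<^sub>R outer \<nu> + (lam * e) *\<^sub>R (C + \<eta> *\<^sub>R tproj \<nu>)) - lam ^ k * e ^ (k - 1) * (\<theta> * csig (k - 1) C)\<bar>
      \<le> lam ^ k * e ^ (k - 1) * \<kappa>"
proof -
  \<comment> \<open>The second bound leaves \<open>w j\<close> at least
    \<open>\<theta> * c0 / 2\<close>, hence positive.\<close>
  define \<kappa>1 where "\<kappa>1 = min \<kappa> (\<theta> * c0 / 2)"
  have \<kappa>1: "\<kappa>1 > 0" "\<kappa>1 \<le> \<kappa>" "\<kappa>1 \<le> \<theta> * c0 / 2" using \<kappa> \<theta> c0 by (auto simp: \<kappa>1_def)
  have "\<exists>\<eta>0>0. \<exists>R. \<forall>\<eta> (\<nu>::real^'n) C. \<bar>\<eta>\<bar> < \<eta>0 \<longrightarrow> norm \<nu> = 1 \<longrightarrow> norm C \<le> K \<longrightarrow>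
    \<bar>csig j (C + \<eta> *\<^sub>R tproj \<nu>) - csig j C\<bar> < \<kappa>1 / (2 * \<theta>) \<and> \<bar>csig j (C + \<eta> *\<^sub>R tproj \<nu>)\<bar> \<le> R" for j
    by (rule csig_perturbed_uniform) (use \<kappa>1 \<theta> in simp)
  then obtain \<eta>f Rf where f: "\<And>j. \<eta>f j > 0" "\<And>j \<eta> (\<nu>::real^'n) C. \<bar>\<eta>\<bar> < \<eta>f j \<Longrightarrow> norm \<nu> = 1 \<Longrightarrow> norm C \<le> K \<Longrightarrow>
    \<bar>csig j (C + \<eta> *\<^sub>R tproj \<nu>) - csig j C\<bar> < \<kappa>1 / (2 * \<theta>) \<and> \<bar>csig j (C + \<eta> *\<^sub>R tproj \<nu>)\<bar> \<le> Rf j"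
    by metis
  define \<eta>0 where "\<eta>0 = Min (\<eta>f ` {..k})"
  define R where "R = \<bar>Max (Rf ` {..k})\<bar> + 1"
  have \<eta>0: "\<eta>0 > 0" using f(1) by (simp add: \<eta>0_def)
  have R: "R > 0" "\<And>j. j \<le> k \<Longrightarrow> Rf j \<le> R"
  proof -
    show "R > 0" by (simp add: R_def add_nonneg_pos)
    fix j assume "j \<le> k"
    then have "Rf j \<le> Max (Rf ` {..k})" by (intro Max_ge) auto
    then show "Rf j \<le> R" by (simp add: R_def)
  qed
  \<comment> \<open>The errors from \<open>e\<close> and from \<open>E - \<theta>\<close> each cost
    a quarter of \<open>\<kappa>1\<close>; the remaining half pays for replacing \<open>B\<close> by
    \<open>C\<close>.\<close>
  define \<epsilon> where "\<epsilon> = \<kappa>1 / (4 * R)"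
  have \<epsilon>: "\<epsilon> > 0" using \<kappa>1 R by (simp add: \<epsilon>_def)
  show ?thesis
  proof (rule exI[of _ \<eta>0], rule conjI[OF \<eta>0], rule exI[of _ \<epsilon>], rule conjI[OF \<epsilon>], intro allI impI conjI)
    fix \<eta> E e lam :: real and \<nu> :: "real^'n" and C
    assume a: "\<bar>\<eta>\<bar> < \<eta>0" "norm \<nu> = 1" "norm C \<le> K" "C *v \<nu> = 0" "\<forall>j<k. csig j C \<ge> c0"
      "\<bar>E - \<theta>\<bar> < \<epsilon>" "0 < e" "e < \<epsilon>" "lam > 0"
    define B where "B = C + \<eta> *\<^sub>R tproj \<nu>"
    define A where "A = (lam * E) *\<^sub>R outer \<nu> + (lam * e) *\<^sub>R B"
    have B0: "B *v \<nu> = 0"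
      using a(2,4) by (simp add: B_def matrix_vector_mult_add_rdistrib scaleR_matrix_vector_assoc[symmetric] tproj_mult_vec norm_eq_1)
    have unif: "\<bar>csig j B - csig j C\<bar> < \<kappa>1 / (2 * \<theta>)" "\<bar>csig j B\<bar> \<le> R" if "j \<le> k" for j
    proof -
      have "\<eta>0 \<le> \<eta>f j" using that unfolding \<eta>0_def by (intro Min_le) auto
      then have "\<bar>\<eta>\<bar> < \<eta>f j" using a(1) by simp
      from f(2)[OF this a(2,3)] show "\<bar>csig j B - csig j C\<bar> < \<kappa>1 / (2 * \<theta>)" "\<bar>csig j B\<bar> \<le> R"
        using R(2)[OF that] by (auto simp: B_def)
    qed
    define w where "w j = e * csig (Suc j) B + E * csig j B" for j
    have cA: "csig (Suc j) A = lam ^ Suc j * e ^ j * w j" for j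
      unfolding A_def csig_Suc_rank_one[OF a(2) B0] w_def by (simp add: power_mult_distrib algebra_simps)
    have w: "\<bar>w j - \<theta> * csig j C\<bar> \<le> \<kappa>1" if "j < k" for j
    proof -
      have "\<bar>e * csig (Suc j) B\<bar> \<le> \<epsilon> * R"
        unfolding abs_mult using a unif(2)[of "Suc j"] that \<epsilon> by (intro mult_mono) auto
      moreover have "\<bar>(E - \<theta>) * csig j B\<bar> \<le> \<epsilon> * R"
        unfolding abs_mult using a unif(2)[of j] that \<epsilon> by (intro mult_mono) auto
      moreover have "\<epsilon> * R = \<kappa>1 / 4" using R by (simp add: \<epsilon>_def)
      moreover have "\<bar>\<theta> * (csig j B - csig j C)\<bar> \<le> \<kappa>1 / 2"
      proof -
        have "\<bar>\<theta> * (csig j B - csig j C)\<bar> \<le> \<theta> * (\<kappa>1 / (2 * \<theta>))"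
          unfolding abs_mult using \<theta> unif(1)[of j] that by (intro mult_mono) auto
        then show ?thesis using \<theta> by simp
      qed
      moreover have "w j - \<theta> * csig j C = e * csig (Suc j) B + (E - \<theta>) * csig j B + \<theta> * (csig j B - csig j C)"
        by (simp add: w_def algebra_simps)
      ultimately show ?thesis by linarith
    qed
    have wpos: "w j > 0" if "j < k" for j
    proof -
      have "\<theta> * csig j C \<ge> \<theta> * c0" using a(5) that \<theta> by simp
      moreover have "\<theta> * c0 > 0" using \<theta> c0 by simp
      ultimately show ?thesis using w[OF that] \<kappa>1(3) by linarith
    qed
    have "csig j A > 0" if j: "j \<in> {1..k}" for j
    proof -
      obtain i where i: "j = Suc i" "i < k" using j by (cases j) auto
      then show ?thesis unfolding i(1) cA using wpos[OF i(2)] a by simp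
    qed
    then show "\<forall>j\<in>{1..k}. csig j ((lam * E) *\<^sub>R outer \<nu> + (lam * e) *\<^sub>R (C + \<eta> *\<^sub>R tproj \<nu>)) > 0"
      unfolding A_def B_def by blast
    obtain i where i: "k = Suc i" using k by (cases k) auto
    have "csig k A - lam ^ k * e ^ (k - 1) * (\<theta> * csig (k - 1) C) = lam ^ k * e ^ (k - 1) * (w i - \<theta> * csig i C)"
      unfolding i cA by (simp add: right_diff_distrib)
    moreover have "lam ^ k * e ^ (k - 1) > 0" using a by simp
    ultimately have "\<bar>csig k A - lam ^ k * e ^ (k - 1) * (\<theta> * csig (k - 1) C)\<bar> = lam ^ k * e ^ (k - 1) * \<bar>w i - \<theta> * csig i C\<bar>"
      by (simp only: abs_mult[of "lam ^ k * e ^ (k - 1)"] abs_of_pos)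
    also have "\<dots> \<le> lam ^ k * e ^ (k - 1) * \<kappa>"
      using w[of i] \<kappa>1(2) i a by (intro mult_left_mono) auto
    finally show "\<bar>csig k ((lam * E) *\<^sub>R outer \<nu> + (lam * e) *\<^sub>R (C + \<eta> *\<^sub>R tproj \<nu>)) - lam ^ k * e ^ (k - 1) * (\<theta> * csig (k - 1) C)\<bar>
      \<le> lam ^ k * e ^ (k - 1) * \<kappa>" unfolding A_def B_def .
  qed
qed

section \<open>Comparison with shifted barriers on boundary strips\<close>

lemma compact_dist_bd_strip:
  assumes \<Omega>: "open \<Omega>" "bounded \<Omega>" and s: "0 < s"
  shows "compact {x \<in> \<Omega>. s \<le> dist_bd \<Omega> x \<and> dist_bd \<Omega> x \<le> \<delta>}"
proof -
  have "{x \<in> \<Omega>. s \<le> dist_bd \<Omega> x \<and> dist_bd \<Omega> x \<le> \<delta>} = closure \<Omega> \<inter> (dist_bd \<Omega> -` {s..\<delta>})"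
  proof -
    have "x \<in> \<Omega>" if "x \<in> closure \<Omega>" "s \<le> dist_bd \<Omega> x" for x
    proof (rule ccontr)
      assume "x \<notin> \<Omega>"
      then have "x \<in> frontier \<Omega>" using that \<Omega> by (simp add: frontier_def interior_open)
      then have "dist_bd \<Omega> x = 0" by (simp add: dist_bd_def)
      then show False using that s by simp
    qed
    then show ?thesis using closure_subset by auto
  qed
  moreover have "closed (dist_bd \<Omega> -` {s..\<delta>})"
    unfolding dist_bd_def by (intro continuous_closed_vimage continuous_infdist continuous_ident) auto
  ultimately show ?thesis using \<Omega> by (simp add: compact_Int_closed compact_closure)
qed

lemma continuous_on_dist_bd: "continuous_on S (dist_bd \<Omega>)"
  unfolding dist_bd_def by (intro continuous_intros)

text \<open>The shift moves the blow-up of \<open>g\<close> to the level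
  \<open>dist_bd = \<sigma>\<close>, where \<open>u\<close> is bounded, so the difference is
  negative near that level; at the level \<open>\<delta>\<close> it is at most the bound
  \<open>c\<close> of \<open>u\<close>. An excess over \<open>c\<close> would therefore be attained
  inside the strip, which \<open>touch\<close> forbids. As \<open>c\<close> is independent of
  \<open>\<sigma>\<close>, the limit can be taken.\<close>

lemma upper_barrier:
  fixes u :: "real^'n \<Rightarrow> real" and g :: "real \<Rightarrow> real"
  assumes \<Omega>: "open \<Omega>" "bounded \<Omega>" "\<Omega> \<noteq> {}" and u: "continuous_on \<Omega> u" and \<delta>: "\<delta> > 0"
    and g: "continuous_on {0<..\<delta>} g" "\<And>t. 0 < t \<Longrightarrow> t \<le> \<delta> \<Longrightarrow> g t > 0" "filterlim g at_top (at_right 0)"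
    and touch: "\<And>\<sigma> z. 0 < \<sigma> \<Longrightarrow> z \<in> \<Omega> \<Longrightarrow> \<sigma> < dist_bd \<Omega> z \<Longrightarrow> dist_bd \<Omega> z < \<delta> \<Longrightarrow> u z > g (dist_bd \<Omega> z - \<sigma>) \<Longrightarrow>
       (\<And>y. y \<in> \<Omega> \<Longrightarrow> \<sigma> < dist_bd \<Omega> y \<Longrightarrow> dist_bd \<Omega> y < \<delta> \<Longrightarrow>
          u y - g (dist_bd \<Omega> y - \<sigma>) \<le> u z - g (dist_bd \<Omega> z - \<sigma>)) \<Longrightarrow> False"
  shows "\<exists>c. \<forall>x\<in>\<Omega>. dist_bd \<Omega> x < \<delta> \<longrightarrow> u x \<le> g (dist_bd \<Omega> x) + c"
proof -
  let ?d = "dist_bd \<Omega>"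
  have bdd: "\<exists>c\<ge>0. \<forall>x\<in>\<Omega>. s \<le> ?d x \<longrightarrow> ?d x \<le> \<delta> \<longrightarrow> u x \<le> c" if "s > 0" for s
  proof -
    have "compact (u ` {x \<in> \<Omega>. s \<le> ?d x \<and> ?d x \<le> \<delta>})"
      by (intro compact_continuous_image continuous_on_subset[OF u] compact_dist_bd_strip \<Omega> that) auto
    then obtain c where "\<And>x. x \<in> \<Omega> \<Longrightarrow> s \<le> ?d x \<Longrightarrow> ?d x \<le> \<delta> \<Longrightarrow> \<bar>u x\<bar> \<le> c"
      using compact_imp_bounded bounded_real by (metis (mono_tags, lifting) imageI mem_Collect_eq)
    then show ?thesis by (intro exI[of _ "\<bar>c\<bar>"]) (force simp: abs_le_iff)
  qed
  obtain c where c: "c \<ge> 0" "\<And>x. x \<in> \<Omega> \<Longrightarrow> ?d x = \<delta> \<Longrightarrow> u x \<le> c" using bdd[OF \<delta>] by force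
  have fne: "frontier \<Omega> \<noteq> {}" using \<Omega> frontier_bounded_nonempty by blast
  have main: "u x \<le> g (?d x - \<sigma>) + c" if x: "x \<in> \<Omega>" "?d x < \<delta>" and \<sigma>: "0 < \<sigma>" "\<sigma> < ?d x" for x \<sigma>
  proof (rule ccontr)
    assume "\<not> u x \<le> g (?d x - \<sigma>) + c"
    then have neg: "u x - g (?d x - \<sigma>) > c" by simp
    obtain U where U: "U \<ge> 0" "\<And>y. y \<in> \<Omega> \<Longrightarrow> \<sigma> \<le> ?d y \<Longrightarrow> ?d y \<le> \<delta> \<Longrightarrow> u y \<le> U" using bdd[OF \<sigma>(1)] by blast
    have "\<forall>\<^sub>F t in at_right 0. g t > U" using g(3) by (simp add: filterlim_at_top_dense)
    then obtain \<sigma>' where \<sigma>': "\<sigma>' > 0" "\<And>t. 0 < t \<Longrightarrow> t < \<sigma>' \<Longrightarrow> g t > U"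
      unfolding eventually_at_right_field by auto
    \<comment> \<open>The strip starting at \<open>s\<close> is compact and avoids the singularity.
      On the discarded part the difference is negative, so the maximum over the compact strip is one
      over the whole region required by \<open>touch\<close>.\<close>
    define s where "s = \<sigma> + \<sigma>' / 2"
    have out: "u y - g (?d y - \<sigma>) < 0" if "y \<in> \<Omega>" "\<sigma> < ?d y" "?d y < s" "?d y \<le> \<delta>" for y
    proof -
      have "g (?d y - \<sigma>) > U" using that \<sigma>' by (intro \<sigma>'(2)) (auto simp: s_def)
      moreover have "u y \<le> U" using that U(2) by simp
      ultimately show ?thesis by simp
    qed
    have xs: "s \<le> ?d x"
    proof (rule ccontr)
      assume "\<not> s \<le> ?d x"
      then have "u x - g (?d x - \<sigma>) < 0" using x by (intro out[OF x(1) \<sigma>(2)]) auto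
      then show False using neg c(1) by linarith
    qed
    let ?D = "{y \<in> \<Omega>. s \<le> ?d y \<and> ?d y \<le> \<delta>}"
    have "compact ?D" by (intro compact_dist_bd_strip \<Omega>) (use \<sigma> \<sigma>' in \<open>simp add: s_def\<close>)
    moreover have "x \<in> ?D" using x xs by simp
    then have "?D \<noteq> {}" by blast
    moreover have "continuous_on ?D (\<lambda>y. u y - g (?d y - \<sigma>))"
    proof (intro continuous_intros)
      show "continuous_on ?D u" by (rule continuous_on_subset[OF u]) auto
      show "continuous_on ?D (\<lambda>y. g (?d y - \<sigma>))"
        by (rule continuous_on_compose2[OF g(1)]) (use \<sigma> \<sigma>' in \<open>auto intro!: continuous_intros continuous_on_dist_bd simp: s_def\<close>)
    qed
    ultimately obtain z where z: "z \<in> ?D" "\<And>y. y \<in> ?D \<Longrightarrow> u y - g (?d y - \<sigma>) \<le> u z - g (?d z - \<sigma>)"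
      using continuous_attains_sup[of ?D "\<lambda>y. u y - g (?d y - \<sigma>)"] by blast
    have zx: "u z - g (?d z - \<sigma>) > c" using z(2)[OF \<open>x \<in> ?D\<close>] neg by simp
    have \<sigma>z: "\<sigma> < ?d z" using z(1) \<sigma>' by (simp add: s_def)
    have "?d z \<noteq> \<delta>"
    proof
      assume dz: "?d z = \<delta>"
      have "g (\<delta> - \<sigma>) > 0" using \<sigma>z \<sigma> by (intro g(2)) (auto simp: dz)
      then show False using zx c(2)[of z] z(1) dz by simp
    qed
    then have z\<delta>: "?d z < \<delta>" using z(1) by simp
    show False
    proof (rule touch[OF \<sigma>(1) _ \<sigma>z z\<delta>])
      show "z \<in> \<Omega>" using z(1) by simp
      show "u z > g (?d z - \<sigma>)" using zx c(1) by simp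
      fix y assume y: "y \<in> \<Omega>" "\<sigma> < ?d y" "?d y < \<delta>"
      show "u y - g (?d y - \<sigma>) \<le> u z - g (?d z - \<sigma>)"
      proof (cases "s \<le> ?d y")
        case True
        then show ?thesis using z(2)[of y] y by simp
      next
        case False
        then show ?thesis using out[of y] y zx c(1) by simp
      qed
    qed
  qed
  have "u x \<le> g (?d x) + c" if x: "x \<in> \<Omega>" "?d x < \<delta>" for x
  proof -
    have dx: "?d x > 0" by (rule dist_bd_pos[OF \<Omega>(1) fne x(1)])
    have "continuous_on {0<..<\<delta>} g" by (rule continuous_on_subset[OF g(1)]) auto
    then have "isCont g (?d x)" using dx x(2) by (simp add: continuous_on_eq_continuous_at)
    moreover have "((\<lambda>\<sigma>. ?d x - \<sigma>) \<longlongrightarrow> ?d x) (at_right 0)" by (auto intro!: tendsto_eq_intros)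
    ultimately have "((\<lambda>\<sigma>. g (?d x - \<sigma>)) \<longlongrightarrow> g (?d x)) (at_right 0)" by (rule isCont_tendsto_compose)
    then have "((\<lambda>\<sigma>. g (?d x - \<sigma>) + c) \<longlongrightarrow> g (?d x) + c) (at_right 0)" by (intro tendsto_intros)
    moreover have "\<forall>\<^sub>F \<sigma> in at_right 0. u x \<le> g (?d x - \<sigma>) + c"
      unfolding eventually_at_right_field using main[OF x] dx by blast
    ultimately show ?thesis by (intro tendsto_lowerbound) auto
  qed
  then show ?thesis by blast
qed

text \<open>Shifting outwards keeps the barrier at most \<open>g \<sigma>\<close> up to the
  boundary, where \<open>u\<close> blows up; at the level \<open>\<delta>\<close> positivity of
  \<open>u\<close> and monotonicity of \<open>g\<close> bound the difference below by
  \<open>- g \<delta>\<close>. The shifted argument reaches almost \<open>2 * \<delta>\<close>,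
  hence the larger domain for \<open>g\<close>.\<close>

lemma lower_barrier:
  fixes u :: "real^'n \<Rightarrow> real" and g :: "real \<Rightarrow> real"
  assumes \<Omega>: "open \<Omega>" "bounded \<Omega>" "\<Omega> \<noteq> {}" and u: "continuous_on \<Omega> u" and \<delta>: "\<delta> > 0"
    and upos: "\<And>x. x \<in> \<Omega> \<Longrightarrow> u x > 0"
    and utop: "\<And>Z. \<exists>\<delta>'>0. \<forall>y\<in>\<Omega>. dist_bd \<Omega> y < \<delta>' \<longrightarrow> u y > Z"
    and g: "continuous_on {0<..<2 * \<delta>} g" "\<And>t. 0 < t \<Longrightarrow> t < 2 * \<delta> \<Longrightarrow> g t > 0"
      "\<And>s t. 0 < s \<Longrightarrow> s \<le> t \<Longrightarrow> t < 2 * \<delta> \<Longrightarrow> g t \<le> g s"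
    and touch: "\<And>\<sigma> z. 0 < \<sigma> \<Longrightarrow> \<sigma> < \<delta> \<Longrightarrow> z \<in> \<Omega> \<Longrightarrow> dist_bd \<Omega> z < \<delta> \<Longrightarrow> u z < g (dist_bd \<Omega> z + \<sigma>) \<Longrightarrow>
       (\<And>y. y \<in> \<Omega> \<Longrightarrow> dist_bd \<Omega> y < \<delta> \<Longrightarrow>
          u y - g (dist_bd \<Omega> y + \<sigma>) \<ge> u z - g (dist_bd \<Omega> z + \<sigma>)) \<Longrightarrow> False"
  shows "\<exists>c. \<forall>x\<in>\<Omega>. dist_bd \<Omega> x < \<delta> \<longrightarrow> u x \<ge> g (dist_bd \<Omega> x) - c"
proof -
  let ?d = "dist_bd \<Omega>"
  define c where "c = g \<delta>"
  have c: "c > 0" using g(2) \<delta> by (simp add: c_def)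
  have fne: "frontier \<Omega> \<noteq> {}" using \<Omega> frontier_bounded_nonempty by blast
  note dpos = dist_bd_pos[OF \<Omega>(1) fne]
  have main: "u x \<ge> g (?d x + \<sigma>) - c" if x: "x \<in> \<Omega>" "?d x < \<delta>" and \<sigma>: "0 < \<sigma>" "\<sigma> < \<delta>" for x \<sigma>
  proof (rule ccontr)
    assume "\<not> u x \<ge> g (?d x + \<sigma>) - c"
    then have neg: "u x - g (?d x + \<sigma>) < - c" by simp
    obtain s where s: "s > 0" "\<And>y. y \<in> \<Omega> \<Longrightarrow> ?d y < s \<Longrightarrow> u y > g \<sigma>" using utop by blast
    have out: "u y - g (?d y + \<sigma>) > 0" if "y \<in> \<Omega>" "?d y < s" "?d y \<le> \<delta>" for y
    proof -
      have "g (?d y + \<sigma>) \<le> g \<sigma>" using that \<sigma> dpos[of y] by (intro g(3)) auto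
      moreover have "u y > g \<sigma>" using that s(2) by simp
      ultimately show ?thesis by simp
    qed
    have xs: "s \<le> ?d x"
    proof (rule ccontr)
      assume "\<not> s \<le> ?d x"
      then have "u x - g (?d x + \<sigma>) > 0" using x by (intro out[OF x(1)]) auto
      then show False using neg c by linarith
    qed
    let ?D = "{y \<in> \<Omega>. s \<le> ?d y \<and> ?d y \<le> \<delta>}"
    have "compact ?D" by (intro compact_dist_bd_strip \<Omega> s)
    moreover have "x \<in> ?D" using x xs by simp
    then have "?D \<noteq> {}" by blast
    moreover have "continuous_on ?D (\<lambda>y. u y - g (?d y + \<sigma>))"
    proof (intro continuous_intros)
      show "continuous_on ?D u" by (rule continuous_on_subset[OF u]) auto
      show "continuous_on ?D (\<lambda>y. g (?d y + \<sigma>))"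
        by (rule continuous_on_compose2[OF g(1)]) (use \<sigma> s in \<open>auto intro!: continuous_intros continuous_on_dist_bd\<close>)
    qed
    ultimately obtain z where z: "z \<in> ?D" "\<And>y. y \<in> ?D \<Longrightarrow> u y - g (?d y + \<sigma>) \<ge> u z - g (?d z + \<sigma>)"
      using continuous_attains_inf[of ?D "\<lambda>y. u y - g (?d y + \<sigma>)"] by blast
    have zx: "u z - g (?d z + \<sigma>) < - c" using z(2)[OF \<open>x \<in> ?D\<close>] neg by simp
    have "?d z \<noteq> \<delta>"
    proof
      assume dz: "?d z = \<delta>"
      have "g (\<delta> + \<sigma>) \<le> c" unfolding c_def using \<sigma> \<delta> by (intro g(3)) auto
      then show False using zx upos[of z] z(1) dz by simp
    qed
    then have z\<delta>: "?d z < \<delta>" using z(1) by simp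
    show False
    proof (rule touch[OF \<sigma> _ z\<delta>])
      show "z \<in> \<Omega>" using z(1) by simp
      show "u z < g (?d z + \<sigma>)" using zx c by simp
      fix y assume y: "y \<in> \<Omega>" "?d y < \<delta>"
      show "u y - g (?d y + \<sigma>) \<ge> u z - g (?d z + \<sigma>)"
      proof (cases "s \<le> ?d y")
        case True
        then show ?thesis using z(2)[of y] y by simp
      next
        case False
        then show ?thesis using out[of y] y zx c by simp
      qed
    qed
  qed
  have "u x \<ge> g (?d x) - c" if x: "x \<in> \<Omega>" "?d x < \<delta>" for x
  proof -
    have dx: "?d x > 0" by (rule dpos[OF x(1)])
    have "isCont g (?d x)" using g(1) dx x(2) \<delta> by (simp add: continuous_on_eq_continuous_at)
    moreover have "((\<lambda>\<sigma>. ?d x + \<sigma>) \<longlongrightarrow> ?d x) (at_right 0)" by (auto intro!: tendsto_eq_intros)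
    ultimately have "((\<lambda>\<sigma>. g (?d x + \<sigma>)) \<longlongrightarrow> g (?d x)) (at_right 0)" by (rule isCont_tendsto_compose)
    then have "((\<lambda>\<sigma>. g (?d x + \<sigma>) - c) \<longlongrightarrow> g (?d x) - c) (at_right 0)" by (intro tendsto_intros)
    moreover have "\<forall>\<^sub>F \<sigma> in at_right 0. u x \<ge> g (?d x + \<sigma>) - c"
      unfolding eventually_at_right_field using main[OF x] \<delta> by blast
    ultimately show ?thesis by (intro tendsto_upperbound) auto
  qed
  then show ?thesis by blast
qed

section \<open>Boundary behaviour of large solutions\<close>

text \<open>The distance is positive on the open set, so the one-sided limit becomes a plain strip
  condition.\<close>

lemma eventually_bd_filter:
  assumes "open \<Omega>" "frontier \<Omega> \<noteq> {}"
  shows "eventually P (bd_filter \<Omega>) \<longleftrightarrow> (\<exists>\<delta>>0. \<forall>x\<in>\<Omega>. dist_bd \<Omega> x < \<delta> \<longrightarrow> P x)"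
proof
  assume "eventually P (bd_filter \<Omega>)"
  then have "eventually (\<lambda>x. x \<in> \<Omega> \<longrightarrow> P x) (filtercomap (dist_bd \<Omega>) (at_right 0))"
    unfolding bd_filter_def by (simp add: inf_commute[of "principal \<Omega>"] eventually_inf_principal)
  then obtain Q where Q: "eventually Q (at_right 0)" "\<And>x. Q (dist_bd \<Omega> x) \<Longrightarrow> x \<in> \<Omega> \<longrightarrow> P x"
    unfolding eventually_filtercomap by blast
  then obtain \<delta> where "\<delta> > 0" "\<And>t. 0 < t \<Longrightarrow> t < \<delta> \<Longrightarrow> Q t"
    unfolding eventually_at_right_field by auto
  then show "\<exists>\<delta>>0. \<forall>x\<in>\<Omega>. dist_bd \<Omega> x < \<delta> \<longrightarrow> P x"
    using Q(2) dist_bd_pos[OF assms] by blast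
next
  assume "\<exists>\<delta>>0. \<forall>x\<in>\<Omega>. dist_bd \<Omega> x < \<delta> \<longrightarrow> P x"
  then obtain \<delta> where \<delta>: "\<delta> > 0" "\<And>x. x \<in> \<Omega> \<Longrightarrow> dist_bd \<Omega> x < \<delta> \<Longrightarrow> P x" by blast
  have "eventually (\<lambda>t. t < \<delta>) (at_right 0)"
    using \<delta>(1) unfolding eventually_at_right_field by blast
  then have "eventually (\<lambda>x. x \<in> \<Omega> \<longrightarrow> P x) (filtercomap (dist_bd \<Omega>) (at_right 0))"
    unfolding eventually_filtercomap using \<delta>(2) by blast
  then show "eventually P (bd_filter \<Omega>)"
    unfolding bd_filter_def by (simp add: inf_commute[of "principal \<Omega>"] eventually_inf_principal)
qed

lemma abs_dist_bd_diff_le: "\<bar>dist_bd \<Omega> (z + h) - dist_bd \<Omega> z\<bar> \<le> norm h"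
proof -
  have "infdist x A \<le> infdist y A + norm (x - y)" for x y :: "real^'n" and A
    using infdist_triangle[of x A y] by (simp add: dist_norm)
  from this[of "z + h" "frontier \<Omega>" z] this[of z "frontier \<Omega>" "z + h"]
  show ?thesis unfolding dist_bd_def by simp
qed

lemma transpose_radial_hessian:
  fixes C :: "real^'n^'n"
  assumes "transpose C = C"
  shows "transpose (a *\<^sub>R outer \<nu> + c *\<^sub>R (C + \<eta> *\<^sub>R tproj \<nu>)) = a *\<^sub>R outer \<nu> + c *\<^sub>R (C + \<eta> *\<^sub>R tproj \<nu>)"
proof -
  have "transpose (a *\<^sub>R X + c *\<^sub>R (Y + \<eta> *\<^sub>R Z)) = a *\<^sub>R transpose X + c *\<^sub>R (transpose Y + \<eta> *\<^sub>R transpose Z)"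
    for X Y Z :: "real^'n^'n"
    by (simp add: transpose_def vec_eq_iff)
  from this[of "outer \<nu>" C "tproj \<nu>"] show ?thesis by (simp add: assms)
qed

section \<open>Barrier estimates for a large solution\<close>

locale large_solution = blowup_profile k f Cf m M \<delta>0 Cm
  for k f Cf m M \<delta>0 Cm +
  fixes \<Omega> :: "(real^'n) set" and b u :: "real^'n \<Rightarrow> real" and bl bu :: real
  assumes dom: "open \<Omega>" "bounded \<Omega>" "\<Omega> \<noteq> {}"
    and conv: "strictly_convex_k (k - 1) \<Omega>" and bdry: "C31_boundary \<Omega>"
    and b_pos: "bl > 0" "bu > 0"
    and b_inf: "Liminf (bd_filter \<Omega>) (\<lambda>x. ereal (b x / m (dist_bd \<Omega> x) ^ (k + 1))) = ereal bl"
    and b_sup: "Limsup (bd_filter \<Omega>) (\<lambda>x. ereal (b x / m (dist_bd \<Omega> x) ^ (k + 1))) = ereal bu"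
    and Cfm: "Cf > 1 - Cm"
    and u_pos: "\<forall>x\<in>\<Omega>. u x > 0"
    and u_sol: "visc_sol k b f \<Omega> u"
    and u_bd: "filterlim u at_top (bd_filter \<Omega>)"
begin

abbreviation "d \<equiv> dist_bd \<Omega>"

definition "\<theta> = 1 - (1 - Cm) / Cf"

lemma \<theta>_pos: "\<theta> > 0"
  using Cfm f3(1) by (simp add: \<theta>_def field_simps)

lemma fne: "frontier \<Omega> \<noteq> {}"
  using dom frontier_bounded_nonempty by blast

lemma d_pos: "x \<in> \<Omega> \<Longrightarrow> d x > 0"
  by (rule dist_bd_pos[OF dom(1) fne])

lemmas ev_bd = eventually_bd_filter[OF dom(1) fne]

lemma u_sub: "visc_sub k b f \<Omega> u" and u_super: "visc_super k b f \<Omega> u"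
  using u_sol by (simp_all add: visc_sol_def)

lemma u_cont: "continuous_on \<Omega> u"
  using u_sol by (simp add: visc_sol_def visc_sub_def)

lemma b_lower:
  assumes "\<kappa> > 0"
  shows "\<exists>\<delta>>0. \<forall>x\<in>\<Omega>. d x < \<delta> \<longrightarrow> (bl - \<kappa>) * m (d x) ^ (k + 1) < b x"
proof -
  have "ereal bl \<le> Liminf (bd_filter \<Omega>) (\<lambda>x. ereal (b x / m (d x) ^ (k + 1)))" by (simp only: b_inf)
  then have "\<forall>\<^sub>F x in bd_filter \<Omega>. ereal (bl - \<kappa>) < ereal (b x / m (d x) ^ (k + 1))"
    unfolding le_Liminf_iff by (rule allE[of _ "ereal (bl - \<kappa>)"]) (use assms in simp)
  then obtain \<delta> where \<delta>: "\<delta> > 0" "\<And>x. x \<in> \<Omega> \<Longrightarrow> d x < \<delta> \<Longrightarrow> bl - \<kappa> < b x / m (d x) ^ (k + 1)"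
    unfolding ev_bd by auto
  have "(bl - \<kappa>) * m (d x) ^ (k + 1) < b x" if "x \<in> \<Omega>" "d x < min \<delta> \<delta>0" for x
  proof -
    have "m (d x) ^ (k + 1) > 0" using m_pos[OF d_pos[OF that(1)]] that(2) by simp
    then show ?thesis using \<delta>(2)[OF that(1)] that(2) by (simp add: less_divide_eq)
  qed
  then show ?thesis using \<delta>(1) m1(1) by (intro exI[of _ "min \<delta> \<delta>0"]) simp
qed

lemma b_upper:
  assumes "\<kappa> > 0"
  shows "\<exists>\<delta>>0. \<forall>x\<in>\<Omega>. d x < \<delta> \<longrightarrow> b x < (bu + \<kappa>) * m (d x) ^ (k + 1)"
proof -
  have "Limsup (bd_filter \<Omega>) (\<lambda>x. ereal (b x / m (d x) ^ (k + 1))) \<le> ereal bu" by (simp only: b_sup)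
  then have "\<forall>\<^sub>F x in bd_filter \<Omega>. ereal (b x / m (d x) ^ (k + 1)) < ereal (bu + \<kappa>)"
    unfolding Limsup_le_iff by (rule allE[of _ "ereal (bu + \<kappa>)"]) (use assms in simp)
  then obtain \<delta> where \<delta>: "\<delta> > 0" "\<And>x. x \<in> \<Omega> \<Longrightarrow> d x < \<delta> \<Longrightarrow> b x / m (d x) ^ (k + 1) < bu + \<kappa>"
    unfolding ev_bd by auto
  have "b x < (bu + \<kappa>) * m (d x) ^ (k + 1)" if "x \<in> \<Omega>" "d x < min \<delta> \<delta>0" for x
  proof -
    have "m (d x) ^ (k + 1) > 0" using m_pos[OF d_pos[OF that(1)]] that(2) by simp
    then show ?thesis using \<delta>(2)[OF that(1)] that(2) by (simp add: divide_less_eq)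
  qed
  then show ?thesis using \<delta>(1) m1(1) by (intro exI[of _ "min \<delta> \<delta>0"]) simp
qed

text \<open>Continuity of \<open>C\<close> on the compact boundary turns the pointwise curvature
  positivity into a uniform \<open>c0\<close>, with the order 0 function equal to 1. It also makes
  the curvature function bounded, so that \<open>L0\<close> and \<open>l0\<close> are a genuine
  supremum and infimum of reals.\<close>

lemma frame: "\<exists>\<nu> C K c0. boundary_frame \<Omega> \<nu> C \<and> 0 < c0 \<and> c0 \<le> 1 \<and>
    (\<forall>p\<in>frontier \<Omega>. norm (C p) \<le> K \<and> (\<forall>j<k. c0 \<le> csig j (C p)) \<and>
       csig (k - 1) (C p) \<le> L0 k \<Omega> \<and> l0 k \<Omega> \<le> csig (k - 1) (C p))"
  and l0_pos: "l0 k \<Omega> > 0" and L0_pos: "L0 k \<Omega> > 0"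
proof -
  obtain \<nu> C where fr: "boundary_frame \<Omega> \<nu> C" using boundary_frame_exists[OF bdry] by blast
  have comp: "compact (frontier \<Omega>)" using dom by (simp add: compact_frontier_bounded)
  have cC: "continuous_on (frontier \<Omega>) C" by (rule boundary_frame_continuous[OF dom(1) fr])
  have cs: "curv_sigma \<Omega> j p = csig j (C p)" if "p \<in> frontier \<Omega>" for j p
    using fr that by (simp add: boundary_frame_def)
  have "bounded (C ` frontier \<Omega>)" by (intro compact_imp_bounded compact_continuous_image cC comp)
  then obtain K where K: "\<And>p. p \<in> frontier \<Omega> \<Longrightarrow> norm (C p) \<le> K" unfolding bounded_iff by auto
  have cj: "continuous_on (frontier \<Omega>) (\<lambda>p. csig j (C p))" for j
    by (rule continuous_on_compose2[OF continuous_on_csig cC]) auto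
  have minj: "\<exists>c>0. \<forall>p\<in>frontier \<Omega>. csig j (C p) \<ge> c" if j: "j < k" for j
  proof -
    obtain p where p: "p \<in> frontier \<Omega>" "\<And>q. q \<in> frontier \<Omega> \<Longrightarrow> csig j (C p) \<le> csig j (C q)"
      using continuous_attains_inf[OF comp fne cj] by blast
    have "csig j (C p) > 0"
    proof (cases "j = 0")
      case False
      then have "curv_sigma \<Omega> j p > 0" using conv p(1) j unfolding strictly_convex_k_def by auto
      then show ?thesis using cs[OF p(1)] by simp
    qed simp
    then show ?thesis using p(2) by blast
  qed
  then have "\<forall>j. \<exists>c. j < k \<longrightarrow> c > 0 \<and> (\<forall>p\<in>frontier \<Omega>. csig j (C p) \<ge> c)" by blast
  then obtain c where c: "\<And>j. j < k \<Longrightarrow> c j > 0" "\<And>j p. j < k \<Longrightarrow> p \<in> frontier \<Omega> \<Longrightarrow> csig j (C p) \<ge> c j" by metis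
  define c0 where "c0 = min 1 (Min (c ` {..<k}))"
  have kne: "{..<k} \<noteq> {}" using k1 by (metis lessThan_empty_iff bot_nat_def not_one_le_zero)
  have c0: "0 < c0" "c0 \<le> 1" using c(1) kne by (auto simp: c0_def)
  have c0': "csig j (C p) \<ge> c0" if "p \<in> frontier \<Omega>" "j < k" for p j
  proof -
    have "Min (c ` {..<k}) \<le> c j" using that by (intro Min_le) auto
    then show ?thesis using c(2)[OF that(2,1)] by (simp add: c0_def)
  qed
  have im: "(curv_sigma \<Omega> (k - 1)) ` frontier \<Omega> = (\<lambda>p. csig (k - 1) (C p)) ` frontier \<Omega>"
    using cs by (intro image_cong) auto
  have bdd: "bounded ((\<lambda>p. csig (k - 1) (C p)) ` frontier \<Omega>)"
    by (intro compact_imp_bounded compact_continuous_image cj comp)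
  have L: "csig (k - 1) (C p) \<le> L0 k \<Omega>" if "p \<in> frontier \<Omega>" for p
    unfolding L0_def im by (rule cSUP_upper[OF that bounded_imp_bdd_above[OF bdd]])
  have l: "csig (k - 1) (C p) \<ge> l0 k \<Omega>" if "p \<in> frontier \<Omega>" for p
    unfolding l0_def im by (rule cINF_lower[OF bounded_imp_bdd_below[OF bdd] that])
  have "c0 \<le> l0 k \<Omega>"
    unfolding l0_def im by (rule cINF_greatest[OF fne]) (use c0' k1 in auto)
  then show lpos: "l0 k \<Omega> > 0" using c0 by simp
  obtain p where "p \<in> frontier \<Omega>" using fne by blast
  then show "L0 k \<Omega> > 0" using L[of p] l[of p] lpos by linarith
  show "\<exists>\<nu> C K c0. boundary_frame \<Omega> \<nu> C \<and> 0 < c0 \<and> c0 \<le> 1 \<and>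
    (\<forall>p\<in>frontier \<Omega>. norm (C p) \<le> K \<and> (\<forall>j<k. c0 \<le> csig j (C p)) \<and>
       csig (k - 1) (C p) \<le> L0 k \<Omega> \<and> l0 k \<Omega> \<le> csig (k - 1) (C p))"
    by (rule exI[of _ \<nu>], rule exI[of _ C], rule exI[of _ K], rule exI[of _ c0]) (use fr K c0 c0' L l in simp)
qed

text \<open>At a positive maximum \<open>z\<close> of the difference, with
  \<open>t = d z - \<sigma>\<close>, the subsolution inequality bounds \<open>b z * f (u z)\<close>
  by a quantity below \<open>(bl - \<kappa>) * m t ^ (k + 1) * f (g t)\<close>. Since
  \<open>t \<le> d z\<close> and \<open>g t < u z\<close>, monotonicity of \<open>m\<close> and
  \<open>f\<close> brings this below \<open>b z * f (u z)\<close> again.\<close>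

lemma upper_estimate:
  assumes \<xi>: "\<xi> > 0" "\<xi> ^ (k + 1) * (\<theta> * L0 k \<Omega>) < bl"
  shows "\<exists>c. \<exists>\<delta>>0. \<forall>x\<in>\<Omega>. d x < \<delta> \<longrightarrow> u x \<le> varphi k f (\<xi> * M (d x)) + c"
proof -
  obtain \<nu> C K c0 where fr: "boundary_frame \<Omega> \<nu> C" and K: "\<And>p. p \<in> frontier \<Omega> \<Longrightarrow> norm (C p) \<le> K"
    and c0: "0 < c0" "c0 \<le> 1" "\<And>p j. p \<in> frontier \<Omega> \<Longrightarrow> j < k \<Longrightarrow> csig j (C p) \<ge> c0"
    and L: "\<And>p. p \<in> frontier \<Omega> \<Longrightarrow> csig (k - 1) (C p) \<le> L0 k \<Omega>"
    using frame by blast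
  define q where "q = \<xi> ^ (k + 1)"
  have q: "q > 0" using \<xi> by (simp add: q_def)
  \<comment> \<open>One tolerance for both errors, that of the Hessian, multiplied by
    \<open>q\<close>, and that of \<open>b\<close>; together they use half of the available
    gap.\<close>
  define \<kappa> where "\<kappa> = (bl - q * (\<theta> * L0 k \<Omega>)) / (2 * (q + 1))"
  have \<kappa>: "\<kappa> > 0" using \<xi>(2) q by (simp add: \<kappa>_def q_def)
  have gap: "q * (\<theta> * L0 k \<Omega> + \<kappa>) < bl - \<kappa>"
  proof -
    have "(q + 1) * \<kappa> = (bl - q * (\<theta> * L0 k \<Omega>)) / 2" using q by (simp add: \<kappa>_def field_simps)
    moreover have "bl - q * (\<theta> * L0 k \<Omega>) > 0" using \<xi>(2) by (simp add: q_def)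
    ultimately show ?thesis by (simp add: algebra_simps)
  qed
  obtain \<eta>0 \<epsilon> where \<eta>0: "\<eta>0 > 0" and \<epsilon>: "\<epsilon> > 0" and rad: "\<And>\<eta> (\<nu>::real^'n) C E e lam. \<bar>\<eta>\<bar> < \<eta>0 \<Longrightarrow> norm \<nu> = 1 \<Longrightarrow> norm C \<le> K \<Longrightarrow>
    C *v \<nu> = 0 \<Longrightarrow> (\<forall>j<k. csig j C \<ge> c0) \<Longrightarrow> \<bar>E - \<theta>\<bar> < \<epsilon> \<Longrightarrow> 0 < e \<Longrightarrow> e < \<epsilon> \<Longrightarrow> lam > 0 \<Longrightarrow>
    (\<forall>j\<in>{1..k}. csig j ((lam * E) *\<^sub>R outer \<nu> + (lam * e) *\<^sub>R (C + \<eta> *\<^sub>R tproj \<nu>)) > 0) \<and>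
    \<bar>csig k ((lam * E) *\<^sub>R outer \<nu> + (lam * e) *\<^sub>R (C + \<eta> *\<^sub>R tproj \<nu>)) - lam ^ k * e ^ (k - 1) * (\<theta> * csig (k - 1) C)\<bar>
      \<le> lam ^ k * e ^ (k - 1) * \<kappa>"
    using radial_hessian_estimate[OF k1 \<theta>_pos c0(1,2) \<kappa>, where K=K] by blast
  define \<eta> where "\<eta> = \<eta>0 / 2"
  have \<eta>: "\<eta> > 0" "\<bar>\<eta>\<bar> < \<eta>0" using \<eta>0 by (auto simp: \<eta>_def)
  obtain \<delta>1 where \<delta>1: "\<delta>1 > 0" "\<And>x. x \<in> \<Omega> \<Longrightarrow> d x < \<delta>1 \<Longrightarrow> \<exists>p\<in>frontier \<Omega>. \<exists>r>0. \<forall>h. norm h < r \<longrightarrow>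
     d (x + h) \<ge> d x + \<nu> p \<bullet> h - (h \<bullet> (C p *v h) + \<eta> * (h \<bullet> (tproj (\<nu> p) *v h))) / 2"
    using dist_bd_second_order[OF dom fr \<eta>(1) K] by meson
  define g where "g = (\<lambda>t. varphi k f (\<xi> * M t))"
  obtain t0 lam e E where t0: "0 < t0" "t0 \<le> \<delta>0" and P: "\<And>t. 0 < t \<Longrightarrow> t < t0 \<Longrightarrow>
      g t > 0 \<and> (g has_real_derivative - (lam t * e t)) (at t) \<and>
      ((\<lambda>t. - (lam t * e t)) has_real_derivative lam t * E t) (at t) \<and>
      lam t > 0 \<and> e t > 0 \<and> lam t ^ k * e t ^ (k - 1) = \<xi> ^ (k + 1) * m t ^ (k + 1) * f (g t)"
    and lims: "(e \<longlongrightarrow> 0) (at_right 0)" "(E \<longlongrightarrow> \<theta>) (at_right 0)" "filterlim g at_top (at_right 0)"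
    using profile[OF \<xi>(1)] unfolding g_def \<theta>_def by blast
  have "\<forall>\<^sub>F t in at_right 0. e t < \<epsilon> \<and> \<bar>E t - \<theta>\<bar> < \<epsilon>"
    using order_tendstoD(2)[OF lims(1) \<epsilon>] tendstoD[OF lims(2) \<epsilon>]
    by eventually_elim (simp add: dist_real_def)
  then obtain t1 where t1: "t1 > 0" "\<And>t. 0 < t \<Longrightarrow> t < t1 \<Longrightarrow> e t < \<epsilon> \<and> \<bar>E t - \<theta>\<bar> < \<epsilon>"
    unfolding eventually_at_right_field by auto
  obtain \<delta>2 where \<delta>2: "\<delta>2 > 0" "\<And>x. x \<in> \<Omega> \<Longrightarrow> d x < \<delta>2 \<Longrightarrow> (bl - \<kappa>) * m (d x) ^ (k + 1) < b x"
    using b_lower[OF \<kappa>] by blast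
  \<comment> \<open>Halving \<open>t0\<close> keeps the closed endpoint \<open>\<delta>\<close>
    inside the interval where the profile is differentiable.\<close>
  define \<delta> where "\<delta> = min (min \<delta>1 \<delta>2) (min (t0 / 2) t1)"
  have \<delta>: "\<delta> > 0" "\<delta> \<le> \<delta>1" "\<delta> \<le> \<delta>2" "\<delta> < t0" "\<delta> \<le> t1" using \<delta>1 \<delta>2 t0 t1 by (auto simp: \<delta>_def)
  have anti: "g t \<le> g s" if "0 < s" "s \<le> t" "t < t0" for s t
  proof (rule DERIV_nonpos_imp_nonincreasing[OF that(2)])
    fix x assume "s \<le> x" "x \<le> t"
    then have "0 < x" "x < t0" using that by auto
    from P[OF this] show "\<exists>y. (g has_real_derivative y) (at x) \<and> y \<le> 0"
      by (intro exI[of _ "- (lam x * e x)"]) simp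
  qed
  have "\<exists>c. \<forall>x\<in>\<Omega>. d x < \<delta> \<longrightarrow> u x \<le> g (d x) + c"
  proof (rule upper_barrier[OF dom u_cont \<delta>(1) _ _ lims(3)])
    show "continuous_on {0<..\<delta>} g"
      by (rule continuous_at_imp_continuous_on) (use P \<delta> in \<open>force intro: DERIV_isCont\<close>)
    show "g t > 0" if "0 < t" "t \<le> \<delta>" for t using P[of t] that \<delta> by simp
  next
    fix \<sigma> z assume \<sigma>: "0 < \<sigma>" and z: "z \<in> \<Omega>" "\<sigma> < d z" "d z < \<delta>" "u z > g (d z - \<sigma>)"
      and mx: "\<And>y. y \<in> \<Omega> \<Longrightarrow> \<sigma> < d y \<Longrightarrow> d y < \<delta> \<Longrightarrow> u y - g (d y - \<sigma>) \<le> u z - g (d z - \<sigma>)"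
    define t where "t = d z - \<sigma>"
    have t: "0 < t" "t < \<delta>" "t < t0" "t < t1" "t \<le> d z" using z \<sigma> \<delta> by (auto simp: t_def)
    note Pt = P[OF t(1,3)]
    then have "lam t > 0" "e t > 0" by auto
    then have w: "lam t ^ k * e t ^ (k - 1) \<ge> 0" by simp
    obtain p r where p: "p \<in> frontier \<Omega>" and r: "r > 0" "\<And>h. norm h < r \<Longrightarrow>
       d (z + h) \<ge> d z + \<nu> p \<bullet> h - (h \<bullet> (C p *v h) + \<eta> * (h \<bullet> (tproj (\<nu> p) *v h))) / 2"
      using \<delta>1(2)[OF z(1)] z(3) \<delta>(2) by force
    have fp: "norm (\<nu> p) = 1" "transpose (C p) = C p" "C p *v \<nu> p = 0"
      using fr p by (auto simp: boundary_frame_def)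
    define B where "B = C p + \<eta> *\<^sub>R tproj (\<nu> p)"
    define A where "A = (lam t * E t) *\<^sub>R outer (\<nu> p) + (lam t * e t) *\<^sub>R B"
    have symA: "transpose A = A" unfolding A_def B_def by (rule transpose_radial_hessian[OF fp(2)])
    have radA: "(\<forall>j\<in>{1..k}. csig j A > 0)"
      "\<bar>csig k A - lam t ^ k * e t ^ (k - 1) * (\<theta> * csig (k - 1) (C p))\<bar> \<le> lam t ^ k * e t ^ (k - 1) * \<kappa>"
      using rad[OF \<eta>(2) fp(1) K[OF p] fp(3), of "E t" "e t" "lam t"] c0(3)[OF p] t1(2)[OF t(1,4)] Pt
      unfolding A_def B_def by blast+
    have "b z * f (u z) \<le> csig k A"
    proof (rule visc_sub_jet[OF dom(1) z(1) u_sub symA])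
      show "csig j A > 0" if "j \<in> {1..k}" for j using radA(1) that by blast
      fix \<eta>' :: real assume \<eta>': "\<eta>' > 0"
      define \<rho> where "\<rho> = min t (t0 - t)"
      have \<rho>: "\<rho> > 0" using t by (simp add: \<rho>_def)
      have in0: "0 < s \<and> s < t0" if "\<bar>s - t\<bar> < \<rho>" for s using that by (auto simp: \<rho>_def abs_less_iff)
      obtain r2 where r2: "r2 > 0" "\<And>h. norm h < r2 \<Longrightarrow> \<bar>\<nu> p \<bullet> h - (h \<bullet> (B *v h)) / 2\<bar> < \<rho> \<and>
          \<bar>g (t + (\<nu> p \<bullet> h - (h \<bullet> (B *v h)) / 2)) - g t - ((- (lam t * e t)) *\<^sub>R \<nu> p) \<bullet> h
            - (h \<bullet> (((lam t * E t) *\<^sub>R outer (\<nu> p) - (- (lam t * e t)) *\<^sub>R B) *v h)) / 2\<bar> \<le> \<eta>' * (h \<bullet> h) / 2"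
        using composite_second_order[OF \<rho> _ _ fp(1) \<eta>', of t g "\<lambda>t. - (lam t * e t)" "lam t * E t" B] P in0 Pt by blast
      have Aeq: "(lam t * E t) *\<^sub>R outer (\<nu> p) - (- (lam t * e t)) *\<^sub>R B = A" by (simp add: A_def)
      obtain r3 where r3: "r3 > 0" "ball z r3 \<subseteq> \<Omega>" using dom(1) z(1) open_contains_ball by blast
      define r' where "r' = min (min r r2) (min r3 (min t (\<delta> - d z)))"
      have r': "r' > 0" "r' \<le> r" "r' \<le> r2" "r' \<le> r3" "r' \<le> t" "r' \<le> \<delta> - d z" using r r2 r3 t z(3) by (auto simp: r'_def)
      show "\<exists>r>0. \<forall>h. norm h < r \<longrightarrow> u (z + h) \<le> u z + ((- (lam t * e t)) *\<^sub>R \<nu> p) \<bullet> h + (h \<bullet> (A *v h) + \<eta>' * (h \<bullet> h)) / 2"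
      proof (intro exI[of _ r'] conjI allI impI r'(1))
        fix h :: "real^'n" assume h: "norm h < r'"
        define l where "l = \<nu> p \<bullet> h - (h \<bullet> (B *v h)) / 2"
        have "norm h < r2" using h r'(3) by linarith
        note exp = r2(2)[OF this, unfolded Aeq, folded l_def]
        then have lr: "\<bar>l\<bar> < \<rho>" by simp
        from exp have ex: "g (t + l) \<le> g t + ((- (lam t * e t)) *\<^sub>R \<nu> p) \<bullet> h + (h \<bullet> (A *v h) + \<eta>' * (h \<bullet> h)) / 2"
          unfolding abs_le_iff add_divide_distrib by linarith
        have "z + h \<in> ball z r3" using h r'(4) by (simp add: dist_norm)
        then have zh: "z + h \<in> \<Omega>" using r3 by blast
        have dd: "\<bar>d (z + h) - d z\<bar> < r'" using abs_dist_bd_diff_le[of \<Omega> z h] h by linarith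
        \<comment> \<open>The profile decreases, so the lower bound for \<open>d\<close> is the one
          that yields an upper jet for \<open>u\<close>; its margin \<open>\<eta>\<close> appears in
          \<open>B\<close> with a plus sign.\<close>
        have dl: "d (z + h) \<ge> d z + l"
          using r(2)[of h] h r'(2) unfolding l_def B_def
          by (simp add: matrix_vector_mult_add_rdistrib scaleR_matrix_vector_assoc[symmetric] inner_add)
        have u1: "u (z + h) - g (d (z + h) - \<sigma>) \<le> u z - g t"
          unfolding t_def using dd r'(5,6) by (intro mx[OF zh]) (auto simp: t_def)
        have "g (d (z + h) - \<sigma>) \<le> g (t + l)"
          using in0[of "t + l"] lr dl dd r'(6) \<delta>(4) \<sigma> by (intro anti) (auto simp: t_def)
        then show "u (z + h) \<le> u z + ((- (lam t * e t)) *\<^sub>R \<nu> p) \<bullet> h + (h \<bullet> (A *v h) + \<eta>' * (h \<bullet> h)) / 2"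
          using u1 ex by linarith
      qed
    qed
    also have "csig k A \<le> lam t ^ k * e t ^ (k - 1) * (\<theta> * csig (k - 1) (C p) + \<kappa>)"
      using radA(2) by (simp add: abs_le_iff algebra_simps)
    also have "\<dots> \<le> lam t ^ k * e t ^ (k - 1) * (\<theta> * L0 k \<Omega> + \<kappa>)"
      using L[OF p] \<theta>_pos by (intro mult_left_mono add_right_mono w) auto
    also have "\<dots> = (q * (\<theta> * L0 k \<Omega> + \<kappa>)) * (m t ^ (k + 1) * f (g t))"
      using Pt by (simp add: q_def)
    also have "\<dots> < (bl - \<kappa>) * (m t ^ (k + 1) * f (g t))"
    proof (rule mult_strict_right_mono[OF gap])
      have "m t > 0" using m_pos t t0 by simp
      then show "m t ^ (k + 1) * f (g t) > 0" using f_pos Pt by simp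
    qed
    also have "\<dots> \<le> (bl - \<kappa>) * (m (d z) ^ (k + 1) * f (u z))"
    proof (rule mult_left_mono)
      have "q * (\<theta> * L0 k \<Omega> + \<kappa>) \<ge> 0"
        using q \<theta>_pos \<kappa> L0_pos by simp
      then show "bl - \<kappa> \<ge> 0" using gap by linarith
      have "m t \<le> m (d z)" using t z(3) \<delta>(4) t0 by (intro m_mono) auto
      moreover have "m t > 0" using m_pos[of t] t t0 by simp
      moreover have "f (g t) \<le> f (u z)" using z(4) Pt by (intro f_mono) (auto simp: t_def)
      moreover have "f (g t) > 0" using f_pos[of "g t"] Pt by simp
      ultimately show "m t ^ (k + 1) * f (g t) \<le> m (d z) ^ (k + 1) * f (u z)"
        by (intro mult_mono power_mono) auto
    qed
    also have "\<dots> < b z * f (u z)"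
    proof -
      have "f (u z) > 0" using f_pos u_pos z(1) by simp
      then have "(bl - \<kappa>) * m (d z) ^ (k + 1) * f (u z) < b z * f (u z)"
        using \<delta>2(2)[OF z(1)] z(3) \<delta>(3) by (intro mult_strict_right_mono) auto
      then show ?thesis by (simp add: mult.assoc)
    qed
    finally show False .
  qed
  then show ?thesis using \<delta>(1) unfolding g_def by blast
qed

text \<open>The mirror image at a negative minimum: now \<open>t = d z + \<sigma>\<close> exceeds
  \<open>d z\<close> and \<open>g t\<close> exceeds \<open>u z\<close>, so monotonicity again has
  the right direction. The upper bound for \<open>d\<close> is used, its margin enters with sign
  \<open>- \<eta>\<close>, and \<open>l0\<close> replaces \<open>L0\<close>.\<close>

lemma lower_estimate:
  assumes \<xi>: "\<xi> > 0" "\<xi> ^ (k + 1) * (\<theta> * l0 k \<Omega>) > bu"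
  shows "\<exists>c. \<exists>\<delta>>0. \<forall>x\<in>\<Omega>. d x < \<delta> \<longrightarrow> u x \<ge> varphi k f (\<xi> * M (d x)) - c"
proof -
  obtain \<nu> C K c0 where fr: "boundary_frame \<Omega> \<nu> C" and K: "\<And>p. p \<in> frontier \<Omega> \<Longrightarrow> norm (C p) \<le> K"
    and c0: "0 < c0" "c0 \<le> 1" "\<And>p j. p \<in> frontier \<Omega> \<Longrightarrow> j < k \<Longrightarrow> csig j (C p) \<ge> c0"
    and l: "\<And>p. p \<in> frontier \<Omega> \<Longrightarrow> csig (k - 1) (C p) \<ge> l0 k \<Omega>"
    using frame by blast
  define q where "q = \<xi> ^ (k + 1)"
  have q: "q > 0" using \<xi> by (simp add: q_def)
  define \<kappa> where "\<kappa> = (q * (\<theta> * l0 k \<Omega>) - bu) / (2 * (q + 1))"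
  have \<kappa>: "\<kappa> > 0" using \<xi>(2) q by (simp add: \<kappa>_def q_def)
  have gap: "bu + \<kappa> < q * (\<theta> * l0 k \<Omega> - \<kappa>)"
  proof -
    have "(q + 1) * \<kappa> = (q * (\<theta> * l0 k \<Omega>) - bu) / 2" using q by (simp add: \<kappa>_def field_simps)
    moreover have "q * (\<theta> * l0 k \<Omega>) - bu > 0" using \<xi>(2) by (simp add: q_def)
    ultimately show ?thesis by (simp add: algebra_simps)
  qed
  obtain \<eta>0 \<epsilon> where \<eta>0: "\<eta>0 > 0" and \<epsilon>: "\<epsilon> > 0" and rad: "\<And>\<eta> (\<nu>::real^'n) C E e lam. \<bar>\<eta>\<bar> < \<eta>0 \<Longrightarrow> norm \<nu> = 1 \<Longrightarrow> norm C \<le> K \<Longrightarrow>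
    C *v \<nu> = 0 \<Longrightarrow> (\<forall>j<k. csig j C \<ge> c0) \<Longrightarrow> \<bar>E - \<theta>\<bar> < \<epsilon> \<Longrightarrow> 0 < e \<Longrightarrow> e < \<epsilon> \<Longrightarrow> lam > 0 \<Longrightarrow>
    (\<forall>j\<in>{1..k}. csig j ((lam * E) *\<^sub>R outer \<nu> + (lam * e) *\<^sub>R (C + \<eta> *\<^sub>R tproj \<nu>)) > 0) \<and>
    \<bar>csig k ((lam * E) *\<^sub>R outer \<nu> + (lam * e) *\<^sub>R (C + \<eta> *\<^sub>R tproj \<nu>)) - lam ^ k * e ^ (k - 1) * (\<theta> * csig (k - 1) C)\<bar>
      \<le> lam ^ k * e ^ (k - 1) * \<kappa>"
    using radial_hessian_estimate[OF k1 \<theta>_pos c0(1,2) \<kappa>, where K=K] by blast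
  define \<eta> where "\<eta> = \<eta>0 / 2"
  have \<eta>: "\<eta> > 0" "\<bar>- \<eta>\<bar> < \<eta>0" using \<eta>0 by (auto simp: \<eta>_def)
  obtain \<delta>1 where \<delta>1: "\<delta>1 > 0" "\<And>x. x \<in> \<Omega> \<Longrightarrow> d x < \<delta>1 \<Longrightarrow> \<exists>p\<in>frontier \<Omega>. \<exists>r>0. \<forall>h. norm h < r \<longrightarrow>
     d (x + h) \<le> d x + \<nu> p \<bullet> h - (h \<bullet> (C p *v h) - \<eta> * (h \<bullet> (tproj (\<nu> p) *v h))) / 2"
    using dist_bd_second_order[OF dom fr \<eta>(1) K] by meson
  define g where "g = (\<lambda>t. varphi k f (\<xi> * M t))"
  obtain t0 lam e E where t0: "0 < t0" "t0 \<le> \<delta>0" and P: "\<And>t. 0 < t \<Longrightarrow> t < t0 \<Longrightarrow>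
      g t > 0 \<and> (g has_real_derivative - (lam t * e t)) (at t) \<and>
      ((\<lambda>t. - (lam t * e t)) has_real_derivative lam t * E t) (at t) \<and>
      lam t > 0 \<and> e t > 0 \<and> lam t ^ k * e t ^ (k - 1) = \<xi> ^ (k + 1) * m t ^ (k + 1) * f (g t)"
    and lims: "(e \<longlongrightarrow> 0) (at_right 0)" "(E \<longlongrightarrow> \<theta>) (at_right 0)" "filterlim g at_top (at_right 0)"
    using profile[OF \<xi>(1)] unfolding g_def \<theta>_def by blast
  have "\<forall>\<^sub>F t in at_right 0. e t < \<epsilon> \<and> \<bar>E t - \<theta>\<bar> < \<epsilon>"
    using order_tendstoD(2)[OF lims(1) \<epsilon>] tendstoD[OF lims(2) \<epsilon>]
    by eventually_elim (simp add: dist_real_def)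
  then obtain t1 where t1: "t1 > 0" "\<And>t. 0 < t \<Longrightarrow> t < t1 \<Longrightarrow> e t < \<epsilon> \<and> \<bar>E t - \<theta>\<bar> < \<epsilon>"
    unfolding eventually_at_right_field by auto
  obtain \<delta>2 where \<delta>2: "\<delta>2 > 0" "\<And>x. x \<in> \<Omega> \<Longrightarrow> d x < \<delta>2 \<Longrightarrow> b x < (bu + \<kappa>) * m (d x) ^ (k + 1)"
    using b_upper[OF \<kappa>] by blast
  \<comment> \<open>The shifted argument \<open>d z + \<sigma>\<close> can reach almost
    \<open>2 * \<delta>\<close>.\<close>
  define \<delta> where "\<delta> = min (min \<delta>1 \<delta>2) (min t0 t1) / 2"
  have \<delta>: "\<delta> > 0" "\<delta> \<le> \<delta>1" "\<delta> \<le> \<delta>2" "2 * \<delta> \<le> t0" "2 * \<delta> \<le> t1" using \<delta>1 \<delta>2 t0 t1 by (auto simp: \<delta>_def)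
  have anti: "g t \<le> g s" if "0 < s" "s \<le> t" "t < t0" for s t
  proof (rule DERIV_nonpos_imp_nonincreasing[OF that(2)])
    fix x assume "s \<le> x" "x \<le> t"
    then have "0 < x" "x < t0" using that by auto
    from P[OF this] show "\<exists>y. (g has_real_derivative y) (at x) \<and> y \<le> 0"
      by (intro exI[of _ "- (lam x * e x)"]) simp
  qed
  have "\<exists>c. \<forall>x\<in>\<Omega>. d x < \<delta> \<longrightarrow> u x \<ge> g (d x) - c"
  proof (rule lower_barrier[OF dom u_cont \<delta>(1)])
    show "u x > 0" if "x \<in> \<Omega>" for x using u_pos that by simp
    show "\<exists>\<delta>'>0. \<forall>y\<in>\<Omega>. d y < \<delta>' \<longrightarrow> u y > Z" for Z
      using u_bd unfolding filterlim_at_top_dense ev_bd by blast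
    show "continuous_on {0<..<2 * \<delta>} g"
      by (rule continuous_at_imp_continuous_on) (use P \<delta> in \<open>force intro: DERIV_isCont\<close>)
    show "g t > 0" if "0 < t" "t < 2 * \<delta>" for t using P[of t] that \<delta> by simp
    show "g t \<le> g s" if "0 < s" "s \<le> t" "t < 2 * \<delta>" for s t using anti that \<delta> by simp
  next
    fix \<sigma> z assume \<sigma>: "0 < \<sigma>" "\<sigma> < \<delta>" and z: "z \<in> \<Omega>" "d z < \<delta>" "u z < g (d z + \<sigma>)"
      and mx: "\<And>y. y \<in> \<Omega> \<Longrightarrow> d y < \<delta> \<Longrightarrow> u y - g (d y + \<sigma>) \<ge> u z - g (d z + \<sigma>)"
    define t where "t = d z + \<sigma>"
    have t: "0 < t" "t < 2 * \<delta>" "t < t0" "t < t1" "d z \<le> t" using z \<sigma> \<delta> d_pos[OF z(1)] by (auto simp: t_def)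
    note Pt = P[OF t(1,3)]
    then have "lam t > 0" "e t > 0" by auto
    then have w: "lam t ^ k * e t ^ (k - 1) \<ge> 0" by simp
    obtain p r where p: "p \<in> frontier \<Omega>" and r: "r > 0" "\<And>h. norm h < r \<Longrightarrow>
       d (z + h) \<le> d z + \<nu> p \<bullet> h - (h \<bullet> (C p *v h) - \<eta> * (h \<bullet> (tproj (\<nu> p) *v h))) / 2"
      using \<delta>1(2)[OF z(1)] z(2) \<delta>(2) by force
    have fp: "norm (\<nu> p) = 1" "transpose (C p) = C p" "C p *v \<nu> p = 0"
      using fr p by (auto simp: boundary_frame_def)
    define B where "B = C p + (- \<eta>) *\<^sub>R tproj (\<nu> p)"
    define A where "A = (lam t * E t) *\<^sub>R outer (\<nu> p) + (lam t * e t) *\<^sub>R B"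
    have symA: "transpose A = A" unfolding A_def B_def by (rule transpose_radial_hessian[OF fp(2)])
    have radA: "(\<forall>j\<in>{1..k}. csig j A > 0)"
      "\<bar>csig k A - lam t ^ k * e t ^ (k - 1) * (\<theta> * csig (k - 1) (C p))\<bar> \<le> lam t ^ k * e t ^ (k - 1) * \<kappa>"
      using rad[OF \<eta>(2) fp(1) K[OF p] fp(3), of "E t" "e t" "lam t"] c0(3)[OF p] t1(2)[OF t(1,4)] Pt
      unfolding A_def B_def by blast+
    have up: "csig k A \<le> b z * f (u z)"
    proof (rule visc_super_jet[OF dom(1) z(1) u_super symA])
      show "csig j A > 0" if "j \<in> {1..k}" for j using radA(1) that by blast
      fix \<eta>' :: real assume \<eta>': "\<eta>' > 0"
      define \<rho> where "\<rho> = min t (t0 - t)"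
      have \<rho>: "\<rho> > 0" using t by (simp add: \<rho>_def)
      have in0: "0 < s \<and> s < t0" if "\<bar>s - t\<bar> < \<rho>" for s using that by (auto simp: \<rho>_def abs_less_iff)
      obtain r2 where r2: "r2 > 0" "\<And>h. norm h < r2 \<Longrightarrow> \<bar>\<nu> p \<bullet> h - (h \<bullet> (B *v h)) / 2\<bar> < \<rho> \<and>
          \<bar>g (t + (\<nu> p \<bullet> h - (h \<bullet> (B *v h)) / 2)) - g t - ((- (lam t * e t)) *\<^sub>R \<nu> p) \<bullet> h
            - (h \<bullet> (((lam t * E t) *\<^sub>R outer (\<nu> p) - (- (lam t * e t)) *\<^sub>R B) *v h)) / 2\<bar> \<le> \<eta>' * (h \<bullet> h) / 2"
        using composite_second_order[OF \<rho> _ _ fp(1) \<eta>', of t g "\<lambda>t. - (lam t * e t)" "lam t * E t" B] P in0 Pt by blast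
      have Aeq: "(lam t * E t) *\<^sub>R outer (\<nu> p) - (- (lam t * e t)) *\<^sub>R B = A" by (simp add: A_def)
      obtain r3 where r3: "r3 > 0" "ball z r3 \<subseteq> \<Omega>" using dom(1) z(1) open_contains_ball by blast
      define r' where "r' = min (min r r2) (min r3 (\<delta> - d z))"
      have r': "r' > 0" "r' \<le> r" "r' \<le> r2" "r' \<le> r3" "r' \<le> \<delta> - d z" using r r2 r3 t z(2) by (auto simp: r'_def)
      show "\<exists>r>0. \<forall>h. norm h < r \<longrightarrow> u (z + h) \<ge> u z + ((- (lam t * e t)) *\<^sub>R \<nu> p) \<bullet> h + (h \<bullet> (A *v h) - \<eta>' * (h \<bullet> h)) / 2"
      proof (intro exI[of _ r'] conjI allI impI r'(1))
        fix h :: "real^'n" assume h: "norm h < r'"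
        define l where "l = \<nu> p \<bullet> h - (h \<bullet> (B *v h)) / 2"
        have "norm h < r2" using h r'(3) by linarith
        note exp = r2(2)[OF this, unfolded Aeq, folded l_def]
        then have lr: "\<bar>l\<bar> < \<rho>" by simp
        from exp have ex: "g (t + l) \<ge> g t + ((- (lam t * e t)) *\<^sub>R \<nu> p) \<bullet> h + (h \<bullet> (A *v h) - \<eta>' * (h \<bullet> h)) / 2"
          unfolding abs_le_iff diff_divide_distrib by linarith
        have "z + h \<in> ball z r3" using h r'(4) by (simp add: dist_norm)
        then have zh: "z + h \<in> \<Omega>" using r3 by blast
        have dd: "\<bar>d (z + h) - d z\<bar> < r'" using abs_dist_bd_diff_le[of \<Omega> z h] h by linarith
        have dl: "d (z + h) \<le> d z + l"
          using r(2)[of h] h r'(2) unfolding l_def B_def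
          by (simp add: matrix_vector_mult_diff_rdistrib scaleR_matrix_vector_assoc[symmetric] inner_diff_right)
        have u1: "u (z + h) - g (d (z + h) + \<sigma>) \<ge> u z - g t"
          unfolding t_def using dd r'(5) by (intro mx[OF zh]) auto
        have "g (d (z + h) + \<sigma>) \<ge> g (t + l)"
          using in0[of "t + l"] lr dl d_pos[OF zh] \<sigma> by (intro anti) (auto simp: t_def)
        then show "u (z + h) \<ge> u z + ((- (lam t * e t)) *\<^sub>R \<nu> p) \<bullet> h + (h \<bullet> (A *v h) - \<eta>' * (h \<bullet> h)) / 2"
          using u1 ex by linarith
      qed
    qed
    have fu: "f (u z) > 0" using f_pos u_pos z(1) by simp
    have mz: "m (d z) > 0" using m_pos[OF d_pos[OF z(1)]] t t0 by simp
    have "b z * f (u z) < (bu + \<kappa>) * m (d z) ^ (k + 1) * f (u z)"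
      using \<delta>2(2)[OF z(1)] z(2) \<delta>(3) fu by (intro mult_strict_right_mono) auto
    also have "\<dots> = (bu + \<kappa>) * (m (d z) ^ (k + 1) * f (u z))" by (simp add: mult.assoc)
    also have "\<dots> \<le> (bu + \<kappa>) * (m t ^ (k + 1) * f (g t))"
    proof (rule mult_left_mono)
      show "bu + \<kappa> \<ge> 0" using b_pos \<kappa> by simp
      have "m (d z) \<le> m t" using t t0 d_pos[OF z(1)] by (intro m_mono) auto
      moreover have "f (u z) \<le> f (g t)" using z(3) u_pos z(1) by (intro f_mono) (auto simp: t_def)
      ultimately show "m (d z) ^ (k + 1) * f (u z) \<le> m t ^ (k + 1) * f (g t)"
        using mz fu by (intro mult_mono power_mono) auto
    qed
    also have "\<dots> \<le> (q * (\<theta> * l0 k \<Omega> - \<kappa>)) * (m t ^ (k + 1) * f (g t))"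
    proof (rule mult_right_mono)
      show "bu + \<kappa> \<le> q * (\<theta> * l0 k \<Omega> - \<kappa>)" using gap by simp
      have "m t > 0" using m_pos t t0 by simp
      then show "m t ^ (k + 1) * f (g t) \<ge> 0" using f_pos[of "g t"] Pt by simp
    qed
    also have "\<dots> = lam t ^ k * e t ^ (k - 1) * (\<theta> * l0 k \<Omega> - \<kappa>)"
      using Pt by (simp add: q_def)
    also have "\<dots> \<le> lam t ^ k * e t ^ (k - 1) * (\<theta> * csig (k - 1) (C p) - \<kappa>)"
      using l[OF p] \<theta>_pos by (intro mult_left_mono diff_right_mono w) auto
    also have "\<dots> \<le> csig k A"
      using radA(2) by (simp add: abs_le_iff algebra_simps)
    finally show False using up by simp
  qed
  then show ?thesis using \<delta>(1) unfolding g_def by blast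
qed

section \<open>Passage to the critical values of \<open>\<xi>\<close>\<close>

lemma root_identity:
  assumes "L > 0" "c > 0"
  defines "x \<equiv> (c / (L * \<theta>)) powr (1 / real (k + 1))"
  shows "x > 0" "x ^ (k + 1) * (\<theta> * L) = c"
proof -
  have p: "c / (L * \<theta>) > 0" using assms \<theta>_pos by simp
  show x: "x > 0" using assms(1,2) \<theta>_pos by (simp add: x_def)
  have "x ^ (k + 1) = x powr real (k + 1)" using x by (simp only: powr_realpow)
  also have "\<dots> = c / (L * \<theta>)" using assms(1,2) \<theta>_pos unfolding x_def powr_powr by (simp del: of_nat_add)
  finally show "x ^ (k + 1) * (\<theta> * L) = c" using assms \<theta>_pos by (simp add: field_simps)
qed

lemma profile_at_top:
  assumes "\<xi> > 0"
  shows "\<exists>\<delta>>0. \<forall>x\<in>\<Omega>. d x < \<delta> \<longrightarrow> varphi k f (\<xi> * M (d x)) > Z"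
proof -
  have "filterlim (\<lambda>t. varphi k f (\<xi> * M t)) at_top (at_right 0)" using profile[OF assms] by blast
  then have "\<forall>\<^sub>F t in at_right 0. varphi k f (\<xi> * M t) > Z" by (simp add: filterlim_at_top_dense)
  then obtain \<delta> where "\<delta> > 0" "\<And>t. 0 < t \<Longrightarrow> t < \<delta> \<Longrightarrow> varphi k f (\<xi> * M t) > Z"
    unfolding eventually_at_right_field by auto
  then show ?thesis using d_pos by blast
qed

lemma profile_ratio:
  assumes "0 < \<xi>" "\<xi> \<le> \<xi>'"
  shows "\<exists>\<delta>>0. \<forall>x\<in>\<Omega>. d x < \<delta> \<longrightarrow>
    varphi k f (\<xi> * M (d x)) \<le> (\<xi>' / \<xi>) powr (Cf + 1) * varphi k f (\<xi>' * M (d x))"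
proof -
  obtain t0 where t0: "t0 > 0" "\<And>t t'. 0 < t \<Longrightarrow> t \<le> t' \<Longrightarrow> t' < t0 \<Longrightarrow>
    varphi k f t \<le> (t' / t) powr (Cf + 1) * varphi k f t'"
    using varphi_ratio by blast
  have "((\<lambda>t. \<xi>' * M t) \<longlongrightarrow> \<xi>' * 0) (at_right 0)"
    using M_tendsto by (intro tendsto_intros) (simp add: filterlim_at)
  then have "\<forall>\<^sub>F t in at_right 0. \<xi>' * M t < t0" by (rule order_tendstoD) (use t0 in simp)
  then obtain \<delta> where \<delta>: "\<delta> > 0" "\<And>t. 0 < t \<Longrightarrow> t < \<delta> \<Longrightarrow> \<xi>' * M t < t0"
    unfolding eventually_at_right_field by auto
  have "varphi k f (\<xi> * M (d x)) \<le> (\<xi>' / \<xi>) powr (Cf + 1) * varphi k f (\<xi>' * M (d x))"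
    if x: "x \<in> \<Omega>" "d x < min \<delta> \<delta>0" for x
  proof -
    have Mp: "M (d x) > 0" using M_bounds(1)[OF d_pos[OF x(1)]] x(2) by simp
    have "varphi k f (\<xi> * M (d x)) \<le> ((\<xi>' * M (d x)) / (\<xi> * M (d x))) powr (Cf + 1) * varphi k f (\<xi>' * M (d x))"
      using Mp assms \<delta>(2)[OF d_pos[OF x(1)]] x(2) by (intro t0(2)) auto
    then show ?thesis using Mp by simp
  qed
  then show ?thesis using \<delta>(1) m1(1) by (intro exI[of _ "min \<delta> \<delta>0"]) simp
qed

text \<open>The strict estimate is applied at a \<open>\<xi>\<close> slightly below the critical
  value. A prescribed factor \<open>r > 1\<close> is split in two: \<open>sqrt r\<close> pays for
  the change of \<open>\<xi>\<close>, and the rest absorbs the additive constant because the profile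
  tends to infinity.\<close>

lemma limsup_estimate:
  defines "xil \<equiv> (bl / (L0 k \<Omega> * \<theta>)) powr (1 / real (k + 1))"
  shows "Limsup (bd_filter \<Omega>) (\<lambda>x. ereal (u x / varphi k f (xil * M (d x)))) \<le> 1"
  unfolding Limsup_le_iff
proof (intro allI impI)
  fix y :: ereal assume "1 < y"
  then obtain r where r: "1 < ereal r" "ereal r < y" using ereal_dense2 by blast
  then have r1: "r > 1" by simp
  have L: "L0 k \<Omega> > 0" by (rule L0_pos)
  note xil = root_identity[OF L b_pos(1), folded xil_def]
  \<comment> \<open>The exponent is chosen so that the factor in \<open>profile_ratio\<close> is
    exactly \<open>sqrt r\<close>.\<close>
  define \<xi> where "\<xi> = xil / r powr (1 / (2 * (Cf + 1)))"
  have rp: "r powr (1 / (2 * (Cf + 1))) > 1" using r1 f3(1) by (intro gr_one_powr) auto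
  have \<xi>: "\<xi> > 0" "\<xi> < xil"
    unfolding \<xi>_def using xil(1) rp by (simp_all add: divide_less_eq del: powr_gt_zero)
  have "\<xi> ^ (k + 1) * (\<theta> * L0 k \<Omega>) < xil ^ (k + 1) * (\<theta> * L0 k \<Omega>)"
    using \<xi> L \<theta>_pos by (intro mult_strict_right_mono power_strict_mono) auto
  then have "\<xi> ^ (k + 1) * (\<theta> * L0 k \<Omega>) < bl" by (simp only: xil(2))
  then obtain c \<delta>1 where 1: "\<delta>1 > 0" "\<And>x. x \<in> \<Omega> \<Longrightarrow> d x < \<delta>1 \<Longrightarrow> u x \<le> varphi k f (\<xi> * M (d x)) + c"
    using upper_estimate[OF \<xi>(1)] by blast
  obtain \<delta>2 where 2: "\<delta>2 > 0" "\<And>x. x \<in> \<Omega> \<Longrightarrow> d x < \<delta>2 \<Longrightarrow>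
      varphi k f (\<xi> * M (d x)) \<le> (xil / \<xi>) powr (Cf + 1) * varphi k f (xil * M (d x))"
    using profile_ratio[OF \<xi>(1) less_imp_le[OF \<xi>(2)]] by blast
  have sq: "(xil / \<xi>) powr (Cf + 1) = sqrt r"
  proof -
    have "xil / \<xi> = r powr (1 / (2 * (Cf + 1)))" using xil(1) by (simp add: \<xi>_def)
    then have "(xil / \<xi>) powr (Cf + 1) = r powr (1 / (2 * (Cf + 1)) * (Cf + 1))" by (simp only: powr_powr)
    also have "1 / (2 * (Cf + 1)) * (Cf + 1) = 1 / 2" using f3(1) by simp
    finally show ?thesis using r1 by (simp add: powr_half_sqrt)
  qed
  have sr: "sqrt r < r" using r1 by (simp add: real_less_lsqrt power2_eq_square)
  \<comment> \<open>Above this level the surplus \<open>(r - sqrt r) * v\<close> exceeds the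
    additive constant.\<close>
  define Z where "Z = max 0 (\<bar>c\<bar> / (r - sqrt r))"
  obtain \<delta>3 where 3: "\<delta>3 > 0" "\<And>x. x \<in> \<Omega> \<Longrightarrow> d x < \<delta>3 \<Longrightarrow> varphi k f (xil * M (d x)) > Z"
    using profile_at_top[OF xil(1)] by blast
  have "ereal (u x / varphi k f (xil * M (d x))) < y" if x: "x \<in> \<Omega>" "d x < min \<delta>1 (min \<delta>2 \<delta>3)" for x
  proof -
    define v where "v = varphi k f (xil * M (d x))"
    have v: "v > 0" "v > \<bar>c\<bar> / (r - sqrt r)" using 3(2)[OF x(1)] x(2) by (auto simp: v_def Z_def)
    have "u x \<le> sqrt r * v + c" using 1(2)[OF x(1)] 2(2)[OF x(1)] x(2) by (simp add: v_def sq)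
    also have "\<dots> < r * v" using v(2) sr by (simp add: field_simps abs_if split: if_splits)
    finally have "u x / v < r" using v(1) by (simp add: divide_less_eq)
    then have "ereal (u x / v) < ereal r" by simp
    then show ?thesis using r(2) unfolding v_def by (rule less_trans)
  qed
  then show "\<forall>\<^sub>F x in bd_filter \<Omega>. ereal (u x / varphi k f (xil * M (d x))) < y"
    unfolding ev_bd using 1(1) 2(1) 3(1) by (intro exI[of _ "min \<delta>1 (min \<delta>2 \<delta>3)"]) simp
qed

text \<open>The same splitting for a factor \<open>r < 1\<close>, with \<open>\<xi>\<close> slightly
  above the critical value.\<close>

lemma liminf_estimate:
  defines "xiu \<equiv> (bu / (l0 k \<Omega> * \<theta>)) powr (1 / real (k + 1))"
  shows "1 \<le> Liminf (bd_filter \<Omega>) (\<lambda>x. ereal (u x / varphi k f (xiu * M (d x))))"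
  unfolding le_Liminf_iff
proof (intro allI impI)
  fix y :: ereal assume "y < 1"
  \<comment> \<open>Comparison with 0 ensures a positive \<open>r\<close>, as needed for its powers
    and square root, even when \<open>y\<close> is negative or minus infinity.\<close>
  then have "max y 0 < 1" by simp
  then obtain r where r: "max y 0 < ereal r" "ereal r < 1" using ereal_dense2 by blast
  then have r1: "0 < r" "r < 1" "y < ereal r" by auto
  have L: "l0 k \<Omega> > 0" by (rule l0_pos)
  note xiu = root_identity[OF L b_pos(2), folded xiu_def]
  define s where "s = (1 / r) powr (1 / (2 * (Cf + 1)))"
  have s: "s > 1" unfolding s_def using r1 f3(1) by (intro gr_one_powr) auto
  define \<xi> where "\<xi> = xiu * s"
  have \<xi>: "\<xi> > xiu" "\<xi> > 0" using xiu(1) s by (auto simp: \<xi>_def)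
  have "\<xi> ^ (k + 1) * (\<theta> * l0 k \<Omega>) > xiu ^ (k + 1) * (\<theta> * l0 k \<Omega>)"
    using \<xi> xiu L \<theta>_pos by (intro mult_strict_right_mono power_strict_mono) auto
  then have "\<xi> ^ (k + 1) * (\<theta> * l0 k \<Omega>) > bu" by (simp only: xiu(2))
  then obtain c \<delta>1 where 1: "\<delta>1 > 0" "\<And>x. x \<in> \<Omega> \<Longrightarrow> d x < \<delta>1 \<Longrightarrow> u x \<ge> varphi k f (\<xi> * M (d x)) - c"
    using lower_estimate[OF \<xi>(2)] by blast
  obtain \<delta>2 where 2: "\<delta>2 > 0" "\<And>x. x \<in> \<Omega> \<Longrightarrow> d x < \<delta>2 \<Longrightarrow>
      varphi k f (xiu * M (d x)) \<le> (\<xi> / xiu) powr (Cf + 1) * varphi k f (\<xi> * M (d x))"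
    using profile_ratio[OF xiu(1) less_imp_le[OF \<xi>(1)]] by blast
  have sq: "(\<xi> / xiu) powr (Cf + 1) = 1 / sqrt r"
  proof -
    have "\<xi> / xiu = (1 / r) powr (1 / (2 * (Cf + 1)))" using xiu(1) by (simp add: \<xi>_def s_def)
    then have "(\<xi> / xiu) powr (Cf + 1) = (1 / r) powr (1 / (2 * (Cf + 1)) * (Cf + 1))" by (simp only: powr_powr)
    also have "1 / (2 * (Cf + 1)) * (Cf + 1) = 1 / 2" using f3(1) by simp
    finally show ?thesis using r1 by (simp add: powr_half_sqrt real_sqrt_divide)
  qed
  have sr: "sqrt r > r" using r1 by (simp add: real_less_rsqrt power2_eq_square)
  have sr0: "sqrt r > 0" using r1 by simp
  define Z where "Z = max 0 (\<bar>c\<bar> / (sqrt r - r))"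
  obtain \<delta>3 where 3: "\<delta>3 > 0" "\<And>x. x \<in> \<Omega> \<Longrightarrow> d x < \<delta>3 \<Longrightarrow> varphi k f (xiu * M (d x)) > Z"
    using profile_at_top[OF xiu(1)] by blast
  have "y < ereal (u x / varphi k f (xiu * M (d x)))" if x: "x \<in> \<Omega>" "d x < min \<delta>1 (min \<delta>2 \<delta>3)" for x
  proof -
    define v where "v = varphi k f (xiu * M (d x))"
    have v: "v > 0" "v > \<bar>c\<bar> / (sqrt r - r)" using 3(2)[OF x(1)] x(2) by (auto simp: v_def Z_def)
    have "v \<le> varphi k f (\<xi> * M (d x)) / sqrt r" using 2(2)[OF x(1)] x(2) by (simp add: v_def sq)
    then have "sqrt r * v \<le> varphi k f (\<xi> * M (d x))" using sr0 by (simp add: field_simps)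
    then have "u x \<ge> sqrt r * v - c" using 1(2)[OF x(1)] x(2) by simp
    moreover have "sqrt r * v - c > r * v" using v(2) sr by (simp add: field_simps abs_if split: if_splits)
    ultimately have "u x / v > r" using v(1) by (simp add: less_divide_eq)
    then have "ereal r < ereal (u x / v)" by simp
    with r1(3) show ?thesis unfolding v_def by (rule less_trans)
  qed
  then show "\<forall>\<^sub>F x in bd_filter \<Omega>. y < ereal (u x / varphi k f (xiu * M (d x)))"
    unfolding ev_bd using 1(1) 2(1) 3(1) by (intro exI[of _ "min \<delta>1 (min \<delta>2 \<delta>3)"]) simp
qed

end

theorem theorem1p2:
  fixes \<Omega> :: "(real^'n) set"
    and k :: nat
    and f :: "real \<Rightarrow> real"
    and b :: "real^'n \<Rightarrow> real"
    and m M :: "real \<Rightarrow> real"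
    and \<delta>0 bl bu Cf Cm :: real
    and u :: "real^'n \<Rightarrow> real"
  assumes n2: "CARD('n) \<ge> 2"
    and k_range: "1 \<le> k" "k \<le> CARD('n)"
    and dom: "open \<Omega>" "connected \<Omega>" "bounded \<Omega>" "\<Omega> \<noteq> {}"
    and conv: "strictly_convex_k (k - 1) \<Omega>"
    and bdry: "C31_boundary \<Omega>"
    \<comment> \<open>(f1)\<close>
    and f1: "f C1_differentiable_on {0<..}" "\<forall>s>0. f s > 0" "mono_on {0<..} f"
    \<comment> \<open>(f2)\<close>
    and f2: "\<forall>s>0. (\<lambda>\<tau>. 1 / Hf k f \<tau>) integrable_on {s..}"
    \<comment> \<open>(f3)\<close>
    and f3: "Cf > 0" "((\<lambda>s. deriv (Hf k f) s * Phi k f s) \<longlongrightarrow> Cf) at_top"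
    \<comment> \<open>(b1)\<close>
    and b1: "C11_closure \<Omega> b" "\<forall>x\<in>\<Omega>. b x > 0"
    \<comment> \<open>(b2)\<close>
    and b2: "\<delta>0 > 0" "m C1_differentiable_on {0<..<\<delta>0}"
      "\<forall>t\<in>{0<..<\<delta>0}. m t > 0" "mono_on {0<..<\<delta>0} m"
      "bl > 0" "bu > 0"
      "Liminf (bd_filter \<Omega>) (\<lambda>x. ereal (b x / m (dist_bd \<Omega> x) ^ (k + 1))) = ereal bl"
      "Limsup (bd_filter \<Omega>) (\<lambda>x. ereal (b x / m (dist_bd \<Omega> x) ^ (k + 1))) = ereal bu"
      "\<forall>t\<in>{0<..<\<delta>0}. m integrable_on {0..t}"
      "\<forall>t\<in>{0<..<\<delta>0}. M t = integral {0..t} m"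
      "Cm \<ge> 0" "((\<lambda>t. deriv (\<lambda>s. M s / m s) t) \<longlongrightarrow> Cm) (at_right 0)"
    and Cfm: "Cf > 1 - Cm"
    \<comment> \<open>u is a positive viscosity solution blowing up at the boundary\<close>
    and u_pos: "\<forall>x\<in>\<Omega>. u x > 0"
    and u_sol: "visc_sol k b f \<Omega> u"
    and u_bd: "filterlim u at_top (bd_filter \<Omega>)"
  shows
    "let xil = (bl / (L0 k \<Omega> * (1 - (1 - Cm) / Cf))) powr (1 / real (k + 1));
         xiu = (bu / (l0 k \<Omega> * (1 - (1 - Cm) / Cf))) powr (1 / real (k + 1))
     in 1 \<le> Liminf (bd_filter \<Omega>) (\<lambda>x. ereal (u x / varphi k f (xiu * M (dist_bd \<Omega> x))))
      \<and> Limsup (bd_filter \<Omega>) (\<lambda>x. ereal (u x / varphi k f (xil * M (dist_bd \<Omega> x)))) \<le> 1"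
proof -
  interpret large_solution k f Cf m M \<delta>0 Cm \<Omega> b u bl bu
    by unfold_locales fact+
  show ?thesis
    using liminf_estimate limsup_estimate by (simp add: Let_def \<theta>_def)
qed

end
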